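(* Let $(M,\sigma,g)$ be an almost paraquaternionic Hermitian manifold, let $\pi:TM\to M$ be its tangent bundle, and endow $TM$ with the Sasaki metric $G$ of $g$. Then the almost paraquaternionic structure $\sigma$ induces, via $\pi$, an almost paraquaternionic structure $\tilde\sigma$ on $TM$ (the one described in the context), such that $(TM,\tilde\sigma,G)$ is an almost paraquaternionic Hermitian manifold, and $\pi:TM\to M$ is a paraquaternionic submersion.
   Context: Put $\tau_1=\tau_2=-1$, $\tau_3=1$. An almost paraquaternionic structure on a manifold $M$ is a rank-three subbundle $\sigma$ of $\mathrm{End}(TM)$ such that each $x\in M$ has an open neighbourhood $U$ carrying a triple $(J_1,J_2,J_3)$ of $(1,1)$-tensor fields on $U$ with: (i) $((J_1)_y,(J_2)_y,(J_3)_y)$ spans $\sigma_y$ for every $y\in U$; (ii) $J_a^2=-\tau_a I$ for $a\in\{1,2,3\}$; (iii) $J_aJ_b=\tau_cJ_c=-J_bJ_a$ for every cyclic permutation $(a,b,c)$ of $(1,2,3)$. Such a triple is called a local basis of $\sigma$ on $U$, and $(M,\sigma)$ is an almost paraquaternionic manifold. An almost paraquaternionic Hermitian manifold $(M,\sigma,g)$ is an almost paraquaternionic manifold with a semi-Riemannian metric $g$ such that $g(X,J_aY)+g(J_aX,Y)=0$ for every local basis $(J_a)$ of $\sigma$ on an open set $U$ and all $X,Y\in\Gamma(TU)$. A smooth map $\pi:(N,\sigma)\to(N',\sigma')$ between almost paraquaternionic manifolds is $(\sigma,\sigma')$-paraholomorphic if for any $x\in N$ and for any open neighbourhood $U$ of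 $x$ on which a local basis $(J_a)_{a=1,2,3}$ of $\sigma$ is defined, there exists an open neighbourhood $U'$ of $\pi(x)$, on which a local basis $(J'_a)_{a=1,2,3}$ of $\sigma'$ is defined, such that $(J'_a)_{\pi(y)}\circ(d\pi)_y=(d\pi)_y\circ(J_a)_y$ for any $y\in U\cap\pi^{-1}(U')$ and any $a\in\{1,2,3\}$. A semi-Riemannian submersion is a surjective smooth submersion whose fibers are non-degenerate and whose differential preserves scalar products of horizontal vectors (vectors orthogonal to the fibers). A paraquaternionic submersion between almost paraquaternionic Hermitian manifolds is a smooth map that is both a semi-Riemannian submersion and $(\sigma,\sigma')$-paraholomorphic. For a vector field $X$ on (an open subset of) $M$, $X^v$ denotes its vertical lift to $TM$ and $X^h$ its horizontal lift with respect to the Levi-Civita connection of $g$. The Sasaki metric $G$ on $TM$ is the semi-Riemannian metric determined by $G(X^v,Y^v)=g(X,Y)\circ\pi$, $G(X^h,Y^h)=g(X,Y)\circ\pi$, $G(X^v,Y^h)=0$. The structure $\tilde\sigma$: choose an open covering $(U_i)_{i\in I}$ of $M$ such that on each $U_i$ a local basis $(J^i_a)_{a=1,2,3}$ of $\sigma$ is defined, and define $(1,1)$-tensor fields $\tilde J^i_a$ on $\pi^{-1}(U_i)$ by $\tilde J^i_a(X^v)=(J^i_aX)^v$ and $\tilde J^i_a(X^h)=(J^i_aX)^h$ for all $X\in\Gamma(TU_i)$ and $a\in\{1,2,3\}$; then $\tilde\sigma$ is the subbundle of $\mathrm{End}(T(TM))$ spanned over each $\pi^{-1}(U_i)$ by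 $(\tilde J^i_1,\tilde J^i_2,\tilde J^i_3)$.
   Formalization: Paraholomorphic is corrected: near x the given local basis J may be replaced by a local basis K with K_x = J_x that is π-related to some J'. As literally defined the claim fails, since a lifted basis can be rotated by a function non-constant along the fibres. *)

theory Defs
  imports "HOL-Analysis.Analysis"
begin

section \<open>Smooth maps between Euclidean spaces\<close>

text \<open>On an open subset of a Euclidean space this is the usual notion of class \<open>C\<^sup>k\<close>:
  a function is \<open>C\<^sup>k\<^sup>+\<^sup>1\<close> iff it is differentiable and all its directional
  derivatives are \<open>C\<^sup>k\<close>.\<close>

primrec Ck_on :: "nat \<Rightarrow> 'a::euclidean_space set \<Rightarrow> ('a \<Rightarrow> 'b::real_normed_vector) \<Rightarrow> bool" where
  "Ck_on 0 S f \<longleftrightarrow> continuous_on S f"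
| "Ck_on (Suc k) S f \<longleftrightarrow>
     (\<forall>x\<in>S. f differentiable (at x)) \<and> (\<forall>v. Ck_on k S (\<lambda>x. frechet_derivative f (at x) v))"

definition smooth_on :: "'a::euclidean_space set \<Rightarrow> ('a \<Rightarrow> 'b::real_normed_vector) \<Rightarrow> bool" where
  "smooth_on S f \<longleftrightarrow> (\<forall>k. Ck_on k S f)"


section \<open>Smooth manifolds\<close>

text \<open>A chart is a pair of a domain and a coordinate map (whose values outside the domain are
  irrelevant).  A manifold modelled on \<open>'e\<close> is given by an atlas, not necessarily maximal, together
  with a preferred chart around each point.  The preferred charts only serve to name tangent
  vectors: a tangent vector at \<open>p\<close> is represented by its components in the preferred chart at \<open>p\<close>,
  so that every tangent space is the type \<open>'e\<close>, and its components in any other chart are obtained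
  by means of the derivative of the transition map.\<close>

type_synonym ('m, 'e) chart = "'m set \<times> ('m \<Rightarrow> 'e)"

record ('m, 'e) mfd =
  charts :: "('m, 'e) chart set"
  chart_at :: "'m \<Rightarrow> ('m, 'e) chart"

abbreviation cdom :: "('m, 'e) chart \<Rightarrow> 'm set" where "cdom \<equiv> fst"

abbreviation cmap :: "('m, 'e) chart \<Rightarrow> 'm \<Rightarrow> 'e" where "cmap \<equiv> snd"

definition cinv :: "('m, 'e) chart \<Rightarrow> 'e \<Rightarrow> 'm" where
  "cinv c = inv_into (cdom c) (cmap c)"

definition points :: "('m, 'e) mfd \<Rightarrow> 'm set" where
  "points M = (\<Union>c\<in>charts M. cdom c)"

definition mtop :: "('m, 'e::euclidean_space) mfd \<Rightarrow> 'm topology" where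
  "mtop M = topology (\<lambda>W. W \<subseteq> points M \<and> (\<forall>c\<in>charts M. open (cmap c ` (W \<inter> cdom c))))"

definition smooth_manifold :: "('m, 'e::euclidean_space) mfd \<Rightarrow> bool" where
  "smooth_manifold M \<longleftrightarrow>
     (\<forall>c\<in>charts M. inj_on (cmap c) (cdom c) \<and> open (cmap c ` cdom c)) \<and>
     (\<forall>c\<in>charts M. \<forall>d\<in>charts M. open (cmap c ` (cdom c \<inter> cdom d)) \<and>
        smooth_on (cmap c ` (cdom c \<inter> cdom d)) (cmap d \<circ> cinv c)) \<and>
     (\<forall>p\<in>points M. chart_at M p \<in> charts M \<and> p \<in> cdom (chart_at M p)) \<and>
     Hausdorff_space (mtop M) \<and> second_countable (mtop M)"

definition smooth_map ::
  "('m, 'e::euclidean_space) mfd \<Rightarrow> ('n, 'f::euclidean_space) mfd \<Rightarrow> ('m \<Rightarrow> 'n) \<Rightarrow> bool" where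
  "smooth_map M N f \<longleftrightarrow> continuous_map (mtop M) (mtop N) f \<and>
     (\<forall>c\<in>charts M. \<forall>d\<in>charts N.
        smooth_on (cmap c ` (cdom c \<inter> f -` cdom d)) (cmap d \<circ> f \<circ> cinv c))"

definition smooth_fun :: "('m, 'e::euclidean_space) mfd \<Rightarrow> 'm set \<Rightarrow> ('m \<Rightarrow> real) \<Rightarrow> bool" where
  "smooth_fun M U f \<longleftrightarrow> (\<forall>c\<in>charts M. smooth_on (cmap c ` (cdom c \<inter> U)) (f \<circ> cinv c))"


section \<open>Tangent vectors, vector fields, tensor fields\<close>

definition coord_change ::
  "('m, 'e::euclidean_space) chart \<Rightarrow> ('m, 'e) chart \<Rightarrow> 'm \<Rightarrow> 'e \<Rightarrow> 'e" where
  "coord_change c d p = frechet_derivative (cmap d \<circ> cinv c) (at (cmap c p))"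

text \<open>\<open>to_chart M c p\<close> maps a tangent vector at \<open>p\<close> to its components in the chart \<open>c\<close>, and
  \<open>of_chart M c p\<close> is the inverse operation.\<close>

definition to_chart :: "('m, 'e::euclidean_space) mfd \<Rightarrow> ('m, 'e) chart \<Rightarrow> 'm \<Rightarrow> 'e \<Rightarrow> 'e" where
  "to_chart M c p = coord_change (chart_at M p) c p"

definition of_chart :: "('m, 'e::euclidean_space) mfd \<Rightarrow> ('m, 'e) chart \<Rightarrow> 'm \<Rightarrow> 'e \<Rightarrow> 'e" where
  "of_chart M c p = coord_change c (chart_at M p) p"

definition mderiv ::
  "('m, 'e::euclidean_space) mfd \<Rightarrow> ('n, 'f::euclidean_space) mfd \<Rightarrow> ('m \<Rightarrow> 'n) \<Rightarrow> 'm \<Rightarrow> 'e \<Rightarrow> 'f"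
  where "mderiv M N f p =
    frechet_derivative (cmap (chart_at N (f p)) \<circ> f \<circ> cinv (chart_at M p)) (at (cmap (chart_at M p) p))"

definition along :: "('m, 'e::euclidean_space) mfd \<Rightarrow> ('m \<Rightarrow> 'e) \<Rightarrow> ('m \<Rightarrow> real) \<Rightarrow> 'm \<Rightarrow> real" where
  "along M X f p = frechet_derivative (f \<circ> cinv (chart_at M p)) (at (cmap (chart_at M p) p)) (X p)"

definition vector_field :: "('m, 'e::euclidean_space) mfd \<Rightarrow> 'm set \<Rightarrow> ('m \<Rightarrow> 'e) \<Rightarrow> bool" where
  "vector_field M U X \<longleftrightarrow>
     (\<forall>c\<in>charts M. smooth_on (cmap c ` (cdom c \<inter> U)) ((\<lambda>p. to_chart M c p (X p)) \<circ> cinv c))"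

definition tensor_field11 ::
  "('m, 'e::euclidean_space) mfd \<Rightarrow> 'm set \<Rightarrow> ('m \<Rightarrow> 'e \<Rightarrow>\<^sub>L 'e) \<Rightarrow> bool" where
  "tensor_field11 M U J \<longleftrightarrow>
     (\<forall>c\<in>charts M. \<forall>v. smooth_on (cmap c ` (cdom c \<inter> U))
        ((\<lambda>p. to_chart M c p (J p (of_chart M c p v))) \<circ> cinv c))"

text \<open>The manifold structure of the tangent bundle; its projection is \<open>fst\<close>.\<close>

definition lift_chart ::
  "('m, 'e::euclidean_space) mfd \<Rightarrow> ('m, 'e) chart \<Rightarrow> ('m \<times> 'e, 'e \<times> 'e) chart" where
  "lift_chart M c = (cdom c \<times> UNIV, \<lambda>(p, v). (cmap c p, to_chart M c p v))"

definition tangent_bundle :: "('m, 'e::euclidean_space) mfd \<Rightarrow> ('m \<times> 'e, 'e \<times> 'e) mfd" where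
  "tangent_bundle M =
     \<lparr> charts = lift_chart M ` charts M, chart_at = (\<lambda>(p, v). lift_chart M (chart_at M p)) \<rparr>"


section \<open>Semi-Riemannian metrics and the Levi-Civita connection\<close>

definition form_index :: "('e::euclidean_space \<Rightarrow> 'e \<Rightarrow> real) \<Rightarrow> nat" where
  "form_index b = Max {dim W |W. subspace W \<and> (\<forall>w\<in>W - {0}. b w w < 0)}"

definition semi_riemannian_metric ::
  "('m, 'e::euclidean_space) mfd \<Rightarrow> ('m \<Rightarrow> 'e \<Rightarrow> 'e \<Rightarrow> real) \<Rightarrow> bool" where
  "semi_riemannian_metric M g \<longleftrightarrow>
     (\<forall>p\<in>points M. bilinear (g p) \<and> (\<forall>v w. g p v w = g p w v) \<and>
        (\<forall>v. (\<forall>w. g p v w = 0) \<longrightarrow> v = 0)) \<and>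
     (\<forall>c\<in>charts M. \<forall>v w. smooth_on (cmap c ` cdom c)
        ((\<lambda>p. g p (of_chart M c p v) (of_chart M c p w)) \<circ> cinv c)) \<and>
     (\<exists>k. \<forall>p\<in>points M. form_index (g p) = k)"

text \<open>A connection acts on the vector fields on any open set, compatibly with restrictions to
  smaller open sets.\<close>

definition affine_connection ::
  "('m, 'e::euclidean_space) mfd \<Rightarrow> (('m \<Rightarrow> 'e) \<Rightarrow> ('m \<Rightarrow> 'e) \<Rightarrow> 'm \<Rightarrow> 'e) \<Rightarrow> bool" where
  "affine_connection M D \<longleftrightarrow>
     (\<forall>U. openin (mtop M) U \<longrightarrow>
       (\<forall>X Y. vector_field M U X \<and> vector_field M U Y \<longrightarrow> vector_field M U (D X Y)) \<and>
       (\<forall>X X' Y Y'. vector_field M U X \<and> vector_field M U Y \<and>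
          (\<forall>p\<in>U. X' p = X p \<and> Y' p = Y p) \<longrightarrow> (\<forall>p\<in>U. D X' Y' p = D X Y p)) \<and>
       (\<forall>X X' Y. vector_field M U X \<and> vector_field M U X' \<and> vector_field M U Y \<longrightarrow>
          (\<forall>p\<in>U. D (\<lambda>q. X q + X' q) Y p = D X Y p + D X' Y p)) \<and>
       (\<forall>f X Y. smooth_fun M U f \<and> vector_field M U X \<and> vector_field M U Y \<longrightarrow>
          (\<forall>p\<in>U. D (\<lambda>q. f q *\<^sub>R X q) Y p = f p *\<^sub>R D X Y p)) \<and>
       (\<forall>X Y Y'. vector_field M U X \<and> vector_field M U Y \<and> vector_field M U Y' \<longrightarrow>
          (\<forall>p\<in>U. D X (\<lambda>q. Y q + Y' q) p = D X Y p + D X Y' p)) \<and>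
       (\<forall>f X Y. smooth_fun M U f \<and> vector_field M U X \<and> vector_field M U Y \<longrightarrow>
          (\<forall>p\<in>U. D X (\<lambda>q. f q *\<^sub>R Y q) p = along M X f p *\<^sub>R Y p + f p *\<^sub>R D X Y p)))"

text \<open>Vanishing of the torsion is expressed by letting the vector field
  \<open>D X Y - D Y X - [X, Y]\<close> act on functions.\<close>

definition is_levi_civita ::
  "('m, 'e::euclidean_space) mfd \<Rightarrow> ('m \<Rightarrow> 'e \<Rightarrow> 'e \<Rightarrow> real) \<Rightarrow>
     (('m \<Rightarrow> 'e) \<Rightarrow> ('m \<Rightarrow> 'e) \<Rightarrow> 'm \<Rightarrow> 'e) \<Rightarrow> bool" where
  "is_levi_civita M g D \<longleftrightarrow> affine_connection M D \<and>
     (\<forall>U. openin (mtop M) U \<longrightarrow>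
       (\<forall>X Y f. vector_field M U X \<and> vector_field M U Y \<and> smooth_fun M U f \<longrightarrow>
          (\<forall>p\<in>U. along M (\<lambda>q. D X Y q - D Y X q) f p =
             along M X (along M Y f) p - along M Y (along M X f) p)) \<and>
       (\<forall>X Y Z. vector_field M U X \<and> vector_field M U Y \<and> vector_field M U Z \<longrightarrow>
          (\<forall>p\<in>U. along M X (\<lambda>q. g q (Y q) (Z q)) p =
             g p (D X Y p) (Z p) + g p (Y p) (D X Z p))))"

text \<open>By the fundamental theorem of semi-Riemannian geometry such a \<open>D\<close> exists and its values
  \<open>D X Y p\<close> are unique for vector fields \<open>X\<close> and \<open>Y\<close> on a neighbourhood of \<open>p\<close>; only such values
  are used below.\<close>

definition levi_civita ::
  "('m, 'e::euclidean_space) mfd \<Rightarrow> ('m \<Rightarrow> 'e \<Rightarrow> 'e \<Rightarrow> real) \<Rightarrow>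
     ('m \<Rightarrow> 'e) \<Rightarrow> ('m \<Rightarrow> 'e) \<Rightarrow> 'm \<Rightarrow> 'e" where
  "levi_civita M g = (SOME D. is_levi_civita M g D)"


section \<open>Vertical and horizontal lifts, Sasaki metric\<close>

text \<open>The lifts to \<open>\<xi>\<close> of a tangent vector at the base point of \<open>\<xi>\<close>.  For a vector field \<open>X\<close> the
  lifted fields are \<open>X\<^sup>v \<xi> = vlift M \<xi> (X (fst \<xi>))\<close> and \<open>X\<^sup>h \<xi> = hlift M g \<xi> (X (fst \<xi>))\<close>.
  The vertical lift of \<open>v\<close> is the velocity at \<open>0\<close> of the curve \<open>u + t v\<close> in the tangent space
  at \<open>p\<close>.\<close>

definition vlift :: "('m, 'e::euclidean_space) mfd \<Rightarrow> 'm \<times> 'e \<Rightarrow> 'e \<Rightarrow> 'e \<times> 'e" where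
  "vlift M = (\<lambda>(p, u) v. vector_derivative
     (\<lambda>t. cmap (chart_at (tangent_bundle M) (p, u)) (p, u + t *\<^sub>R v)) (at 0))"

text \<open>The horizontal lift is characterised by \<open>dZ(X) = X\<^sup>h + (\<nabla>\<^sub>X Z)\<^sup>v\<close> along \<open>Z\<close>, for every local
  section \<open>Z\<close> of the tangent bundle.\<close>

definition hlift ::
  "('m, 'e::euclidean_space) mfd \<Rightarrow> ('m \<Rightarrow> 'e \<Rightarrow> 'e \<Rightarrow> real) \<Rightarrow> 'm \<times> 'e \<Rightarrow> 'e \<Rightarrow> 'e \<times> 'e" where
  "hlift M g = (\<lambda>(p, u) w. THE \<eta>. \<exists>U X Z. openin (mtop M) U \<and> p \<in> U \<and>
     vector_field M U X \<and> vector_field M U Z \<and> X p = w \<and> Z p = u \<and>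
     \<eta> = mderiv M (tangent_bundle M) (\<lambda>q. (q, Z q)) p w - vlift M (p, u) (levi_civita M g X Z p))"

definition sasaki_metric ::
  "('m, 'e::euclidean_space) mfd \<Rightarrow> ('m \<Rightarrow> 'e \<Rightarrow> 'e \<Rightarrow> real) \<Rightarrow>
     'm \<times> 'e \<Rightarrow> 'e \<times> 'e \<Rightarrow> 'e \<times> 'e \<Rightarrow> real" where
  "sasaki_metric M g \<xi> = (THE b. bilinear b \<and> (\<forall>\<eta> \<zeta>. b \<eta> \<zeta> = b \<zeta> \<eta>) \<and>
     (\<forall>v w. b (vlift M \<xi> v) (vlift M \<xi> w) = g (fst \<xi>) v w \<and>
            b (hlift M g \<xi> v) (hlift M g \<xi> w) = g (fst \<xi>) v w \<and>
            b (vlift M \<xi> v) (hlift M g \<xi> w) = 0))"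

definition lift_endo ::
  "('m, 'e::euclidean_space) mfd \<Rightarrow> ('m \<Rightarrow> 'e \<Rightarrow> 'e \<Rightarrow> real) \<Rightarrow>
     ('m \<Rightarrow> 'e \<Rightarrow>\<^sub>L 'e) \<Rightarrow> 'm \<times> 'e \<Rightarrow> ('e \<times> 'e) \<Rightarrow>\<^sub>L ('e \<times> 'e)" where
  "lift_endo M g J \<xi> = (THE B :: ('e \<times> 'e) \<Rightarrow>\<^sub>L ('e \<times> 'e). \<forall>v. B (vlift M \<xi> v) = vlift M \<xi> (J (fst \<xi>) v) \<and>
     B (hlift M g \<xi> v) = hlift M g \<xi> (J (fst \<xi>) v))"


section \<open>Almost paraquaternionic structures\<close>

definition \<tau> :: "nat \<Rightarrow> real" where
  "\<tau> a = (if a = 3 then 1 else - 1)"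

text \<open>The members of a local basis are indexed by 1, 2, 3; other indices are irrelevant.\<close>

definition local_basis ::
  "('m, 'e::euclidean_space) mfd \<Rightarrow> ('m \<Rightarrow> ('e \<Rightarrow>\<^sub>L 'e) set) \<Rightarrow> 'm set \<Rightarrow>
     (nat \<Rightarrow> 'm \<Rightarrow> 'e \<Rightarrow>\<^sub>L 'e) \<Rightarrow> bool" where
  "local_basis M \<sigma> U J \<longleftrightarrow> openin (mtop M) U \<and>
     (\<forall>a\<in>{1, 2, 3}. tensor_field11 M U (J a)) \<and>
     (\<forall>y\<in>U. span {J 1 y, J 2 y, J 3 y} = \<sigma> y) \<and>
     (\<forall>y\<in>U. \<forall>a\<in>{1, 2, 3}. J a y o\<^sub>L J a y = - \<tau> a *\<^sub>R id_blinfun) \<and>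
     (\<forall>y\<in>U. \<forall>(a, b, c)\<in>{(1, 2, 3), (2, 3, 1), (3, 1, 2)}.
        J a y o\<^sub>L J b y = \<tau> c *\<^sub>R J c y \<and> \<tau> c *\<^sub>R J c y = - (J b y o\<^sub>L J a y))"

text \<open>A subbundle is given by its fibres; its local smooth frames are the local bases.\<close>

definition almost_paraquaternionic ::
  "('m, 'e::euclidean_space) mfd \<Rightarrow> ('m \<Rightarrow> ('e \<Rightarrow>\<^sub>L 'e) set) \<Rightarrow> bool" where
  "almost_paraquaternionic M \<sigma> \<longleftrightarrow> smooth_manifold M \<and>
     (\<forall>x\<in>points M. subspace (\<sigma> x) \<and> dim (\<sigma> x) = 3) \<and>
     (\<forall>x\<in>points M. \<exists>U J. x \<in> U \<and> local_basis M \<sigma> U J)"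

definition almost_paraquaternionic_hermitian ::
  "('m, 'e::euclidean_space) mfd \<Rightarrow> ('m \<Rightarrow> ('e \<Rightarrow>\<^sub>L 'e) set) \<Rightarrow>
     ('m \<Rightarrow> 'e \<Rightarrow> 'e \<Rightarrow> real) \<Rightarrow> bool" where
  "almost_paraquaternionic_hermitian M \<sigma> g \<longleftrightarrow>
     almost_paraquaternionic M \<sigma> \<and> semi_riemannian_metric M g \<and>
     (\<forall>U J. local_basis M \<sigma> U J \<longrightarrow>
        (\<forall>X Y. vector_field M U X \<and> vector_field M U Y \<longrightarrow>
           (\<forall>a\<in>{1, 2, 3}. \<forall>p\<in>U. g p (X p) (J a p (Y p)) + g p (J a p (X p)) (Y p) = 0)))"

text \<open>The requirement on \<open>\<pi>\<close> is that each local basis \<open>J\<close> can be adjusted near \<open>x\<close>, without changing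
  it at the point \<open>x\<close>, to a local basis \<open>K\<close> which is \<open>\<pi>\<close>-related to a local basis \<open>J'\<close> of the target.
  One cannot demand that \<open>J\<close> itself is \<open>\<pi>\<close>-related to some \<open>J'\<close>: a local basis may be rotated by a
  function which is not constant along the fibres of \<open>\<pi>\<close>, and then no such \<open>J'\<close> exists.\<close>

definition paraholomorphic ::
  "('n, 'f::euclidean_space) mfd \<Rightarrow> ('n \<Rightarrow> ('f \<Rightarrow>\<^sub>L 'f) set) \<Rightarrow>
     ('m, 'e::euclidean_space) mfd \<Rightarrow> ('m \<Rightarrow> ('e \<Rightarrow>\<^sub>L 'e) set) \<Rightarrow> ('n \<Rightarrow> 'm) \<Rightarrow> bool" where
  "paraholomorphic N \<sigma> N' \<sigma>' \<pi> \<longleftrightarrow> smooth_map N N' \<pi> \<and>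
     (\<forall>x\<in>points N. \<forall>U J. x \<in> U \<and> local_basis N \<sigma> U J \<longrightarrow>
        (\<exists>U' J' K. \<pi> x \<in> U' \<and> local_basis N' \<sigma>' U' J' \<and>
           local_basis N \<sigma> (U \<inter> \<pi> -` U') K \<and> (\<forall>a\<in>{1, 2, 3}. K a x = J a x) \<and>
           (\<forall>y\<in>U \<inter> \<pi> -` U'. \<forall>a\<in>{1, 2, 3}.
              blinfun_apply (J' a (\<pi> y)) \<circ> mderiv N N' \<pi> y =
              mderiv N N' \<pi> y \<circ> blinfun_apply (K a y))))"

definition semi_riemannian_submersion ::
  "('n, 'f::euclidean_space) mfd \<Rightarrow> ('n \<Rightarrow> 'f \<Rightarrow> 'f \<Rightarrow> real) \<Rightarrow>
     ('m, 'e::euclidean_space) mfd \<Rightarrow> ('m \<Rightarrow> 'e \<Rightarrow> 'e \<Rightarrow> real) \<Rightarrow> ('n \<Rightarrow> 'm) \<Rightarrow> bool" where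
  "semi_riemannian_submersion N g N' g' \<pi> \<longleftrightarrow>
     smooth_map N N' \<pi> \<and> \<pi> ` points N = points N' \<and>
     (\<forall>x\<in>points N. let d = mderiv N N' \<pi> x; V = {v. d v = 0}; H = {w. \<forall>v\<in>V. g x w v = 0} in
        surj d \<and>
        (\<forall>v\<in>V. (\<forall>w\<in>V. g x v w = 0) \<longrightarrow> v = 0) \<and>
        (\<forall>v\<in>H. \<forall>w\<in>H. g' (\<pi> x) (d v) (d w) = g x v w))"

definition paraquaternionic_submersion ::
  "('n, 'f::euclidean_space) mfd \<Rightarrow> ('n \<Rightarrow> ('f \<Rightarrow>\<^sub>L 'f) set) \<Rightarrow> ('n \<Rightarrow> 'f \<Rightarrow> 'f \<Rightarrow> real) \<Rightarrow>
     ('m, 'e::euclidean_space) mfd \<Rightarrow> ('m \<Rightarrow> ('e \<Rightarrow>\<^sub>L 'e) set) \<Rightarrow> ('m \<Rightarrow> 'e \<Rightarrow> 'e \<Rightarrow> real) \<Rightarrow>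
     ('n \<Rightarrow> 'm) \<Rightarrow> bool" where
  "paraquaternionic_submersion N \<sigma> g N' \<sigma>' g' \<pi> \<longleftrightarrow>
     semi_riemannian_submersion N g N' g' \<pi> \<and> paraholomorphic N \<sigma> N' \<sigma>' \<pi>"

definition local_basis_cover ::
  "('m, 'e::euclidean_space) mfd \<Rightarrow> ('m \<Rightarrow> ('e \<Rightarrow>\<^sub>L 'e) set) \<Rightarrow>
     ('m set \<times> (nat \<Rightarrow> 'm \<Rightarrow> 'e \<Rightarrow>\<^sub>L 'e)) set \<Rightarrow> bool" where
  "local_basis_cover M \<sigma> C \<longleftrightarrow>
     (\<forall>(U, J)\<in>C. local_basis M \<sigma> U J) \<and> points M = (\<Union>(U, J)\<in>C. U)"

text \<open>The structure on the tangent bundle induced by a covering \<open>C\<close> by local bases.  That over each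
  member \<open>(U, J)\<close> of \<open>C\<close> the three lifts of this single \<open>J\<close> already span is not part of the
  definition.\<close>

definition lift_structure ::
  "('m, 'e::euclidean_space) mfd \<Rightarrow> ('m \<Rightarrow> 'e \<Rightarrow> 'e \<Rightarrow> real) \<Rightarrow>
     ('m set \<times> (nat \<Rightarrow> 'm \<Rightarrow> 'e \<Rightarrow>\<^sub>L 'e)) set \<Rightarrow> 'm \<times> 'e \<Rightarrow> (('e \<times> 'e) \<Rightarrow>\<^sub>L ('e \<times> 'e)) set" where
  "lift_structure M g C \<xi> =
     span {lift_endo M g (J a) \<xi> |U J a. (U, J) \<in> C \<and> fst \<xi> \<in> U \<and> a \<in> {1, 2, 3}}"

end

theory Submission
  imports Defs
begin

text \<open>Let \<open>\<Gamma>\<close> be the Christoffel symbols of the Levi-Civita connection in a chart \<open>c\<close>.  The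
  chart induced by \<open>c\<close> on the tangent bundle describes a tangent vector at \<open>(p, u)\<close> by a pair
  \<open>(a, b)\<close>, and there \<open>X\<^sup>v = (0, X)\<close> and \<open>X\<^sup>h = (X, - \<Gamma> X u)\<close>.  Hence \<open>(a, b)\<close> is the sum of the
  horizontal lift of \<open>a\<close> and the vertical lift of \<open>b + \<Gamma> a u\<close>, so the lifts split the tangent space
  into two copies of the tangent space of the base, and the structures defined by their values on
  lifts are explicit: the Sasaki metric is \<open>g \<oplus> g\<close> and a lifted endomorphism is \<open>J \<oplus> J\<close> with respect
  to this splitting (\<open>sasaki_metric_eq\<close>, \<open>lift_endo_eq\<close>).

  Smoothness.  These formulas are first obtained in the preferred chart at each point, which
  varies with the point.  They hold in every induced chart (\<open>of_chart_tangent\<close>), because the second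
  derivative of the transition map occurring in the Jacobian of the induced transition map is the
  one in the transformation law of the Christoffel symbols (\<open>coord_change_lift\<close>,
  \<open>christoffel_change\<close>).  In a fixed chart everything is a polynomial in smooth functions of the
  base point and the fibre coordinate \<open>u\<close>.  Since the Levi-Civita connection is selected by a choice
  operator, its properties rest on its existence, which is proved by means of Koszul's formula:
  the symbols that the formula gives in each chart obey the same transformation law
  (\<open>lc_symbol_change\<close>), so the connections they define in the different charts agree.

  Algebra.  Over each point, \<open>J \<mapsto> J \<oplus> J\<close> is an injective homomorphism of algebras (\<open>lift_op\<close>).  It
  carries the fibre of \<open>\<sigma>\<close> onto the fibre of the induced structure (\<open>lift_structure_eq\<close>), preserves
  and reflects the paraquaternionic relations, and takes skew-adjoint maps to skew-adjoint maps.
  The index of \<open>g \<oplus> g\<close> is twice that of \<open>g\<close> (\<open>form_index_double\<close>), hence constant.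

  The projection has differential \<open>(a, b) \<mapsto> a\<close>, its fibres are tangent to the vertical vectors, and
  on horizontal vectors the Sasaki metric is \<open>g(a, a')\<close>; so \<open>\<pi>\<close> is a semi-Riemannian submersion that
  intertwines \<open>J \<oplus> J\<close> with \<open>J\<close>.  Finally, a local basis of the induced structure is at the given
  point the lift of three endomorphisms in the fibre of \<open>\<sigma>\<close>.  Written in terms of a local basis of
  \<open>\<sigma>\<close> they extend with constant coefficients to a local basis nearby (\<open>local_basis_extend\<close>), because
  the multiplication table of a local basis is the same at all points; the lifts of the extension
  are the adjusted local basis required for paraholomorphy.\<close>

section \<open>Calculus of smooth maps between Euclidean spaces\<close>

lemma linear_eq_sum_Basis:
  fixes L :: "'a::euclidean_space \<Rightarrow> 'b::real_vector"
  assumes "linear L"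
  shows "L x = (\<Sum>b\<in>Basis. (x \<bullet> b) *\<^sub>R L b)"
proof -
  have "L x = L (\<Sum>b\<in>Basis. (x \<bullet> b) *\<^sub>R b)" by (simp add: euclidean_representation)
  also have "\<dots> = (\<Sum>b\<in>Basis. (x \<bullet> b) *\<^sub>R L b)"
    by (simp add: linear_sum[OF assms] linear_scale[OF assms])
  finally show ?thesis .
qed

lemma Ck_on_cong:
  assumes "open S" "\<And>x. x \<in> S \<Longrightarrow> f x = g x" "Ck_on k S f"
  shows "Ck_on k S g"
  using assms(2,3)
proof (induction k arbitrary: f g)
  case 0
  then show ?case using continuous_on_cong[of S S f g] by auto
next
  case (Suc k)
  have d: "f differentiable (at x)" if "x \<in> S" for x using Suc.prems(2) that by auto
  have eq: "frechet_derivative f (at x) = frechet_derivative g (at x)" if "x \<in> S" for x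
    using frechet_derivative_transform_within_open[OF d assms(1) _ Suc.prems(1)] that by auto
  have "g differentiable (at x)" if "x \<in> S" for x
    using d[OF that] has_derivative_transform_within_open[of f _ x UNIV S g, OF _ assms(1) that Suc.prems(1)]
    unfolding differentiable_def by blast
  moreover have "Ck_on k S (\<lambda>x. frechet_derivative g (at x) v)" for v
    using Suc.IH[of "\<lambda>x. frechet_derivative f (at x) v" "\<lambda>x. frechet_derivative g (at x) v"] eq Suc.prems(2)
    by simp
  ultimately show ?case by simp
qed

lemma Ck_on_SucD: "Ck_on (Suc k) S f \<Longrightarrow> Ck_on k S f"
proof (induction k arbitrary: f)
  case 0
  then show ?case
    by (auto intro!: continuous_at_imp_continuous_on differentiable_imp_continuous_within)
qed auto

text \<open>The definition of class \<open>C\<^sup>k\<close> refers to the chosen derivative \<open>frechet_derivative\<close>; with this rule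
  any explicit derivative serves, and the closure properties follow from the calculus rules of
  \<open>has_derivative\<close> by induction on \<open>k\<close>.\<close>

lemma Ck_on_SucI:
  assumes "open S" "\<And>x. x \<in> S \<Longrightarrow> (f has_derivative D x) (at x)" "\<And>v. Ck_on k S (\<lambda>x. D x v)"
  shows "Ck_on (Suc k) S f"
proof -
  have eq: "D x = frechet_derivative f (at x)" if "x \<in> S" for x
    using frechet_derivative_at[OF assms(2)[OF that]] .
  have "Ck_on k S (\<lambda>x. frechet_derivative f (at x) v)" for v
    using Ck_on_cong[OF assms(1) _ assms(3)[of v], of "\<lambda>x. frechet_derivative f (at x) v"] eq by simp
  then show ?thesis using assms(2) by (auto simp: differentiable_def)
qed

lemma Ck_on_has_derivative:
  "Ck_on (Suc k) S f \<Longrightarrow> x \<in> S \<Longrightarrow> (f has_derivative frechet_derivative f (at x)) (at x)"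
  by (simp add: frechet_derivative_works)

lemma Ck_on_frechet: "Ck_on (Suc k) S f \<Longrightarrow> Ck_on k S (\<lambda>x. frechet_derivative f (at x) v)"
  by simp

lemma Ck_on_subset: "Ck_on k S f \<Longrightarrow> T \<subseteq> S \<Longrightarrow> Ck_on k T f"
  by (induction k arbitrary: f) (auto intro: continuous_on_subset)

lemma Ck_on_const: "open S \<Longrightarrow> Ck_on k S (\<lambda>x. c)"
proof (induction k arbitrary: c)
  case (Suc k)
  show ?case by (rule Ck_on_SucI[where D = "\<lambda>x v. 0"]) (use Suc in auto)
qed auto

lemma Ck_on_ident: "open S \<Longrightarrow> Ck_on k S (\<lambda>x. x)"
proof (cases k)
  case (Suc l)
  assume "open S"
  then show ?thesis unfolding Suc
    by (intro Ck_on_SucI[where D = "\<lambda>x v. v"]) (auto intro: Ck_on_const)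
qed auto

lemma Ck_on_bounded_linear:
  assumes "open S" "bounded_linear L" "Ck_on k S f"
  shows "Ck_on k S (\<lambda>x. L (f x))"
  using assms(3)
proof (induction k arbitrary: f)
  case 0
  then show ?case using bounded_linear.continuous_on[OF assms(2)] by auto
next
  case (Suc k)
  show ?case
    by (rule Ck_on_SucI[where D = "\<lambda>x v. L (frechet_derivative f (at x) v)", OF assms(1)
          bounded_linear.has_derivative[OF assms(2) Ck_on_has_derivative[OF Suc.prems]]])
      (use Suc in auto)
qed

lemma Ck_on_add:
  assumes "open S" "Ck_on k S f" "Ck_on k S g"
  shows "Ck_on k S (\<lambda>x. f x + g x)"
  using assms(2,3)
proof (induction k arbitrary: f g)
  case 0
  then show ?case by (auto intro: continuous_on_add)
next
  case (Suc k)
  show ?case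
    by (rule Ck_on_SucI[OF assms(1) has_derivative_add[OF
            Ck_on_has_derivative[OF Suc.prems(1)] Ck_on_has_derivative[OF Suc.prems(2)]]])
      (use Suc in auto)
qed

lemma Ck_on_Pair:
  assumes "open S" "Ck_on k S f" "Ck_on k S g"
  shows "Ck_on k S (\<lambda>x. (f x, g x))"
  using assms(2,3)
proof (induction k arbitrary: f g)
  case 0
  then show ?case by (auto intro: continuous_on_Pair)
next
  case (Suc k)
  show ?case
    by (rule Ck_on_SucI[OF assms(1) has_derivative_Pair[OF
            Ck_on_has_derivative[OF Suc.prems(1)] Ck_on_has_derivative[OF Suc.prems(2)]]])
      (use Suc in auto)
qed

lemma Ck_on_bilinear:
  assumes "open S" "bounded_bilinear B" "Ck_on k S f" "Ck_on k S g"
  shows "Ck_on k S (\<lambda>x. B (f x) (g x))"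
  using assms(3,4)
proof (induction k arbitrary: f g)
  case 0
  then show ?case using bounded_bilinear.continuous_on[OF assms(2)] by auto
next
  case (Suc k)
  show ?case
    by (rule Ck_on_SucI[OF assms(1) bounded_bilinear.FDERIV[OF assms(2)
            Ck_on_has_derivative[OF Suc.prems(1)] Ck_on_has_derivative[OF Suc.prems(2)]]])
       (use Suc in \<open>auto intro!: Ck_on_add assms(1) Suc.IH simp del: Ck_on.simps
          intro: Ck_on_SucD Ck_on_frechet\<close>)
qed

lemma Ck_on_sum:
  assumes "open S" "\<And>i. i \<in> I \<Longrightarrow> Ck_on k S (f i)"
  shows "Ck_on k S (\<lambda>x. \<Sum>i\<in>I. f i x)"
  using assms(2)
  by (induction I rule: infinite_finite_induct)
    (auto intro!: Ck_on_add assms(1) Ck_on_const)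

text \<open>The chain rule applies the derivative of \<open>f\<close> to a vector that varies with \<open>x\<close>.  Expanding this
  vector in the basis leaves the partial derivatives of \<open>f\<close>, composed with \<open>g\<close>, to which the
  induction hypothesis applies.\<close>

lemma Ck_on_compose:
  fixes g :: "'a::euclidean_space \<Rightarrow> 'b::euclidean_space"
  assumes "open S" "Ck_on k S g" "Ck_on k T f" "g ` S \<subseteq> T"
  shows "Ck_on k S (\<lambda>x. f (g x))"
  using assms(2,3)
proof (induction k arbitrary: f)
  case 0
  then show ?case using assms(4) by (auto intro: continuous_on_compose2)
next
  case (Suc k)
  let ?g' = "\<lambda>x. frechet_derivative g (at x)" and ?f' = "\<lambda>x. frechet_derivative f (at x)"
  have f': "(f has_derivative ?f' (g x)) (at (g x))" if "x \<in> S" for x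
    using Suc.prems(2) that assms(4) by (auto intro: Ck_on_has_derivative simp del: Ck_on.simps)
  show ?case
  proof (rule Ck_on_SucI[OF assms(1), where D = "\<lambda>x v. \<Sum>b\<in>Basis. (?g' x v \<bullet> b) *\<^sub>R ?f' (g x) b"])
    fix x assume x: "x \<in> S"
    have "(\<lambda>v. ?f' (g x) (?g' x v)) = (\<lambda>v. \<Sum>b\<in>Basis. (?g' x v \<bullet> b) *\<^sub>R ?f' (g x) b)"
      by (rule ext, rule linear_eq_sum_Basis) (use f'[OF x] has_derivative_linear in blast)
    then show "((\<lambda>x. f (g x)) has_derivative (\<lambda>v. \<Sum>b\<in>Basis. (?g' x v \<bullet> b) *\<^sub>R ?f' (g x) b)) (at x)"
      using has_derivative_compose[OF Ck_on_has_derivative[OF Suc.prems(1) x] f'[OF x]] by simp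
  next
    fix v
    show "Ck_on k S (\<lambda>x. \<Sum>b\<in>Basis. (?g' x v \<bullet> b) *\<^sub>R ?f' (g x) b)"
    proof (rule Ck_on_sum[OF assms(1)])
      fix b :: 'b
      have "Ck_on k S (\<lambda>x. ?g' x v \<bullet> b)"
        by (rule Ck_on_bounded_linear[OF assms(1) bounded_linear_inner_left])
          (use Suc.prems(1) Ck_on_frechet in blast)
      moreover have "Ck_on k S (\<lambda>x. ?f' (g x) b)"
        by (rule Suc.IH[OF Ck_on_SucD[OF Suc.prems(1)] Ck_on_frechet[OF Suc.prems(2)]])
      ultimately show "Ck_on k S (\<lambda>x. (?g' x v \<bullet> b) *\<^sub>R ?f' (g x) b)"
        by (rule Ck_on_bilinear[OF assms(1) bounded_bilinear_scaleR])
    qed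
  qed
qed

lemma Ck_on_local:
  assumes "\<And>x. x \<in> S \<Longrightarrow> \<exists>T. open T \<and> x \<in> T \<and> Ck_on k T f"
  shows "Ck_on k S f"
  using assms
proof (induction k arbitrary: f)
  case 0
  then show ?case
    by (meson Ck_on.simps(1) continuous_at_imp_continuous_on continuous_on_eq_continuous_at)
next
  case (Suc k)
  have "f differentiable (at x)" if "x \<in> S" for x using Suc.prems[OF that] by auto
  moreover have "Ck_on k S (\<lambda>x. frechet_derivative f (at x) v)" for v
    by (rule Suc.IH) (use Suc.prems in fastforce)
  ultimately show ?case by simp
qed

lemma smooth_on_cong:
  "open S \<Longrightarrow> (\<And>x. x \<in> S \<Longrightarrow> f x = g x) \<Longrightarrow> smooth_on S f \<Longrightarrow> smooth_on S g"
  unfolding smooth_on_def by (metis Ck_on_cong)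

lemma smooth_on_subset: "smooth_on S f \<Longrightarrow> T \<subseteq> S \<Longrightarrow> smooth_on T f"
  unfolding smooth_on_def by (metis Ck_on_subset)

lemma smooth_on_const: "open S \<Longrightarrow> smooth_on S (\<lambda>x. c)"
  by (simp add: smooth_on_def Ck_on_const)

lemma smooth_on_ident: "open S \<Longrightarrow> smooth_on S (\<lambda>x. x)"
  by (simp add: smooth_on_def Ck_on_ident)

lemma smooth_on_bounded_linear:
  "open S \<Longrightarrow> bounded_linear L \<Longrightarrow> smooth_on S f \<Longrightarrow> smooth_on S (\<lambda>x. L (f x))"
  by (simp add: smooth_on_def Ck_on_bounded_linear)

lemma smooth_on_add:
  "open S \<Longrightarrow> smooth_on S f \<Longrightarrow> smooth_on S g \<Longrightarrow> smooth_on S (\<lambda>x. f x + g x)"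
  by (simp add: smooth_on_def Ck_on_add)

lemma smooth_on_Pair:
  "open S \<Longrightarrow> smooth_on S f \<Longrightarrow> smooth_on S g \<Longrightarrow> smooth_on S (\<lambda>x. (f x, g x))"
  by (simp add: smooth_on_def Ck_on_Pair)

lemma smooth_on_bilinear:
  "open S \<Longrightarrow> bounded_bilinear B \<Longrightarrow> smooth_on S f \<Longrightarrow> smooth_on S g
    \<Longrightarrow> smooth_on S (\<lambda>x. B (f x) (g x))"
  by (simp add: smooth_on_def Ck_on_bilinear)

lemma smooth_on_sum:
  "open S \<Longrightarrow> (\<And>i. i \<in> I \<Longrightarrow> smooth_on S (f i)) \<Longrightarrow> smooth_on S (\<lambda>x. \<Sum>i\<in>I. f i x)"
  by (simp add: smooth_on_def Ck_on_sum)

lemma smooth_on_compose: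
  fixes g :: "'a::euclidean_space \<Rightarrow> 'b::euclidean_space"
  shows "open S \<Longrightarrow> smooth_on S g \<Longrightarrow> smooth_on T f \<Longrightarrow> g ` S \<subseteq> T \<Longrightarrow> smooth_on S (\<lambda>x. f (g x))"
  unfolding smooth_on_def by (metis Ck_on_compose)

lemma smooth_on_local:
  "(\<And>x. x \<in> S \<Longrightarrow> \<exists>T. open T \<and> x \<in> T \<and> smooth_on T f) \<Longrightarrow> smooth_on S f"
  unfolding smooth_on_def by (meson Ck_on_local)

lemma smooth_on_frechet: "smooth_on S f \<Longrightarrow> smooth_on S (\<lambda>x. frechet_derivative f (at x) v)"
  by (simp add: smooth_on_def del: Ck_on.simps) (blast intro: Ck_on_frechet)

lemma smooth_on_has_derivative:
  "smooth_on S f \<Longrightarrow> x \<in> S \<Longrightarrow> (f has_derivative frechet_derivative f (at x)) (at x)"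
  unfolding smooth_on_def using Ck_on_has_derivative by blast

lemma smooth_on_imp_continuous_on: "smooth_on S f \<Longrightarrow> continuous_on S f"
  unfolding smooth_on_def by (metis Ck_on.simps(1))

text \<open>Tensor fields are called smooth when they are so on constant vectors; expansion in the basis
  gives smoothness on varying vectors.\<close>

lemma smooth_on_linear_family:
  fixes h :: "'a::euclidean_space \<Rightarrow> 'b::euclidean_space" and A :: "'a \<Rightarrow> 'b \<Rightarrow> 'c::real_normed_vector"
  assumes "open S" "\<And>x. x \<in> S \<Longrightarrow> linear (A x)" "\<And>v. smooth_on S (\<lambda>x. A x v)" "smooth_on S h"
  shows "smooth_on S (\<lambda>x. A x (h x))"
proof (rule smooth_on_cong[OF assms(1)])
  show "(\<Sum>b\<in>Basis. (h x \<bullet> b) *\<^sub>R A x b) = A x (h x)" if "x \<in> S" for x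
    by (rule linear_eq_sum_Basis[OF assms(2)[OF that], symmetric])
  show "smooth_on S (\<lambda>x. \<Sum>b\<in>Basis. (h x \<bullet> b) *\<^sub>R A x b)"
    by (intro smooth_on_sum smooth_on_bilinear[OF _ bounded_bilinear_scaleR]
        smooth_on_bounded_linear[OF _ bounded_linear_inner_left] assms)
qed

text \<open>At a zero of \<open>p\<close>, continuity of \<open>q\<close> is enough for the product rule, since \<open>p y\<close> is of order
  \<open>norm (y - x)\<close> and \<open>q y - q x\<close> tends to zero.\<close>

lemma has_derivative_scaleR_vanishing:
  fixes p :: "'a::real_normed_vector \<Rightarrow> real" and q :: "'a \<Rightarrow> 'b::real_normed_vector"
  assumes p: "(p has_derivative p') (at x)" "p x = 0" and q: "isCont q x"
  shows "((\<lambda>y. p y *\<^sub>R q y) has_derivative (\<lambda>h. p' h *\<^sub>R q x)) (at x)"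
proof -
  interpret p': bounded_linear p' using p(1) by (rule has_derivative_bounded_linear)
  obtain K where K: "\<And>h. norm (p' h) \<le> norm h * K" using p'.bounded by blast
  have lim: "(\<lambda>h. norm (p (x + h) - p' h) / norm h) \<midarrow>0\<rightarrow> 0"
    using p by (simp add: has_derivative_at)
  have q0: "(\<lambda>h. q (x + h)) \<midarrow>0\<rightarrow> q x" using q by (simp add: isCont_iff)
  have est: "norm (p (x + h) *\<^sub>R q (x + h) - p' h *\<^sub>R q x) / norm h
      \<le> norm (p (x + h) - p' h) / norm h * norm (q (x + h)) + K * norm (q (x + h) - q x)"
    if "h \<noteq> 0" for h
  proof -
    have "p (x + h) *\<^sub>R q (x + h) - p' h *\<^sub>R q x
        = (p (x + h) - p' h) *\<^sub>R q (x + h) + p' h *\<^sub>R (q (x + h) - q x)"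
      by (simp add: algebra_simps)
    also have "norm \<dots> \<le> norm (p (x + h) - p' h) * norm (q (x + h)) + norm h * K * norm (q (x + h) - q x)"
      by (rule order_trans[OF norm_triangle_ineq])
        (use mult_right_mono[OF K[of h], of "norm (q (x + h) - q x)"] in simp)
    finally show ?thesis using that by (simp add: field_simps)
  qed
  have "(\<lambda>h. norm (p (x + h) *\<^sub>R q (x + h) - p' h *\<^sub>R q x) / norm h) \<midarrow>0\<rightarrow> 0"
  proof (rule Lim_null_comparison)
    show "\<forall>\<^sub>F h in at 0. norm (norm (p (x + h) *\<^sub>R q (x + h) - p' h *\<^sub>R q x) / norm h)
        \<le> norm (p (x + h) - p' h) / norm h * norm (q (x + h)) + K * norm (q (x + h) - q x)"
      using est by (simp add: eventually_at_filter)
    show "(\<lambda>h. norm (p (x + h) - p' h) / norm h * norm (q (x + h)) + K * norm (q (x + h) - q x)) \<midarrow>0\<rightarrow> 0"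
      using tendsto_add[OF tendsto_mult[OF lim tendsto_norm[OF q0]]
          tendsto_mult[OF tendsto_const tendsto_norm[OF LIM_zero[OF q0]]]] by simp
  qed
  then show ?thesis
    using p(2) bounded_linear_scaleR_const[OF p'.bounded_linear_axioms] by (simp add: has_derivative_at)
qed

text \<open>If \<open>A x0\<close> is bounded below by \<open>m\<close>, then \<open>A x\<close> is bounded below by \<open>m / 2\<close> for \<open>x\<close> near \<open>x0\<close>.
  Applied to \<open>B x v - B x0 v\<close>, whose image under \<open>A x\<close> is small, this gives continuity.\<close>

lemma inverse_family_isCont:
  fixes A B :: "'a::euclidean_space \<Rightarrow> 'b::euclidean_space \<Rightarrow> 'b"
  assumes S: "open S" "x0 \<in> S" and lin: "\<And>x. x \<in> S \<Longrightarrow> linear (A x)"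
    and cont: "\<And>v. isCont (\<lambda>x. A x v) x0"
    and AB: "\<And>x v. x \<in> S \<Longrightarrow> A x (B x v) = v" and BA: "\<And>x v. x \<in> S \<Longrightarrow> B x (A x v) = v"
  shows "isCont (\<lambda>x. B x v) x0"
proof -
  have "inj (A x0)" using BA[OF S(2)] by (metis injI)
  then obtain m where m: "m > 0" "\<And>u. norm (A x0 u) \<ge> m * norm u"
    using linear_inj_bounded_below_pos[OF lin[OF S(2)]] by (metis mult.commute)
  define E where "E x = (\<Sum>b\<in>Basis. norm (A x b - A x0 b))" for x
  have "((\<lambda>x. E x) \<longlongrightarrow> E x0) (at x0)"
    unfolding E_def by (intro tendsto_intros isContD[OF cont])
  then have E0: "(E \<longlongrightarrow> 0) (at x0)" by (simp add: E_def[abs_def])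
  have diff: "norm (A x u - A x0 u) \<le> E x * norm u" if "x \<in> S" for x u
  proof -
    have "A x u - A x0 u = (\<Sum>b\<in>Basis. (u \<bullet> b) *\<^sub>R (A x b - A x0 b))"
      by (subst linear_eq_sum_Basis[OF lin[OF that], of u], subst linear_eq_sum_Basis[OF lin[OF S(2)], of u])
        (simp add: sum_subtractf scaleR_diff_right)
    also have "norm \<dots> \<le> (\<Sum>b\<in>Basis. norm (u \<bullet> b) * norm (A x b - A x0 b))"
      by (rule order_trans[OF norm_sum]) simp
    also have "\<dots> \<le> (\<Sum>b\<in>Basis. norm u * norm (A x b - A x0 b))"
      by (intro sum_mono mult_right_mono) (auto simp: Basis_le_norm)
    finally show ?thesis by (simp add: E_def sum_distrib_left mult.commute)
  qed
  have ev: "\<forall>\<^sub>F x in at x0. norm (B x v - B x0 v) \<le> (2 / m) * (E x * norm (B x0 v))"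
  proof -
    have "\<forall>\<^sub>F x in at x0. E x < m / 2" using order_tendstoD(2)[OF E0, of "m / 2"] m(1) by simp
    moreover have "\<forall>\<^sub>F x in at x0. x \<in> S" using eventually_at_in_open'[OF S] .
    ultimately show ?thesis
    proof eventually_elim
      case (elim x)
      let ?u = "B x v - B x0 v"
      have "A x ?u = - (A x (B x0 v) - A x0 (B x0 v))"
        using AB[OF elim(2)] AB[OF S(2)] by (simp add: linear_diff[OF lin[OF elim(2)]])
      then have 1: "norm (A x ?u) \<le> E x * norm (B x0 v)" using diff[OF elim(2)] by (simp only: norm_minus_cancel)
      have "m * norm ?u \<le> norm (A x0 ?u)" using m(2) .
      also have "\<dots> \<le> norm (A x ?u) + norm (A x ?u - A x0 ?u)"
        by (metis norm_triangle_sub norm_minus_commute)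
      also have "\<dots> \<le> norm (A x ?u) + (m / 2) * norm ?u"
        using diff[OF elim(2), of ?u] mult_right_mono[of "E x" "m / 2" "norm ?u"] elim(1) by simp
      finally have "(m / 2) * norm ?u \<le> E x * norm (B x0 v)" using 1 by simp
      then show ?case using m(1) by (simp add: field_simps)
    qed
  qed
  have "((\<lambda>x. (2 / m) * (E x * norm (B x0 v))) \<longlongrightarrow> (2 / m) * (0 * norm (B x0 v))) (at x0)"
    by (intro tendsto_intros E0)
  then have "((\<lambda>x. B x v - B x0 v) \<longlongrightarrow> 0) (at x0)"
    by (intro Lim_null_comparison[OF ev]) simp
  then show ?thesis unfolding isCont_def by (rule LIM_zero_cancel)
qed

lemma linear_of_inverse:
  assumes "linear F" "\<And>v. F (G v) = v" "\<And>v. G (F v) = v"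
  shows "linear G"
proof (rule linearI)
  show "G (a + b) = G a + G b" for a b
    using assms(3)[of "G a + G b"] by (simp add: linear_add[OF assms(1)] assms(2))
  show "G (r *\<^sub>R a) = r *\<^sub>R G a" for r a
    using assms(3)[of "r *\<^sub>R G a"] by (simp add: linear_scale[OF assms(1)] assms(2))
qed

text \<open>With \<open>u = B x0 v\<close> one has \<open>B x v = u - B x (A x u - v)\<close>.  The argument of \<open>B x\<close> vanishes at \<open>x0\<close>, so
  that only the continuity of \<open>B\<close> enters in differentiating the right-hand side.\<close>

lemma inverse_family_has_derivative:
  fixes A B :: "'a::euclidean_space \<Rightarrow> 'b::euclidean_space \<Rightarrow> 'b"
  assumes S: "open S" "x0 \<in> S" and lin: "\<And>x. x \<in> S \<Longrightarrow> linear (A x)"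
    and der: "\<And>v. ((\<lambda>x. A x v) has_derivative A' v) (at x0)"
    and AB: "\<And>x v. x \<in> S \<Longrightarrow> A x (B x v) = v" and BA: "\<And>x v. x \<in> S \<Longrightarrow> B x (A x v) = v"
  shows "((\<lambda>x. B x v) has_derivative (\<lambda>h. - (\<Sum>b\<in>Basis. (B x0 v \<bullet> b) *\<^sub>R B x0 (A' b h)))) (at x0)"
proof -
  have linB: "linear (B x)" if "x \<in> S" for x
    by (rule linear_of_inverse[where F = "A x"]) (use that lin AB BA in auto)
  have cont: "isCont (\<lambda>x. B x b) x0" for b
    by (rule inverse_family_isCont[OF S lin _ AB BA]) (auto intro: has_derivative_continuous[OF der])
  let ?u = "B x0 v"
  define r where "r x = (\<Sum>b\<in>Basis. (?u \<bullet> b) *\<^sub>R A x b) - v" for x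
  define r' where "r' h = (\<Sum>b\<in>Basis. (?u \<bullet> b) *\<^sub>R A' b h)" for h
  have r_eq: "r x = A x ?u - v" if "x \<in> S" for x
    unfolding r_def linear_eq_sum_Basis[OF lin[OF that], symmetric] ..
  have r: "((\<lambda>x. r x \<bullet> b) has_derivative (\<lambda>h. r' h \<bullet> b)) (at x0)" for b
    unfolding r_def r'_def by (auto intro!: derivative_eq_intros der)
  have "((\<lambda>x. ?u - (\<Sum>b\<in>Basis. (r x \<bullet> b) *\<^sub>R B x b)) has_derivative
      (\<lambda>h. 0 - (\<Sum>b\<in>Basis. (r' h \<bullet> b) *\<^sub>R B x0 b))) (at x0)"
    by (intro has_derivative_diff has_derivative_const has_derivative_sum
        has_derivative_scaleR_vanishing r cont) (simp add: r_eq[OF S(2)] AB[OF S(2)])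
  moreover have "(\<Sum>b\<in>Basis. (r' h \<bullet> b) *\<^sub>R B x0 b) = (\<Sum>b\<in>Basis. (?u \<bullet> b) *\<^sub>R B x0 (A' b h))" for h
    unfolding linear_eq_sum_Basis[OF linB[OF S(2)], symmetric]
    by (simp add: r'_def linear_sum[OF linB[OF S(2)]] linear_scale[OF linB[OF S(2)]])
  moreover have eq: "?u - (\<Sum>b\<in>Basis. (r x \<bullet> b) *\<^sub>R B x b) = B x v" if "x \<in> S" for x
    unfolding linear_eq_sum_Basis[OF linB[OF that], symmetric]
    by (simp add: r_eq[OF that] linear_diff[OF linB[OF that]] BA[OF that])
  ultimately have d: "((\<lambda>x. ?u - (\<Sum>b\<in>Basis. (r x \<bullet> b) *\<^sub>R B x b)) has_derivative
      (\<lambda>h. - (\<Sum>b\<in>Basis. (?u \<bullet> b) *\<^sub>R B x0 (A' b h)))) (at x0)" by simp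
  show ?thesis by (rule has_derivative_transform_within_open[OF d S eq])
qed

text \<open>The derivative of the inverse is a polynomial in the inverse and the derivative of \<open>A\<close>, so each
  order of differentiability of the inverse yields the next.\<close>

lemma smooth_on_inverse_family:
  fixes A B :: "'a::euclidean_space \<Rightarrow> 'b::euclidean_space \<Rightarrow> 'b"
  assumes S: "open S" and lin: "\<And>x. x \<in> S \<Longrightarrow> linear (A x)"
    and A: "\<And>v. smooth_on S (\<lambda>x. A x v)"
    and AB: "\<And>x v. x \<in> S \<Longrightarrow> A x (B x v) = v" and BA: "\<And>x v. x \<in> S \<Longrightarrow> B x (A x v) = v"
  shows "smooth_on S (\<lambda>x. B x v)"
proof -
  have linB: "linear (B x)" if "x \<in> S" for x
    by (rule linear_of_inverse[where F = "A x"]) (use that lin AB BA in auto)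
  define A' where "A' x v h = frechet_derivative (\<lambda>x. A x v) (at x) h" for x v h
  have dA: "((\<lambda>x. A x v) has_derivative A' x v) (at x)" if "x \<in> S" for x v
    using smooth_on_has_derivative[OF A that] by (simp add: A'_def[abs_def])
  note dB = inverse_family_has_derivative[OF S _ lin dA AB BA]
  have "Ck_on k S (\<lambda>x. B x v)" for k v
  proof (induction k arbitrary: v)
    case 0
    show ?case
      using has_derivative_continuous[OF dB] by (auto intro!: continuous_at_imp_continuous_on)
  next
    case (Suc k)
    show ?case
    proof (rule Ck_on_SucI[OF S dB])
      fix h
      have A': "Ck_on k S (\<lambda>x. A' x w h)" for w
        using A[of w] smooth_on_frechet unfolding smooth_on_def A'_def by blast
      have "Ck_on k S (\<lambda>x. B x (A' x b h))" for b
      proof (rule Ck_on_cong[OF S])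
        show "(\<Sum>i\<in>Basis. (A' x b h \<bullet> i) *\<^sub>R B x i) = B x (A' x b h)" if "x \<in> S" for x
          by (rule linear_eq_sum_Basis[OF linB[OF that], symmetric])
        show "Ck_on k S (\<lambda>x. \<Sum>i\<in>Basis. (A' x b h \<bullet> i) *\<^sub>R B x i)"
          by (intro Ck_on_sum Ck_on_bilinear[OF _ bounded_bilinear_scaleR]
              Ck_on_bounded_linear[OF _ bounded_linear_inner_left] A' Suc.IH S)
      qed
      then have "Ck_on k S (\<lambda>x. \<Sum>b\<in>Basis. (B x v \<bullet> b) *\<^sub>R B x (A' x b h))"
        by (intro Ck_on_sum Ck_on_bilinear[OF _ bounded_bilinear_scaleR]
            Ck_on_bounded_linear[OF _ bounded_linear_inner_left] Suc.IH S)
      then show "Ck_on k S (\<lambda>x. - (\<Sum>b\<in>Basis. (B x v \<bullet> b) *\<^sub>R B x (A' x b h)))"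
        by (rule Ck_on_bounded_linear[OF S bounded_linear_minus[OF bounded_linear_ident]])
    qed auto
  qed
  then show ?thesis by (simp add: smooth_on_def)
qed

text \<open>The mean value theorem is used in the direction \<open>v\<close> for the difference of \<open>f\<close> at points differing
  by \<open>s *\<^sub>R w\<close>, and then in the direction \<open>w\<close> for the derivative in the direction \<open>v\<close>.\<close>

lemma mixed_difference_eq:
  fixes f :: "'a::euclidean_space \<Rightarrow> real"
  assumes f: "smooth_on S f" and s: "s > 0"
    and S: "\<And>a b. \<lbrakk>0 \<le> a; a \<le> s; 0 \<le> b; b \<le> s\<rbrakk> \<Longrightarrow> x + a *\<^sub>R v + b *\<^sub>R w \<in> S"
  obtains a b where "0 \<le> a" "a \<le> s" "0 \<le> b" "b \<le> s"
    "f (x + s *\<^sub>R v + s *\<^sub>R w) - f (x + s *\<^sub>R v) - f (x + s *\<^sub>R w) + f x =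
      s * s * frechet_derivative (\<lambda>y. frechet_derivative f (at y) v) (at (x + a *\<^sub>R v + b *\<^sub>R w)) w"
proof -
  let ?D = "\<lambda>y. frechet_derivative f (at y)"
  have line: "((\<lambda>a. F (y + a *\<^sub>R u)) has_real_derivative frechet_derivative F (at (y + a *\<^sub>R u)) u) (at a)"
    if F: "smooth_on S F" and y: "y + a *\<^sub>R u \<in> S" for F :: "'a \<Rightarrow> real" and y u :: 'a and a
  proof -
    have FD: "(F has_derivative frechet_derivative F (at (y + a *\<^sub>R u))) (at (y + a *\<^sub>R u))"
      by (rule smooth_on_has_derivative[OF F y])
    have "((\<lambda>a. F (y + a *\<^sub>R u)) has_derivative (\<lambda>h. frechet_derivative F (at (y + a *\<^sub>R u)) (h *\<^sub>R u))) (at a)"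
      by (rule has_derivative_compose[where g = F and f = "\<lambda>a. y + a *\<^sub>R u", OF _ FD]) (auto intro!: derivative_eq_intros)
    moreover have "(\<lambda>h. frechet_derivative F (at (y + a *\<^sub>R u)) (h *\<^sub>R u))
        = (*) (frechet_derivative F (at (y + a *\<^sub>R u)) u)"
      by (rule ext) (simp add: linear_scale[OF has_derivative_linear[OF FD]])
    ultimately show ?thesis by (simp add: has_field_derivative_def)
  qed
  have "\<exists>a>0. a < s \<and> (f ((x + s *\<^sub>R w) + s *\<^sub>R v) - f (x + s *\<^sub>R v)) - (f ((x + s *\<^sub>R w) + 0 *\<^sub>R v) - f (x + 0 *\<^sub>R v))
      = (s - 0) * (?D ((x + s *\<^sub>R w) + a *\<^sub>R v) v - ?D (x + a *\<^sub>R v) v)"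
  proof (rule MVT2[OF s])
    fix a assume a: "0 \<le> a" "a \<le> s"
    show "((\<lambda>a. f ((x + s *\<^sub>R w) + a *\<^sub>R v) - f (x + a *\<^sub>R v)) has_real_derivative
        ?D ((x + s *\<^sub>R w) + a *\<^sub>R v) v - ?D (x + a *\<^sub>R v) v) (at a)"
      using S[of a s] S[of a 0] a s by (intro DERIV_diff line f) (auto simp: algebra_simps)
  qed
  then obtain a where a: "0 < a" "a < s" and
    1: "f (x + s *\<^sub>R v + s *\<^sub>R w) - f (x + s *\<^sub>R v) - f (x + s *\<^sub>R w) + f x
      = s * (?D ((x + a *\<^sub>R v) + s *\<^sub>R w) v - ?D ((x + a *\<^sub>R v) + 0 *\<^sub>R w) v)"
    by (auto simp: algebra_simps)
  have "\<exists>b>0. b < s \<and> ?D ((x + a *\<^sub>R v) + s *\<^sub>R w) v - ?D ((x + a *\<^sub>R v) + 0 *\<^sub>R w) v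
      = (s - 0) * frechet_derivative (\<lambda>y. ?D y v) (at (x + a *\<^sub>R v + b *\<^sub>R w)) w"
  proof (rule MVT2[OF s])
    fix b assume "0 \<le> b" "b \<le> s"
    then show "((\<lambda>b. ?D ((x + a *\<^sub>R v) + b *\<^sub>R w) v) has_real_derivative
        frechet_derivative (\<lambda>y. ?D y v) (at (x + a *\<^sub>R v + b *\<^sub>R w)) w) (at b)"
      using S[of a b] a by (intro line smooth_on_frechet f) auto
  qed
  then obtain b where b: "0 < b" "b < s" and
    2: "?D ((x + a *\<^sub>R v) + s *\<^sub>R w) v - ?D ((x + a *\<^sub>R v) + 0 *\<^sub>R w) v
      = s * frechet_derivative (\<lambda>y. ?D y v) (at (x + a *\<^sub>R v + b *\<^sub>R w)) w" by auto
  show ?thesis using that[of a b] a b 1[unfolded 2] by (simp add: mult.assoc)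
qed

text \<open>The second difference in the preceding lemma is symmetric in \<open>v\<close> and \<open>w\<close>, so the two mixed
  derivatives take equal values at two points arbitrarily close to \<open>x\<close>; they are continuous.\<close>

lemma second_derivative_symmetric_real:
  fixes f :: "'a::euclidean_space \<Rightarrow> real"
  assumes S: "open S" "x \<in> S" and f: "smooth_on S f"
  shows "frechet_derivative (\<lambda>y. frechet_derivative f (at y) v) (at x) w
    = frechet_derivative (\<lambda>y. frechet_derivative f (at y) w) (at x) v"
proof -
  let ?F = "\<lambda>v w y. frechet_derivative (\<lambda>y. frechet_derivative f (at y) v) (at y) w"
  have cont: "isCont (?F v w) x" for v w
    using smooth_on_imp_continuous_on[OF smooth_on_frechet[OF smooth_on_frechet[OF f]]] S
      continuous_on_eq_continuous_at by blast
  have "\<bar>?F v w x - ?F w v x\<bar> < e" if "e > 0" for e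
  proof -
    obtain d where d: "d > 0" "ball x d \<subseteq> S" using S open_contains_ball by blast
    obtain d1 where d1: "d1 > 0" "\<And>y. dist y x < d1 \<Longrightarrow> dist (?F v w y) (?F v w x) < e / 2"
      using cont[of v w] \<open>e > 0\<close> unfolding continuous_at_eps_delta by (meson half_gt_zero)
    obtain d2 where d2: "d2 > 0" "\<And>y. dist y x < d2 \<Longrightarrow> dist (?F w v y) (?F w v x) < e / 2"
      using cont[of w v] \<open>e > 0\<close> unfolding continuous_at_eps_delta by (meson half_gt_zero)
    define r where "r = min d (min d1 d2)"
    \<comment> \<open>The parallelogram with sides \<open>s *\<^sub>R v\<close> and \<open>s *\<^sub>R w\<close> at \<open>x\<close> then lies in the ball of radius \<open>r\<close>.\<close>
    define s where "s = r / (norm v + norm w + 1)"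
    have r: "r > 0" using d d1 d2 by (simp add: r_def)
    have pos: "norm v + norm w + 1 > 0" by (simp add: add_nonneg_pos)
    have s: "s > 0" using r pos by (simp add: s_def)
    have near: "dist (x + a *\<^sub>R v + b *\<^sub>R w) x < r" if "0 \<le> a" "a \<le> s" "0 \<le> b" "b \<le> s" for a b
    proof -
      have "dist (x + a *\<^sub>R v + b *\<^sub>R w) x = norm (a *\<^sub>R v + b *\<^sub>R w)"
        by (simp add: dist_norm algebra_simps)
      also have "\<dots> \<le> a * norm v + b * norm w"
        using norm_triangle_ineq[of "a *\<^sub>R v" "b *\<^sub>R w"] that by simp
      also have "\<dots> \<le> s * norm v + s * norm w" using that by (intro add_mono mult_right_mono) auto
      also have "\<dots> < s * (norm v + norm w + 1)" using s by (simp add: algebra_simps)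
      also have "\<dots> = r" using pos by (simp add: s_def)
      finally show ?thesis .
    qed
    have inS: "x + a *\<^sub>R v + b *\<^sub>R w \<in> S" if "0 \<le> a" "a \<le> s" "0 \<le> b" "b \<le> s" for a b
      using near[OF that] d(2) by (auto simp: r_def dist_commute subset_iff)
    obtain a b where ab: "0 \<le> a" "a \<le> s" "0 \<le> b" "b \<le> s"
      "f (x + s *\<^sub>R v + s *\<^sub>R w) - f (x + s *\<^sub>R v) - f (x + s *\<^sub>R w) + f x = s * s * ?F v w (x + a *\<^sub>R v + b *\<^sub>R w)"
      using mixed_difference_eq[OF f s inS] by blast
    have inS': "x + a *\<^sub>R w + b *\<^sub>R v \<in> S" if "0 \<le> a" "a \<le> s" "0 \<le> b" "b \<le> s" for a b
      using inS[of b a] that by (simp add: algebra_simps)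
    obtain a' b' where ab': "0 \<le> a'" "a' \<le> s" "0 \<le> b'" "b' \<le> s"
      "f (x + s *\<^sub>R w + s *\<^sub>R v) - f (x + s *\<^sub>R w) - f (x + s *\<^sub>R v) + f x = s * s * ?F w v (x + a' *\<^sub>R w + b' *\<^sub>R v)"
      using mixed_difference_eq[OF f s inS'] by blast
    have "s * s * ?F v w (x + a *\<^sub>R v + b *\<^sub>R w) = s * s * ?F w v (x + b' *\<^sub>R v + a' *\<^sub>R w)"
      using ab(5) ab'(5) by (simp add: algebra_simps)
    then have "?F v w (x + a *\<^sub>R v + b *\<^sub>R w) = ?F w v (x + b' *\<^sub>R v + a' *\<^sub>R w)" using s by simp
    moreover have "dist (?F v w (x + a *\<^sub>R v + b *\<^sub>R w)) (?F v w x) < e / 2"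
      using d1(2) near[OF ab(1-4)] by (simp add: r_def)
    moreover have "dist (?F w v (x + b' *\<^sub>R v + a' *\<^sub>R w)) (?F w v x) < e / 2"
      using d2(2) near[OF ab'(3,4,1,2)] by (simp add: r_def)
    ultimately show ?thesis unfolding dist_real_def by linarith
  qed
  then have "\<not> \<bar>?F v w x - ?F w v x\<bar> > 0" by blast
  then show ?thesis by simp
qed

lemma frechet_derivative_inner:
  assumes "(f has_derivative f') (at x)"
  shows "frechet_derivative (\<lambda>y. f y \<bullet> b) (at x) v = f' v \<bullet> b"
  using frechet_derivative_at[OF has_derivative_inner_left[OF assms, of b]] by metis

lemma second_derivative_symmetric:
  fixes f :: "'a::euclidean_space \<Rightarrow> 'b::euclidean_space"
  assumes S: "open S" "x \<in> S" and f: "smooth_on S f"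
  shows "frechet_derivative (\<lambda>y. frechet_derivative f (at y) v) (at x) w
    = frechet_derivative (\<lambda>y. frechet_derivative f (at y) w) (at x) v"
proof (rule euclidean_eqI)
  fix b :: 'b
  have "frechet_derivative (\<lambda>y. frechet_derivative f (at y) v) (at x) w \<bullet> b =
      frechet_derivative (\<lambda>y. frechet_derivative (\<lambda>z. f z \<bullet> b) (at y) v) (at x) w" for v w
  proof -
    have "frechet_derivative (\<lambda>y. frechet_derivative f (at y) v) (at x) w \<bullet> b
        = frechet_derivative (\<lambda>y. frechet_derivative f (at y) v \<bullet> b) (at x) w"
      using frechet_derivative_inner[OF smooth_on_has_derivative[OF smooth_on_frechet[OF f] S(2)]] by simp
    also have "frechet_derivative (\<lambda>y. frechet_derivative f (at y) v \<bullet> b) (at x) =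
        frechet_derivative (\<lambda>y. frechet_derivative (\<lambda>z. f z \<bullet> b) (at y) v) (at x)"
      using frechet_derivative_inner[OF smooth_on_has_derivative[OF f]]
      by (intro frechet_derivative_transform_within_open[OF _ S])
        (auto intro: differentiableI[OF has_derivative_inner_left[OF smooth_on_has_derivative[OF smooth_on_frechet[OF f] S(2)]]])
    finally show ?thesis .
  qed
  moreover have "smooth_on S (\<lambda>z. f z \<bullet> b)"
    by (rule smooth_on_bounded_linear[OF S(1) bounded_linear_inner_left f])
  ultimately show "frechet_derivative (\<lambda>y. frechet_derivative f (at y) v) (at x) w \<bullet> b
      = frechet_derivative (\<lambda>y. frechet_derivative f (at y) w) (at x) v \<bullet> b"
    using second_derivative_symmetric_real[OF S] by simp
qed

section \<open>Differential calculus in charts\<close>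

text \<open>The same notion as \<open>smooth_fun\<close> for functions with values in a normed space, such as the
  components of vector fields.\<close>

definition smooth_in :: "('m, 'e::euclidean_space) mfd \<Rightarrow> 'm set \<Rightarrow> ('m \<Rightarrow> 'b::real_normed_vector) \<Rightarrow> bool"
  where "smooth_in M W F \<longleftrightarrow> (\<forall>c\<in>charts M. smooth_on (cmap c ` (cdom c \<inter> W)) (F \<circ> cinv c))"

text \<open>The derivative in the coordinates of \<open>c\<close>, for a function on the manifold rather than for its
  coordinate representation: this allows the calculus to be done with functions of points.\<close>

definition chart_deriv ::
  "('m, 'e::euclidean_space) chart \<Rightarrow> ('m \<Rightarrow> 'b::real_normed_vector) \<Rightarrow> 'm \<Rightarrow> 'e \<Rightarrow> 'b"
  where "chart_deriv c F p = frechet_derivative (F \<circ> cinv c) (at (cmap c p))"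

text \<open>The part of the definition of a manifold that does not involve its topology.  The tangent bundle
  is first shown to be of this kind, and the lemmas of this locale then serve in proving that it
  is Hausdorff and second countable.\<close>

locale smooth_atlas =
  fixes M :: "('m, 'e::euclidean_space) mfd"
  assumes inj_chart: "c \<in> charts M \<Longrightarrow> inj_on (cmap c) (cdom c)"
    and open_chart_image: "c \<in> charts M \<Longrightarrow> open (cmap c ` cdom c)"
    and open_overlap: "c \<in> charts M \<Longrightarrow> d \<in> charts M \<Longrightarrow> open (cmap c ` (cdom c \<inter> cdom d))"
    and smooth_transition: "c \<in> charts M \<Longrightarrow> d \<in> charts M \<Longrightarrow>
      smooth_on (cmap c ` (cdom c \<inter> cdom d)) (cmap d \<circ> cinv c)"
    and chart_at_charts: "p \<in> points M \<Longrightarrow> chart_at M p \<in> charts M"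
    and in_chart_at: "p \<in> points M \<Longrightarrow> p \<in> cdom (chart_at M p)"

lemma smooth_manifold_atlas: "smooth_manifold M \<Longrightarrow> smooth_atlas M"
  unfolding smooth_manifold_def smooth_atlas_def by blast

context smooth_atlas
begin

lemma cinv_cmap [simp]: "c \<in> charts M \<Longrightarrow> p \<in> cdom c \<Longrightarrow> cinv c (cmap c p) = p"
  using inj_chart by (simp add: cinv_def)

lemma cdom_points: "c \<in> charts M \<Longrightarrow> p \<in> cdom c \<Longrightarrow> p \<in> points M"
  by (auto simp: points_def)

lemma istopology_atlas:
  "istopology (\<lambda>W. W \<subseteq> points M \<and> (\<forall>c\<in>charts M. open (cmap c ` (W \<inter> cdom c))))"
  unfolding istopology_def
proof (intro conjI allI impI)
  fix S T
  assume a: "S \<subseteq> points M \<and> (\<forall>c\<in>charts M. open (cmap c ` (S \<inter> cdom c)))"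
    "T \<subseteq> points M \<and> (\<forall>c\<in>charts M. open (cmap c ` (T \<inter> cdom c)))"
  have "cmap c ` (S \<inter> T \<inter> cdom c) = cmap c ` (S \<inter> cdom c) \<inter> cmap c ` (T \<inter> cdom c)"
    if "c \<in> charts M" for c
    using inj_on_image_Int[OF inj_chart[OF that], of "S \<inter> cdom c" "T \<inter> cdom c"]
    by (simp add: Int_ac)
  then show "S \<inter> T \<subseteq> points M" "\<forall>c\<in>charts M. open (cmap c ` (S \<inter> T \<inter> cdom c))"
    using a by auto
next
  fix \<K>
  assume a: "\<forall>K\<in>\<K>. K \<subseteq> points M \<and> (\<forall>c\<in>charts M. open (cmap c ` (K \<inter> cdom c)))"
  then show "\<Union>\<K> \<subseteq> points M" by blast
  show "\<forall>c\<in>charts M. open (cmap c ` (\<Union>\<K> \<inter> cdom c))"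
  proof
    fix c assume "c \<in> charts M"
    moreover have "cmap c ` (\<Union>\<K> \<inter> cdom c) = (\<Union>K\<in>\<K>. cmap c ` (K \<inter> cdom c))" by blast
    ultimately show "open (cmap c ` (\<Union>\<K> \<inter> cdom c))" using a by (metis (no_types, lifting) open_UN)
  qed
qed

lemma openin_mtop_iff:
  "openin (mtop M) W \<longleftrightarrow> W \<subseteq> points M \<and> (\<forall>c\<in>charts M. open (cmap c ` (cdom c \<inter> W)))"
  unfolding mtop_def using topology_inverse'[OF istopology_atlas] by (simp add: Int_commute)

lemma open_image: "openin (mtop M) W \<Longrightarrow> c \<in> charts M \<Longrightarrow> open (cmap c ` (cdom c \<inter> W))"
  by (simp add: openin_mtop_iff)

lemma openin_points: "openin (mtop M) W \<Longrightarrow> p \<in> W \<Longrightarrow> p \<in> points M"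
  by (auto simp: openin_mtop_iff)

lemma chart_at_openin:
  assumes "openin (mtop M) W" "p \<in> W"
  shows "chart_at M p \<in> charts M" "p \<in> cdom (chart_at M p)"
  using chart_at_charts in_chart_at openin_points[OF assms] by blast+

lemma openin_cdom: "c \<in> charts M \<Longrightarrow> openin (mtop M) (cdom c)"
  by (auto simp: openin_mtop_iff points_def open_overlap)

lemma openin_cdom_Int: "c \<in> charts M \<Longrightarrow> openin (mtop M) W \<Longrightarrow> openin (mtop M) (cdom c \<inter> W)"
  using openin_cdom by blast

lemma topspace_mtop: "topspace (mtop M) = points M"
proof -
  have "openin (mtop M) (points M)" unfolding points_def using openin_cdom by blast
  then show ?thesis using openin_mtop_iff openin_subset openin_topspace by blast
qed

lemma openin_chart_preimage:
  assumes c: "c \<in> charts M" and V: "open V"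
  shows "openin (mtop M) {p \<in> cdom c. cmap c p \<in> V}"
  unfolding openin_mtop_iff
proof (intro conjI ballI)
  fix d assume d: "d \<in> charts M"
  let ?S = "cmap d ` (cdom d \<inter> cdom c)"
  have "open (?S \<inter> (cmap c \<circ> cinv d) -` V)"
    by (rule continuous_open_preimage[OF smooth_on_imp_continuous_on open_overlap V])
      (use smooth_transition c d in auto)
  moreover have "?S \<inter> (cmap c \<circ> cinv d) -` V = cmap d ` (cdom d \<inter> {p \<in> cdom c. cmap c p \<in> V})"
    using d by auto
  ultimately show "open (cmap d ` (cdom d \<inter> {p \<in> cdom c. cmap c p \<in> V}))" by simp
qed (use cdom_points[OF c] in auto)

lemma smooth_inD: "smooth_in M W F \<Longrightarrow> c \<in> charts M \<Longrightarrow> smooth_on (cmap c ` (cdom c \<inter> W)) (F \<circ> cinv c)"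
  by (simp add: smooth_in_def)

lemma smooth_in_subset: "smooth_in M W F \<Longrightarrow> V \<subseteq> W \<Longrightarrow> smooth_in M V F"
  unfolding smooth_in_def
  by (meson Int_mono image_mono order_refl smooth_on_subset)

text \<open>Inside the domain of a chart, smoothness may be tested in that chart alone, as transition maps
  are smooth.\<close>

lemma smooth_inI_chart:
  assumes c: "c \<in> charts M" and W: "openin (mtop M) W" "W \<subseteq> cdom c"
    and F: "smooth_on (cmap c ` W) (F \<circ> cinv c)"
  shows "smooth_in M W F"
  unfolding smooth_in_def
proof
  fix d assume d: "d \<in> charts M"
  show "smooth_on (cmap d ` (cdom d \<inter> W)) (F \<circ> cinv d)"
  proof (rule smooth_on_cong[OF open_image[OF W(1) d]])
    show "smooth_on (cmap d ` (cdom d \<inter> W)) (\<lambda>x. (F \<circ> cinv c) ((cmap c \<circ> cinv d) x))"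
    proof (rule smooth_on_compose[OF open_image[OF W(1) d] _ F])
      show "smooth_on (cmap d ` (cdom d \<inter> W)) (cmap c \<circ> cinv d)"
        by (rule smooth_on_subset[OF smooth_transition[OF d c]]) (use W in auto)
    qed (use W d in auto)
    show "(F \<circ> cinv c) ((cmap c \<circ> cinv d) x) = (F \<circ> cinv d) x" if "x \<in> cmap d ` (cdom d \<inter> W)" for x
      using that c d W by auto
  qed
qed

lemma smooth_in_local:
  assumes "\<And>p. p \<in> W \<Longrightarrow> \<exists>V. openin (mtop M) V \<and> p \<in> V \<and> smooth_in M V F"
  shows "smooth_in M W F"
  unfolding smooth_in_def
proof
  fix c assume c: "c \<in> charts M"
  show "smooth_on (cmap c ` (cdom c \<inter> W)) (F \<circ> cinv c)"
  proof (rule smooth_on_local)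
    fix x assume "x \<in> cmap c ` (cdom c \<inter> W)"
    then obtain p where p: "p \<in> cdom c" "p \<in> W" "x = cmap c p" by auto
    then obtain V where V: "openin (mtop M) V" "p \<in> V" "smooth_in M V F" using assms by blast
    then show "\<exists>T. open T \<and> x \<in> T \<and> smooth_on T (F \<circ> cinv c)"
      using p open_image[OF V(1) c] smooth_inD[OF V(3) c] by blast
  qed
qed

lemma smooth_in_cong:
  assumes "openin (mtop M) W" "\<And>p. p \<in> W \<Longrightarrow> F p = G p" "smooth_in M W F"
  shows "smooth_in M W G"
  unfolding smooth_in_def
proof
  fix c assume c: "c \<in> charts M"
  show "smooth_on (cmap c ` (cdom c \<inter> W)) (G \<circ> cinv c)"
    by (rule smooth_on_cong[OF open_image[OF assms(1) c] _ smooth_inD[OF assms(3) c]])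
      (use assms(2) c in auto)
qed

lemma smooth_in_const: "openin (mtop M) W \<Longrightarrow> smooth_in M W (\<lambda>p. k)"
  unfolding smooth_in_def o_def using open_image smooth_on_const by blast

lemma smooth_in_bounded_linear:
  "openin (mtop M) W \<Longrightarrow> bounded_linear L \<Longrightarrow> smooth_in M W F \<Longrightarrow> smooth_in M W (\<lambda>p. L (F p))"
  unfolding smooth_in_def o_def using open_image smooth_on_bounded_linear by blast

lemma smooth_in_add:
  "openin (mtop M) W \<Longrightarrow> smooth_in M W F \<Longrightarrow> smooth_in M W G \<Longrightarrow> smooth_in M W (\<lambda>p. F p + G p)"
  unfolding smooth_in_def o_def using open_image smooth_on_add by blast

lemma smooth_in_minus:
  "openin (mtop M) W \<Longrightarrow> smooth_in M W F \<Longrightarrow> smooth_in M W (\<lambda>p. - F p)"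
  by (rule smooth_in_bounded_linear[OF _ bounded_linear_minus[OF bounded_linear_ident]])

lemma smooth_in_diff:
  "openin (mtop M) W \<Longrightarrow> smooth_in M W F \<Longrightarrow> smooth_in M W G \<Longrightarrow> smooth_in M W (\<lambda>p. F p - G p)"
  using smooth_in_add[of W F "\<lambda>p. - G p"] smooth_in_minus[of W G] by simp

lemma smooth_in_Pair:
  "openin (mtop M) W \<Longrightarrow> smooth_in M W F \<Longrightarrow> smooth_in M W G \<Longrightarrow> smooth_in M W (\<lambda>p. (F p, G p))"
  unfolding smooth_in_def o_def using open_image smooth_on_Pair by blast

lemma smooth_in_bilinear:
  "openin (mtop M) W \<Longrightarrow> bounded_bilinear B \<Longrightarrow> smooth_in M W F \<Longrightarrow> smooth_in M W G
    \<Longrightarrow> smooth_in M W (\<lambda>p. B (F p) (G p))"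
  unfolding smooth_in_def o_def by (metis open_image smooth_on_bilinear)

lemmas smooth_in_scaleR = smooth_in_bilinear[OF _ bounded_bilinear_scaleR]

lemma smooth_in_sum:
  "openin (mtop M) W \<Longrightarrow> (\<And>i. i \<in> I \<Longrightarrow> smooth_in M W (F i)) \<Longrightarrow> smooth_in M W (\<lambda>p. \<Sum>i\<in>I. F i p)"
  by (induction I rule: infinite_finite_induct) (auto intro: smooth_in_const smooth_in_add)

lemma smooth_in_linear_family:
  fixes h :: "'m \<Rightarrow> 'b::euclidean_space" and A :: "'m \<Rightarrow> 'b \<Rightarrow> 'c::real_normed_vector"
  assumes W: "openin (mtop M) W" and "\<And>p. p \<in> W \<Longrightarrow> linear (A p)"
    "\<And>v. smooth_in M W (\<lambda>p. A p v)" "smooth_in M W h"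
  shows "smooth_in M W (\<lambda>p. A p (h p))"
  unfolding smooth_in_def o_def
proof
  fix c assume c: "c \<in> charts M"
  show "smooth_on (cmap c ` (cdom c \<inter> W)) (\<lambda>x. A (cinv c x) (h (cinv c x)))"
    by (rule smooth_on_linear_family[OF open_image[OF W c]])
      (use assms c in \<open>auto simp: smooth_in_def o_def\<close>)
qed

lemma smooth_in_inverse_family:
  fixes A B :: "'m \<Rightarrow> 'b::euclidean_space \<Rightarrow> 'b"
  assumes W: "openin (mtop M) W" and "\<And>p. p \<in> W \<Longrightarrow> linear (A p)"
    "\<And>v. smooth_in M W (\<lambda>p. A p v)"
    "\<And>p v. p \<in> W \<Longrightarrow> A p (B p v) = v" "\<And>p v. p \<in> W \<Longrightarrow> B p (A p v) = v"
  shows "smooth_in M W (\<lambda>p. B p v)"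
  unfolding smooth_in_def o_def
proof
  fix c assume c: "c \<in> charts M"
  show "smooth_on (cmap c ` (cdom c \<inter> W)) (\<lambda>x. B (cinv c x) v)"
    by (rule smooth_on_inverse_family[OF open_image[OF W c], where A = "\<lambda>x. A (cinv c x)"])
      (use assms c in \<open>auto simp: smooth_in_def o_def\<close>)
qed

lemma smooth_in_cmap: "c \<in> charts M \<Longrightarrow> smooth_in M (cdom c) (cmap c)"
proof (rule smooth_inI_chart)
  assume c: "c \<in> charts M"
  show "smooth_on (cmap c ` cdom c) (cmap c \<circ> cinv c)"
    by (rule smooth_on_cong[OF open_chart_image[OF c] _ smooth_on_ident[OF open_chart_image[OF c]]])
      (use c in auto)
qed (auto intro: openin_cdom)

lemma has_chart_deriv:
  assumes "openin (mtop M) W" "smooth_in M W F" "c \<in> charts M" "p \<in> W" "p \<in> cdom c"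
  shows "((F \<circ> cinv c) has_derivative chart_deriv c F p) (at (cmap c p))"
  unfolding chart_deriv_def
  by (rule smooth_on_has_derivative[OF smooth_inD[OF assms(2,3)]]) (use assms in auto)

lemma chart_deriv_linear:
  assumes "openin (mtop M) W" "smooth_in M W F" "c \<in> charts M" "p \<in> W" "p \<in> cdom c"
  shows "linear (chart_deriv c F p)"
  using has_derivative_linear[OF has_chart_deriv[OF assms]] .

lemma chart_derivI:
  assumes "((F \<circ> cinv c) has_derivative D) (at (cmap c p))"
  shows "chart_deriv c F p = D"
  unfolding chart_deriv_def using frechet_derivative_at[OF assms] by simp

lemma chart_deriv_cong:
  assumes W: "openin (mtop M) W" "smooth_in M W F" "c \<in> charts M" "p \<in> W" "p \<in> cdom c"
    and eq: "\<And>q. q \<in> W \<Longrightarrow> F q = G q"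
  shows "chart_deriv c G p = chart_deriv c F p"
  by (rule chart_derivI, rule has_derivative_transform_within_open[OF has_chart_deriv[OF W(1-5)]
        open_image[OF W(1,3)]]) (use W eq in auto)

lemma chart_deriv_const: "chart_deriv c (\<lambda>q. k) p v = 0"
  unfolding chart_deriv_def by (simp add: o_def)

lemma chart_deriv_add:
  assumes W: "openin (mtop M) W" "c \<in> charts M" "p \<in> W" "p \<in> cdom c"
    and F: "smooth_in M W F" and G: "smooth_in M W G"
  shows "chart_deriv c (\<lambda>q. F q + G q) p v = chart_deriv c F p v + chart_deriv c G p v"
proof -
  have "chart_deriv c (\<lambda>q. F q + G q) p = (\<lambda>v. chart_deriv c F p v + chart_deriv c G p v)"
    by (rule chart_derivI) (use has_derivative_add[OF has_chart_deriv[OF W(1) F W(2-4)]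
          has_chart_deriv[OF W(1) G W(2-4)]] in \<open>simp add: o_def\<close>)
  then show ?thesis by simp
qed

lemma chart_deriv_bounded_linear:
  assumes W: "openin (mtop M) W" "c \<in> charts M" "p \<in> W" "p \<in> cdom c"
    and L: "bounded_linear L" and F: "smooth_in M W F"
  shows "chart_deriv c (\<lambda>q. L (F q)) p v = L (chart_deriv c F p v)"
proof -
  have "chart_deriv c (\<lambda>q. L (F q)) p = (\<lambda>v. L (chart_deriv c F p v))"
    by (rule chart_derivI)
      (use bounded_linear.has_derivative[OF L has_chart_deriv[OF W(1) F W(2-4)]] in \<open>simp add: o_def\<close>)
  then show ?thesis by simp
qed

lemma chart_deriv_bilinear:
  assumes W: "openin (mtop M) W" "c \<in> charts M" "p \<in> W" "p \<in> cdom c"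
    and B: "bounded_bilinear B" and F: "smooth_in M W F" and G: "smooth_in M W G"
  shows "chart_deriv c (\<lambda>q. B (F q) (G q)) p v = B (F p) (chart_deriv c G p v) + B (chart_deriv c F p v) (G p)"
proof -
  have "chart_deriv c (\<lambda>q. B (F q) (G q)) p = (\<lambda>v. B (F p) (chart_deriv c G p v) + B (chart_deriv c F p v) (G p))"
    by (rule chart_derivI)
      (use bounded_bilinear.FDERIV[OF B has_chart_deriv[OF W(1) F W(2-4)] has_chart_deriv[OF W(1) G W(2-4)]] W
       in \<open>simp add: o_def\<close>)
  then show ?thesis by simp
qed

lemmas chart_deriv_scaleR = chart_deriv_bilinear[OF _ _ _ _ bounded_bilinear_scaleR]

lemma chart_deriv_sum:
  assumes W: "openin (mtop M) W" "c \<in> charts M" "p \<in> W" "p \<in> cdom c"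
    and F: "\<And>i. i \<in> I \<Longrightarrow> smooth_in M W (F i)"
  shows "chart_deriv c (\<lambda>q. \<Sum>i\<in>I. F i q) p v = (\<Sum>i\<in>I. chart_deriv c (F i) p v)"
  using F by (induction I rule: infinite_finite_induct)
    (auto simp: chart_deriv_const chart_deriv_add[OF W] smooth_in_sum W)

text \<open>Product rule for a varying linear map applied to a varying vector, proved by expansion in the
  basis.\<close>

lemma chart_deriv_linear_family:
  fixes h :: "'m \<Rightarrow> 'b::euclidean_space" and A :: "'m \<Rightarrow> 'b \<Rightarrow> 'c::real_normed_vector"
  assumes W: "openin (mtop M) W" "c \<in> charts M" "p \<in> W" "p \<in> cdom c"
    and lin: "\<And>q. q \<in> W \<Longrightarrow> linear (A q)" and A: "\<And>v. smooth_in M W (\<lambda>q. A q v)"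
    and h: "smooth_in M W h"
  shows "chart_deriv c (\<lambda>q. A q (h q)) p v = chart_deriv c (\<lambda>q. A q (h p)) p v + A p (chart_deriv c h p v)"
proof -
  have hb: "smooth_in M W (\<lambda>q. h q \<bullet> b)" for b
    by (rule smooth_in_bounded_linear[OF W(1) bounded_linear_inner_left h])
  have eq: "chart_deriv c (\<lambda>q. A q (k q)) p v
      = chart_deriv c (\<lambda>q. \<Sum>b\<in>Basis. (k q \<bullet> b) *\<^sub>R A q b) p v" if k: "smooth_in M W k" for k
    by (subst chart_deriv_cong[OF W(1) smooth_in_linear_family[OF W(1) lin A k] W(2-4)])
      (simp_all add: linear_eq_sum_Basis[OF lin, symmetric])
  have "chart_deriv c (\<lambda>q. A q (h q)) p v
      = (\<Sum>b\<in>Basis. chart_deriv c (\<lambda>q. (h q \<bullet> b) *\<^sub>R A q b) p v)"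
    by (subst eq[OF h], rule chart_deriv_sum[OF W]) (intro smooth_in_scaleR W hb A)
  also have "\<dots> = (\<Sum>b\<in>Basis. (h p \<bullet> b) *\<^sub>R chart_deriv c (\<lambda>q. A q b) p v
      + (chart_deriv c h p v \<bullet> b) *\<^sub>R A p b)"
    by (simp add: chart_deriv_scaleR[OF W hb A]
        chart_deriv_bounded_linear[OF W bounded_linear_inner_left h])
  also have "\<dots> = (\<Sum>b\<in>Basis. (h p \<bullet> b) *\<^sub>R chart_deriv c (\<lambda>q. A q b) p v) + A p (chart_deriv c h p v)"
    by (simp add: sum.distrib linear_eq_sum_Basis[OF lin[OF W(3)], symmetric])
  also have "(\<Sum>b\<in>Basis. (h p \<bullet> b) *\<^sub>R chart_deriv c (\<lambda>q. A q b) p v)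
      = chart_deriv c (\<lambda>q. \<Sum>b\<in>Basis. (h p \<bullet> b) *\<^sub>R A q b) p v"
    by (subst chart_deriv_sum[OF W])
      (auto intro!: smooth_in_scaleR W A smooth_in_const
        simp: chart_deriv_scaleR[OF W smooth_in_const[OF W(1)] A] chart_deriv_const)
  also have "\<dots> = chart_deriv c (\<lambda>q. A q (h p)) p v"
    using eq[OF smooth_in_const[OF W(1)]] by simp
  finally show ?thesis .
qed

lemma smooth_in_chart_deriv:
  assumes W: "openin (mtop M) W" "W \<subseteq> cdom c" "c \<in> charts M" and F: "smooth_in M W F"
  shows "smooth_in M W (\<lambda>p. chart_deriv c F p v)"
proof (rule smooth_inI_chart[OF W(3) W(1,2)])
  have op: "open (cmap c ` W)" and sm: "smooth_on (cmap c ` W) (F \<circ> cinv c)"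
    using open_image[OF W(1,3)] smooth_inD[OF F W(3)] W(2) by (simp_all add: Int_absorb1)
  show "smooth_on (cmap c ` W) ((\<lambda>p. chart_deriv c F p v) \<circ> cinv c)"
    by (rule smooth_on_cong[OF op _ smooth_on_frechet[OF sm, of v]])
      (use W in \<open>auto simp: chart_deriv_def\<close>)
qed

lemma chart_deriv_symmetric:
  fixes F :: "'m \<Rightarrow> 'b::euclidean_space"
  assumes W: "openin (mtop M) W" "c \<in> charts M" "p \<in> W" "p \<in> cdom c" and F: "smooth_in M W F"
  shows "chart_deriv c (\<lambda>q. chart_deriv c F q v) p w = chart_deriv c (\<lambda>q. chart_deriv c F q w) p v"
proof -
  let ?S = "cmap c ` (cdom c \<inter> W)"
  have S: "open ?S" "cmap c p \<in> ?S" using W open_image by auto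
  have "chart_deriv c (\<lambda>q. chart_deriv c F q v) p =
     frechet_derivative (\<lambda>x. frechet_derivative (F \<circ> cinv c) (at x) v) (at (cmap c p))" for v
  proof (rule chart_derivI)
    show "((\<lambda>q. chart_deriv c F q v) \<circ> cinv c has_derivative
        frechet_derivative (\<lambda>x. frechet_derivative (F \<circ> cinv c) (at x) v) (at (cmap c p))) (at (cmap c p))"
      by (rule has_derivative_transform_within_open[OF
            smooth_on_has_derivative[OF smooth_on_frechet[OF smooth_inD[OF F W(2)]] S(2)] S])
        (use W in \<open>auto simp: chart_deriv_def\<close>)
  qed
  then show ?thesis using second_derivative_symmetric[OF S smooth_inD[OF F W(2)]] by simp
qed

lemma chart_deriv_change:
  assumes W: "openin (mtop M) W" "smooth_in M W F" "p \<in> W"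
    and c: "c \<in> charts M" "p \<in> cdom c" and d: "d \<in> charts M" "p \<in> cdom d"
  shows "chart_deriv c F p v = chart_deriv d F p (coord_change c d p v)"
proof -
  have "((cmap d \<circ> cinv c) has_derivative coord_change c d p) (at (cmap c p))"
    using has_chart_deriv[OF openin_cdom[OF d(1)] smooth_in_cmap[OF d(1)] c(1) d(2) c(2)]
    by (simp add: coord_change_def chart_deriv_def)
  moreover have "((F \<circ> cinv d) has_derivative chart_deriv d F p) (at ((cmap d \<circ> cinv c) (cmap c p)))"
    using has_chart_deriv[OF W(1,2) d(1) W(3) d(2)] c by simp
  ultimately have D: "((\<lambda>x. (F \<circ> cinv d) ((cmap d \<circ> cinv c) x)) has_derivative
      (\<lambda>v. chart_deriv d F p (coord_change c d p v))) (at (cmap c p))"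
    by (rule has_derivative_compose)
  have "chart_deriv c F p = (\<lambda>v. chart_deriv d F p (coord_change c d p v))"
    by (rule chart_derivI, rule has_derivative_transform_within_open[OF D open_overlap[OF c(1) d(1)]])
      (use c d in auto)
  then show ?thesis by simp
qed

text \<open>The change of components is itself a chart derivative.  Its smoothness, its cocycle property and
  the symmetry of its derivatives are therefore special cases of facts about \<open>chart_deriv\<close>.\<close>

lemma coord_change_chart_deriv: "coord_change c d p = chart_deriv c (cmap d) p"
  by (simp add: coord_change_def chart_deriv_def)

lemma coord_change_trans:
  assumes "c \<in> charts M" "d \<in> charts M" "e \<in> charts M" "p \<in> cdom c" "p \<in> cdom d" "p \<in> cdom e"
  shows "coord_change d e p (coord_change c d p v) = coord_change c e p v"
  using chart_deriv_change[OF openin_cdom smooth_in_cmap, of e p c d] assms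
  by (simp add: coord_change_chart_deriv)

lemma coord_change_self: "c \<in> charts M \<Longrightarrow> p \<in> cdom c \<Longrightarrow> coord_change c c p v = v"
proof -
  assume c: "c \<in> charts M" "p \<in> cdom c"
  have "chart_deriv c (cmap c) p = (\<lambda>v. v)"
    by (rule chart_derivI, rule has_derivative_transform_within_open[OF has_derivative_ident
          open_chart_image[OF c(1)]]) (use c in auto)
  then show ?thesis by (simp add: coord_change_chart_deriv)
qed

lemma linear_coord_change:
  assumes "c \<in> charts M" "d \<in> charts M" "p \<in> cdom c" "p \<in> cdom d"
  shows "linear (coord_change c d p)"
  unfolding coord_change_chart_deriv
  by (rule chart_deriv_linear[OF openin_cdom smooth_in_cmap]) (use assms in auto)

lemma smooth_in_coord_change:
  assumes "c \<in> charts M" "d \<in> charts M"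
  shows "smooth_in M (cdom c \<inter> cdom d) (\<lambda>p. coord_change c d p v)"
  unfolding coord_change_chart_deriv
  by (rule smooth_in_chart_deriv[OF _ _ _ smooth_in_subset[OF smooth_in_cmap]])
    (use assms in \<open>auto intro: openin_cdom\<close>)

lemma to_of_chart [simp]: "c \<in> charts M \<Longrightarrow> p \<in> cdom c \<Longrightarrow> to_chart M c p (of_chart M c p v) = v"
  unfolding to_chart_def of_chart_def
  using coord_change_self[of c p] coord_change_self[of "chart_at M p" p]
  by (subst coord_change_trans) (simp_all add: chart_at_charts in_chart_at cdom_points[of c p])

lemma of_to_chart [simp]: "c \<in> charts M \<Longrightarrow> p \<in> cdom c \<Longrightarrow> of_chart M c p (to_chart M c p v) = v"
  unfolding to_chart_def of_chart_def
  using coord_change_self[of c p] coord_change_self[of "chart_at M p" p]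
  by (subst coord_change_trans) (simp_all add: chart_at_charts in_chart_at cdom_points[of c p])

lemma coord_change_to_chart:
  assumes "c \<in> charts M" "d \<in> charts M" "p \<in> cdom c" "p \<in> cdom d"
  shows "coord_change c d p (to_chart M c p v) = to_chart M d p v"
  unfolding to_chart_def
  by (rule coord_change_trans) (use assms in \<open>auto intro: chart_at_charts in_chart_at cdom_points\<close>)

lemma of_chart_coord_change:
  assumes "c \<in> charts M" "d \<in> charts M" "p \<in> cdom c" "p \<in> cdom d"
  shows "of_chart M d p (coord_change c d p v) = of_chart M c p v"
  unfolding of_chart_def
  by (rule coord_change_trans) (use assms in \<open>auto intro: chart_at_charts in_chart_at cdom_points\<close>)

lemma linear_to_chart: "c \<in> charts M \<Longrightarrow> p \<in> cdom c \<Longrightarrow> linear (to_chart M c p)"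
  unfolding to_chart_def
  by (rule linear_coord_change) (auto intro: chart_at_charts in_chart_at cdom_points)

lemma linear_of_chart: "c \<in> charts M \<Longrightarrow> p \<in> cdom c \<Longrightarrow> linear (of_chart M c p)"
  unfolding of_chart_def
  by (rule linear_coord_change) (auto intro: chart_at_charts in_chart_at cdom_points)

lemma to_chart_at [simp]: "p \<in> points M \<Longrightarrow> to_chart M (chart_at M p) p v = v"
  unfolding to_chart_def by (simp add: coord_change_self chart_at_charts in_chart_at)

lemma of_chart_at [simp]: "p \<in> points M \<Longrightarrow> of_chart M (chart_at M p) p v = v"
  unfolding of_chart_def by (simp add: coord_change_self chart_at_charts in_chart_at)

lemma along_chart:
  assumes "openin (mtop M) W" "smooth_in M W f" "c \<in> charts M" "p \<in> W" "p \<in> cdom c"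
  shows "along M X f p = chart_deriv c f p (to_chart M c p (X p))"
proof -
  have p: "p \<in> points M" using assms(3,5) cdom_points by blast
  have "along M X f p = chart_deriv (chart_at M p) f p (X p)"
    by (simp add: along_def chart_deriv_def)
  also have "\<dots> = chart_deriv c f p (to_chart M c p (X p))"
    unfolding to_chart_def using chart_deriv_change[OF assms(1,2,4) chart_at_charts[OF p] in_chart_at[OF p] assms(3,5)] .
  finally show ?thesis .
qed

lemma smooth_fun_iff: "smooth_fun M U f \<longleftrightarrow> smooth_in M U f"
  by (simp add: smooth_fun_def smooth_in_def)

lemma vector_fieldD:
  assumes "openin (mtop M) U" "vector_field M U X" "c \<in> charts M"
  shows "smooth_in M (cdom c \<inter> U) (\<lambda>p. to_chart M c p (X p))"
  by (rule smooth_inI_chart) (use assms in \<open>auto simp: vector_field_def intro: openin_cdom\<close>)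

text \<open>It is enough to test smoothness in one chart around each point.\<close>

lemma vector_fieldI:
  assumes U: "openin (mtop M) U"
    and X: "\<And>p. p \<in> U \<Longrightarrow> \<exists>c\<in>charts M. p \<in> cdom c \<and> smooth_in M (cdom c \<inter> U) (\<lambda>p. to_chart M c p (X p))"
  shows "vector_field M U X"
  unfolding vector_field_def
proof
  fix d assume d: "d \<in> charts M"
  have "smooth_in M (cdom d \<inter> U) (\<lambda>p. to_chart M d p (X p))"
  proof (rule smooth_in_local)
    fix p assume p: "p \<in> cdom d \<inter> U"
    then obtain c where c: "c \<in> charts M" "p \<in> cdom c" "smooth_in M (cdom c \<inter> U) (\<lambda>p. to_chart M c p (X p))"
      using X by blast
    let ?V = "cdom c \<inter> cdom d \<inter> U"
    have V: "openin (mtop M) ?V" using c d U by (auto intro: openin_cdom)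
    have "smooth_in M ?V (\<lambda>p. coord_change c d p (to_chart M c p (X p)))"
      by (rule smooth_in_linear_family[OF V _ smooth_in_subset[OF smooth_in_coord_change] smooth_in_subset[OF c(3)]])
        (use c d linear_coord_change in auto)
    then have "smooth_in M ?V (\<lambda>p. to_chart M d p (X p))"
      by (rule smooth_in_cong[OF V, rotated]) (use c d in \<open>simp add: coord_change_to_chart\<close>)
    then show "\<exists>V. openin (mtop M) V \<and> p \<in> V \<and> smooth_in M V (\<lambda>p. to_chart M d p (X p))"
      using V p c by blast
  qed
  from smooth_inD[OF this d] show "smooth_on (cmap d ` (cdom d \<inter> U)) ((\<lambda>p. to_chart M d p (X p)) \<circ> cinv d)"
    by (simp add: Int_assoc[symmetric])
qed

lemma vector_field_subset: "vector_field M U X \<Longrightarrow> V \<subseteq> U \<Longrightarrow> vector_field M V X"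
  unfolding vector_field_def by (meson Int_mono image_mono order_refl smooth_on_subset)

lemma vector_field_coordinate:
  assumes c: "c \<in> charts M" and W: "openin (mtop M) W" "W \<subseteq> cdom c" and h: "smooth_in M W h"
  shows "vector_field M W (\<lambda>q. of_chart M c q (h q))"
proof (rule vector_fieldI[OF W(1)])
  fix p assume p: "p \<in> W"
  have "smooth_in M W (\<lambda>p. to_chart M c p (of_chart M c p (h p)))"
    by (rule smooth_in_cong[OF W(1) _ h]) (use W c in auto)
  then show "\<exists>c'\<in>charts M. p \<in> cdom c' \<and>
      smooth_in M (cdom c' \<inter> W) (\<lambda>q. to_chart M c' q (of_chart M c q (h q)))"
    using p W c by (intro bexI[of _ c]) (auto simp: Int_absorb1)
qed

lemma vector_field_const: "c \<in> charts M \<Longrightarrow> vector_field M (cdom c) (\<lambda>q. of_chart M c q v)"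
  by (rule vector_field_coordinate) (auto intro: openin_cdom smooth_in_const)

lemma tensor_field11D:
  assumes "openin (mtop M) U" "tensor_field11 M U J" "c \<in> charts M"
  shows "smooth_in M (cdom c \<inter> U) (\<lambda>p. to_chart M c p (J p (of_chart M c p v)))"
  by (rule smooth_inI_chart) (use assms in \<open>auto simp: tensor_field11_def intro: openin_cdom\<close>)

lemma tensor_field11I:
  fixes J :: "'m \<Rightarrow> 'e \<Rightarrow>\<^sub>L 'e"
  assumes "\<And>c v. c \<in> charts M \<Longrightarrow> smooth_in M (cdom c \<inter> U) (\<lambda>p. to_chart M c p (J p (of_chart M c p v)))"
  shows "tensor_field11 M U J"
  unfolding tensor_field11_def
proof (intro ballI allI)
  fix c v assume c: "c \<in> charts M"
  from smooth_inD[OF assms[OF c] c]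
  show "smooth_on (cmap c ` (cdom c \<inter> U)) ((\<lambda>p. to_chart M c p (J p (of_chart M c p v))) \<circ> cinv c)"
    by (simp add: Int_assoc[symmetric])
qed

lemma tensor_field11_subset: "tensor_field11 M U J \<Longrightarrow> V \<subseteq> U \<Longrightarrow> tensor_field11 M V J"
  unfolding tensor_field11_def by (meson Int_mono image_mono order_refl smooth_on_subset)

end

section \<open>Vector fields and affine connections in charts\<close>

context smooth_atlas
begin

lemma to_chart_of_chart:
  assumes "c \<in> charts M" "d \<in> charts M" "p \<in> cdom c" "p \<in> cdom d"
  shows "to_chart M d p (of_chart M c p v) = coord_change c d p v"
  using coord_change_to_chart[OF assms, of "of_chart M c p v"] assms by simp

lemma coord_change_inverse:
  assumes "c \<in> charts M" "d \<in> charts M" "p \<in> cdom c" "p \<in> cdom d"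
  shows "coord_change d c p (coord_change c d p v) = v"
  using coord_change_trans[of c d c p v] coord_change_self[of c p v] assms by simp

lemma smooth_in_bilinear_family:
  fixes h :: "'m \<Rightarrow> 'b::euclidean_space" and k :: "'m \<Rightarrow> 'd::euclidean_space"
    and A :: "'m \<Rightarrow> 'b \<Rightarrow> 'd \<Rightarrow> 'c::real_normed_vector"
  assumes W: "openin (mtop M) W" and bil: "\<And>p. p \<in> W \<Longrightarrow> bilinear (A p)"
    and A: "\<And>v w. smooth_in M W (\<lambda>p. A p v w)" and h: "smooth_in M W h" and k: "smooth_in M W k"
  shows "smooth_in M W (\<lambda>p. A p (h p) (k p))"
proof (rule smooth_in_linear_family[OF W _ _ k, where A = "\<lambda>p. A p (h p)"])
  show "linear (A p (h p))" if "p \<in> W" for p using bil[OF that] by (simp add: bilinear_def)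
  show "smooth_in M W (\<lambda>p. A p (h p) w)" for w
    by (rule smooth_in_linear_family[OF W _ A h]) (use bil in \<open>simp add: bilinear_def\<close>)
qed

lemma chart_deriv_bilinear_family:
  fixes h :: "'m \<Rightarrow> 'b::euclidean_space" and k :: "'m \<Rightarrow> 'd::euclidean_space"
    and A :: "'m \<Rightarrow> 'b \<Rightarrow> 'd \<Rightarrow> 'c::real_normed_vector"
  assumes W: "openin (mtop M) W" "c \<in> charts M" "p \<in> W" "p \<in> cdom c"
    and bil: "\<And>p. p \<in> W \<Longrightarrow> bilinear (A p)"
    and A: "\<And>v w. smooth_in M W (\<lambda>p. A p v w)" and h: "smooth_in M W h" and k: "smooth_in M W k"
  shows "chart_deriv c (\<lambda>q. A q (h q) (k q)) p v =
    chart_deriv c (\<lambda>q. A q (h p) (k p)) p v + A p (chart_deriv c h p v) (k p) + A p (h p) (chart_deriv c k p v)"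
proof -
  have lin1: "linear (A p w)" and lin2: "linear (\<lambda>v. A p v z)" if "p \<in> W" for p w z
    using bil[OF that] by (auto simp: bilinear_def)
  have "chart_deriv c (\<lambda>q. A q (h q) (k q)) p v =
      chart_deriv c (\<lambda>q. A q (h q) (k p)) p v + A p (h p) (chart_deriv c k p v)"
    by (rule chart_deriv_linear_family[OF W lin1 smooth_in_linear_family[OF W(1) lin2 A h] k])
  also have "chart_deriv c (\<lambda>q. A q (h q) (k p)) p v =
      chart_deriv c (\<lambda>q. A q (h p) (k p)) p v + A p (chart_deriv c h p v) (k p)"
    by (rule chart_deriv_linear_family[OF W lin2 A h])
  finally show ?thesis by simp
qed

lemma vector_field_add:
  assumes U: "openin (mtop M) U" and X: "vector_field M U X" and Y: "vector_field M U Y"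
  shows "vector_field M U (\<lambda>q. X q + Y q)"
proof (rule vector_fieldI[OF U])
  fix p assume "p \<in> U"
  then have p: "p \<in> points M" using openin_points[OF U] by blast
  let ?c = "chart_at M p"
  have c: "?c \<in> charts M" "p \<in> cdom ?c" using p chart_at_charts in_chart_at by auto
  have "smooth_in M (cdom ?c \<inter> U) (\<lambda>q. to_chart M ?c q (X q + Y q))"
    by (rule smooth_in_cong[OF openin_cdom_Int[OF c(1) U] _ smooth_in_add[OF openin_cdom_Int[OF c(1) U]
          vector_fieldD[OF U X c(1)] vector_fieldD[OF U Y c(1)]]])
      (simp add: linear_add[OF linear_to_chart] c)
  then show "\<exists>c\<in>charts M. p \<in> cdom c \<and> smooth_in M (cdom c \<inter> U) (\<lambda>q. to_chart M c q (X q + Y q))"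
    using c by blast
qed

lemma vector_field_scaleR:
  assumes U: "openin (mtop M) U" and X: "vector_field M U X" and f: "smooth_in M U f"
  shows "vector_field M U (\<lambda>q. f q *\<^sub>R X q)"
proof (rule vector_fieldI[OF U])
  fix p assume "p \<in> U"
  then have p: "p \<in> points M" using openin_points[OF U] by blast
  let ?c = "chart_at M p"
  have c: "?c \<in> charts M" "p \<in> cdom ?c" using p chart_at_charts in_chart_at by auto
  have "smooth_in M (cdom ?c \<inter> U) (\<lambda>q. to_chart M ?c q (f q *\<^sub>R X q))"
    by (rule smooth_in_cong[OF openin_cdom_Int[OF c(1) U] _ smooth_in_scaleR[OF openin_cdom_Int[OF c(1) U]
          smooth_in_subset[OF f] vector_fieldD[OF U X c(1)]]])
      (simp_all add: linear_scale[OF linear_to_chart] c)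
  then show "\<exists>c\<in>charts M. p \<in> cdom c \<and> smooth_in M (cdom c \<inter> U) (\<lambda>q. to_chart M c q (f q *\<^sub>R X q))"
    using c by blast
qed

lemma vector_field_sum:
  assumes U: "openin (mtop M) U" and I: "finite I" "I \<noteq> {}" and X: "\<And>i. i \<in> I \<Longrightarrow> vector_field M U (X i)"
  shows "vector_field M U (\<lambda>q. \<Sum>i\<in>I. X i q)"
  using I X by (induction I rule: finite_ne_induct) (auto intro: vector_field_add[OF U])

end

text \<open>The components in the chart \<open>c\<close> of the covariant derivative of the field with constant
  components \<open>w\<close> along the field with constant components \<open>v\<close>.\<close>

definition christoffel ::
  "('m, 'e::euclidean_space) mfd \<Rightarrow> (('m \<Rightarrow> 'e) \<Rightarrow> ('m \<Rightarrow> 'e) \<Rightarrow> 'm \<Rightarrow> 'e) \<Rightarrow> ('m, 'e) chart \<Rightarrow> 'm \<Rightarrow> 'e \<Rightarrow> 'e \<Rightarrow> 'e"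
  where "christoffel M D c p v w =
    to_chart M c p (D (\<lambda>q. of_chart M c q v) (\<lambda>q. of_chart M c q w) p)"

locale affine_manifold = smooth_atlas M for M :: "('m, 'e::euclidean_space) mfd" +
  fixes D :: "('m \<Rightarrow> 'e) \<Rightarrow> ('m \<Rightarrow> 'e) \<Rightarrow> 'm \<Rightarrow> 'e"
  assumes connection: "affine_connection M D"
begin

lemma connection_vector_field:
  "openin (mtop M) U \<Longrightarrow> vector_field M U X \<Longrightarrow> vector_field M U Y \<Longrightarrow> vector_field M U (D X Y)"
  using connection unfolding affine_connection_def by meson

lemma connection_cong:
  "openin (mtop M) U \<Longrightarrow> vector_field M U X \<Longrightarrow> vector_field M U Y \<Longrightarrow>
    (\<And>q. q \<in> U \<Longrightarrow> X' q = X q) \<Longrightarrow> (\<And>q. q \<in> U \<Longrightarrow> Y' q = Y q) \<Longrightarrow> p \<in> U \<Longrightarrow> D X' Y' p = D X Y p"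
  using connection unfolding affine_connection_def by meson

lemma connection_add_left:
  "openin (mtop M) U \<Longrightarrow> vector_field M U X \<Longrightarrow> vector_field M U X' \<Longrightarrow> vector_field M U Y \<Longrightarrow>
    p \<in> U \<Longrightarrow> D (\<lambda>q. X q + X' q) Y p = D X Y p + D X' Y p"
  using connection unfolding affine_connection_def by meson

lemma connection_scale_left:
  "openin (mtop M) U \<Longrightarrow> smooth_in M U f \<Longrightarrow> vector_field M U X \<Longrightarrow> vector_field M U Y \<Longrightarrow>
    p \<in> U \<Longrightarrow> D (\<lambda>q. f q *\<^sub>R X q) Y p = f p *\<^sub>R D X Y p"
  using connection unfolding affine_connection_def smooth_fun_iff[symmetric] by meson

lemma connection_add_right:
  "openin (mtop M) U \<Longrightarrow> vector_field M U X \<Longrightarrow> vector_field M U Y \<Longrightarrow> vector_field M U Y' \<Longrightarrow>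
    p \<in> U \<Longrightarrow> D X (\<lambda>q. Y q + Y' q) p = D X Y p + D X Y' p"
  using connection unfolding affine_connection_def by meson

lemma connection_scale_right:
  "openin (mtop M) U \<Longrightarrow> smooth_in M U f \<Longrightarrow> vector_field M U X \<Longrightarrow> vector_field M U Y \<Longrightarrow>
    p \<in> U \<Longrightarrow> D X (\<lambda>q. f q *\<^sub>R Y q) p = along M X f p *\<^sub>R Y p + f p *\<^sub>R D X Y p"
  using connection unfolding affine_connection_def smooth_fun_iff[symmetric] by meson

lemma connection_sum_left:
  assumes U: "openin (mtop M) U" "p \<in> U" and Y: "vector_field M U Y" and I: "finite I" "I \<noteq> {}"
    and X: "\<And>i. i \<in> I \<Longrightarrow> vector_field M U (X i)"
  shows "D (\<lambda>q. \<Sum>i\<in>I. X i q) Y p = (\<Sum>i\<in>I. D (X i) Y p)"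
  using I X
  by (induction I rule: finite_ne_induct)
    (auto simp: connection_add_left[OF U(1) _ _ Y U(2)] vector_field_sum[OF U(1)])

lemma connection_sum_right:
  assumes U: "openin (mtop M) U" "p \<in> U" and X: "vector_field M U X" and I: "finite I" "I \<noteq> {}"
    and Y: "\<And>i. i \<in> I \<Longrightarrow> vector_field M U (Y i)"
  shows "D X (\<lambda>q. \<Sum>i\<in>I. Y i q) p = (\<Sum>i\<in>I. D X (Y i) p)"
  using I Y
  by (induction I rule: finite_ne_induct)
    (auto simp: connection_add_right[OF U(1) X _ _ U(2)] vector_field_sum[OF U(1)])

abbreviation "\<Gamma> \<equiv> christoffel M D"

lemma smooth_in_christoffel:
  assumes c: "c \<in> charts M"
  shows "smooth_in M (cdom c) (\<lambda>p. \<Gamma> c p v w)"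
  using vector_fieldD[OF openin_cdom[OF c] connection_vector_field[OF openin_cdom[OF c]
        vector_field_const[OF c] vector_field_const[OF c]] c]
  by (simp add: christoffel_def)

lemma bilinear_christoffel:
  assumes c: "c \<in> charts M" and p: "p \<in> cdom c"
  shows "bilinear (\<Gamma> c p)"
proof -
  note U = openin_cdom[OF c] and vf = vector_field_const[OF c] and lin = linear_of_chart[OF c]
  note k = smooth_in_const[OF U]
  let ?E = "\<lambda>v q. of_chart M c q v"
  have 1: "D (?E (a + b)) (?E w) p = D (?E a) (?E w) p + D (?E b) (?E w) p" for a b w
    using connection_cong[OF U vector_field_add[OF U vf vf] vf _ _ p, of "?E (a + b)" a b "?E w" w]
    by (simp add: linear_add[OF lin] connection_add_left[OF U vf vf vf p])
  have 2: "D (?E (r *\<^sub>R a)) (?E w) p = r *\<^sub>R D (?E a) (?E w) p" for a r w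
    using connection_cong[OF U vector_field_scaleR[OF U vf k] vf _ _ p, of "?E (r *\<^sub>R a)" r a "?E w" w]
    by (simp add: linear_scale[OF lin] connection_scale_left[OF U k vf vf p])
  have 3: "D (?E w) (?E (a + b)) p = D (?E w) (?E a) p + D (?E w) (?E b) p" for a b w
    using connection_cong[OF U vf vector_field_add[OF U vf vf] _ _ p, of "?E w" w "?E (a + b)" a b]
    by (simp add: linear_add[OF lin] connection_add_right[OF U vf vf vf p])
  have 4: "D (?E w) (?E (r *\<^sub>R a)) p = r *\<^sub>R D (?E w) (?E a) p" for a r w
    using connection_cong[OF U vf vector_field_scaleR[OF U vf k] _ _ p, of "?E w" w "?E (r *\<^sub>R a)" r a]
    by (simp add: linear_scale[OF lin] connection_scale_right[OF U k vf vf p] along_chart[OF U k c p p]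
        chart_deriv_const)
  show ?thesis
    unfolding bilinear_def
    by (intro conjI allI linearI)
      (simp_all add: christoffel_def 1 2 3 4 linear_add[OF linear_to_chart[OF c p]]
        linear_scale[OF linear_to_chart[OF c p]])
qed

text \<open>Expand both fields in the coordinate fields of \<open>c\<close> and use that the connection is linear over
  functions in the first argument and a derivation in the second.\<close>

lemma connection_in_chart:
  assumes W: "openin (mtop M) W" "p \<in> W" and c: "c \<in> charts M" "p \<in> cdom c"
    and X: "vector_field M W X" and Y: "vector_field M W Y"
  shows "to_chart M c p (D X Y p) =
    chart_deriv c (\<lambda>q. to_chart M c q (Y q)) p (to_chart M c p (X p))
    + \<Gamma> c p (to_chart M c p (X p)) (to_chart M c p (Y p))"
proof -
  define U where "U = cdom c \<inter> W"
  have U: "openin (mtop M) U" "p \<in> U" unfolding U_def using openin_cdom_Int[OF c(1) W(1)] W c by auto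
  define E where "E b q = of_chart M c q b" for b q
  define Xc where "Xc q = to_chart M c q (X q)" for q
  define Yc where "Yc q = to_chart M c q (Y q)" for q
  have sm: "smooth_in M U Xc" "smooth_in M U Yc"
    unfolding Xc_def Yc_def U_def using vector_fieldD[OF W(1) X c(1)] vector_fieldD[OF W(1) Y c(1)] by auto
  have comp: "smooth_in M U (\<lambda>q. h q \<bullet> b)" if "smooth_in M U h" for h :: "'m \<Rightarrow> 'e" and b
    by (rule smooth_in_bounded_linear[OF U(1) bounded_linear_inner_left that])
  have E: "vector_field M U (E b)" for b
    unfolding E_def[abs_def] U_def by (rule vector_field_subset[OF vector_field_const[OF c(1)]]) auto
  have expand: "Z q = (\<Sum>b\<in>Basis. (to_chart M c q (Z q) \<bullet> b) *\<^sub>R E b q)" if "q \<in> U" for Z q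
  proof -
    have q: "q \<in> cdom c" using that by (simp add: U_def)
    have "Z q = of_chart M c q (to_chart M c q (Z q))" using c q by simp
    also have "\<dots> = (\<Sum>b\<in>Basis. (to_chart M c q (Z q) \<bullet> b) *\<^sub>R E b q)"
      unfolding E_def by (rule linear_eq_sum_Basis[OF linear_of_chart[OF c(1) q]])
    finally show ?thesis .
  qed
  have YU: "vector_field M U Y" and XU: "vector_field M U X"
    using vector_field_subset[OF Y] vector_field_subset[OF X] by (auto simp: U_def)
  have Xb: "vector_field M U (\<lambda>q. (Xc q \<bullet> b) *\<^sub>R E b q)" and Yb: "vector_field M U (\<lambda>q. (Yc q \<bullet> b) *\<^sub>R E b q)" for b
    by (intro vector_field_scaleR U(1) E comp sm)+
  have DX: "D X Y p = (\<Sum>b\<in>Basis. (Xc p \<bullet> b) *\<^sub>R D (E b) Y p)"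
  proof -
    have "D X Y p = D (\<lambda>q. \<Sum>b\<in>Basis. (Xc q \<bullet> b) *\<^sub>R E b q) Y p"
      by (rule connection_cong[OF U(1) vector_field_sum[OF U(1) finite_Basis nonempty_Basis Xb] YU _ _ U(2)])
        (use expand in \<open>auto simp: Xc_def\<close>)
    also have "\<dots> = (\<Sum>b\<in>Basis. (Xc p \<bullet> b) *\<^sub>R D (E b) Y p)"
      by (simp add: connection_sum_left[OF U YU finite_Basis nonempty_Basis Xb]
          connection_scale_left[OF U(1) comp[OF sm(1)] E YU U(2)])
    finally show ?thesis .
  qed
  have DY: "to_chart M c p (D (E b) Y p) = chart_deriv c Yc p b + \<Gamma> c p b (Yc p)" for b
  proof -
    have "D (E b) Y p = D (E b) (\<lambda>q. \<Sum>i\<in>Basis. (Yc q \<bullet> i) *\<^sub>R E i q) p"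
      by (rule connection_cong[OF U(1) E vector_field_sum[OF U(1) finite_Basis nonempty_Basis Yb] _ _ U(2)])
        (use expand in \<open>auto simp: Yc_def\<close>)
    also have "\<dots> = (\<Sum>i\<in>Basis. along M (E b) (\<lambda>q. Yc q \<bullet> i) p *\<^sub>R E i p + (Yc p \<bullet> i) *\<^sub>R D (E b) (E i) p)"
      by (simp add: connection_sum_right[OF U E finite_Basis nonempty_Basis Yb]
          connection_scale_right[OF U(1) comp[OF sm(2)] E E U(2)])
    finally have "to_chart M c p (D (E b) Y p) =
      (\<Sum>i\<in>Basis. along M (E b) (\<lambda>q. Yc q \<bullet> i) p *\<^sub>R i + (Yc p \<bullet> i) *\<^sub>R \<Gamma> c p b i)"
      using linear_to_chart[OF c] c
      by (simp add: linear_sum linear_add linear_scale christoffel_def E_def[abs_def])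
    moreover have "along M (E b) (\<lambda>q. Yc q \<bullet> i) p = chart_deriv c Yc p b \<bullet> i" for i
      using c by (simp add: along_chart[OF U(1) comp[OF sm(2)] c(1) U(2) c(2)] E_def
          chart_deriv_bounded_linear[OF U(1) c(1) U(2) c(2) bounded_linear_inner_left sm(2)])
    moreover have "(\<Sum>i\<in>Basis. (Yc p \<bullet> i) *\<^sub>R \<Gamma> c p b i) = \<Gamma> c p b (Yc p)"
      by (rule linear_eq_sum_Basis[symmetric]) (use bilinear_christoffel[OF c] in \<open>simp add: bilinear_def\<close>)
    ultimately show ?thesis by (simp add: sum.distrib euclidean_representation)
  qed
  have "to_chart M c p (D X Y p) = (\<Sum>b\<in>Basis. (Xc p \<bullet> b) *\<^sub>R (chart_deriv c Yc p b + \<Gamma> c p b (Yc p)))"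
    using linear_to_chart[OF c] by (simp add: DX linear_sum linear_scale DY)
  also have "\<dots> = chart_deriv c Yc p (Xc p) + \<Gamma> c p (Xc p) (Yc p)"
  proof (rule linear_eq_sum_Basis[symmetric])
    show "linear (\<lambda>b. chart_deriv c Yc p b + \<Gamma> c p b (Yc p))"
      by (intro linear_compose_add chart_deriv_linear[OF U(1) sm(2) c(1) U(2) c(2)])
        (use bilinear_christoffel[OF c] in \<open>simp add: bilinear_def\<close>)
  qed
  finally show ?thesis by (simp add: Xc_def Yc_def[abs_def])
qed

text \<open>Both sides are the components in \<open>d\<close> of the covariant derivative of a coordinate field of \<open>c\<close>
  along another.  In the chart \<open>d\<close> the differentiated field has the varying components
  \<open>coord_change c d q w\<close>, which accounts for the second derivative of the transition map.\<close>

lemma christoffel_change: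
  assumes c: "c \<in> charts M" "p \<in> cdom c" and d: "d \<in> charts M" "p \<in> cdom d"
  shows "coord_change c d p (\<Gamma> c p v w) =
    chart_deriv c (\<lambda>q. coord_change c d q w) p v + \<Gamma> d p (coord_change c d p v) (coord_change c d p w)"
proof -
  let ?W = "cdom c \<inter> cdom d"
  have W: "openin (mtop M) ?W" "p \<in> ?W" using c d by (auto intro: openin_cdom)
  have sm: "smooth_in M ?W (\<lambda>q. coord_change c d q w)"
    by (rule smooth_in_coord_change[OF c(1) d(1)])
  have "coord_change c d p (\<Gamma> c p v w) =
      to_chart M d p (D (\<lambda>q. of_chart M c q v) (\<lambda>q. of_chart M c q w) p)"
    unfolding christoffel_def by (rule coord_change_to_chart[OF c(1) d(1) c(2) d(2)])
  also have "\<dots> = chart_deriv d (\<lambda>q. to_chart M d q (of_chart M c q w)) p (coord_change c d p v)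
      + \<Gamma> d p (coord_change c d p v) (coord_change c d p w)"
    by (subst connection_in_chart[OF openin_cdom[OF c(1)] c(2) d vector_field_const vector_field_const])
      (simp_all add: c d to_chart_of_chart)
  also have "chart_deriv d (\<lambda>q. to_chart M d q (of_chart M c q w)) p
      = chart_deriv d (\<lambda>q. coord_change c d q w) p"
    by (rule chart_deriv_cong[OF W(1) sm d(1) W(2) d(2)]) (use c d in \<open>simp add: to_chart_of_chart\<close>)
  also have "chart_deriv d (\<lambda>q. coord_change c d q w) p (coord_change c d p v)
      = chart_deriv c (\<lambda>q. coord_change c d q w) p v"
    by (rule chart_deriv_change[OF W(1) sm W(2) c d, symmetric])
  finally show ?thesis .
qed

end

section \<open>Existence of the Levi-Civita connection\<close>

lemma inner_sum_Basis_linear: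
  fixes k :: "'e::euclidean_space \<Rightarrow> real"
  assumes "linear k"
  shows "(\<Sum>i\<in>Basis. k i *\<^sub>R i) \<bullet> z = k z"
  using linear_eq_sum_Basis[OF assms, of z]
  by (simp add: inner_sum_left inner_commute[of z] mult.commute)

lemma linear_half: "linear f \<Longrightarrow> linear (\<lambda>x. f x / 2 :: real)"
  by (simp add: linear_iff add_divide_distrib)

text \<open>The form induces an injective endomorphism of a finite-dimensional space, which is therefore
  surjective.\<close>

lemma nondegenerate_represents:
  fixes b :: "'e::euclidean_space \<Rightarrow> 'e \<Rightarrow> real"
  assumes b: "bilinear b" "\<And>v. (\<forall>w. b v w = 0) \<Longrightarrow> v = 0" and k: "linear k"
  shows "\<exists>!y. \<forall>z. b y z = k z"
proof -
  have lin: "linear (b y)" "linear (\<lambda>y. b y z)" for y z using b(1) by (auto simp: bilinear_def)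
  define A where "A y = (\<Sum>i\<in>Basis. b y i *\<^sub>R i)" for y
  have A: "A y \<bullet> z = b y z" for y z
    unfolding A_def by (rule inner_sum_Basis_linear[OF lin(1)])
  have linA: "linear A"
    unfolding A_def[abs_def]
    by (intro linear_compose_sum ballI linearI)
      (simp_all add: linear_add[OF lin(2)] linear_scale[OF lin(2)] scaleR_left_distrib)
  have "inj A"
    using b(2) A unfolding linear_injective_0[OF linA] by (metis inner_zero_left)
  then have "surj A" using linear_injective_imp_surjective[OF linA] by blast
  then obtain y where y: "A y = (\<Sum>i\<in>Basis. k i *\<^sub>R i)" by (metis surjD)
  have "b y z = k z" for z
    by (simp add: A[symmetric] y inner_sum_Basis_linear[OF k])
  moreover have "y' = y" if "\<forall>z. b y' z = k z" for y'
  proof -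
    have "A y' = A y"
      by (rule euclidean_eqI) (simp add: A that \<open>\<And>z. b y z = k z\<close>)
    then show ?thesis using \<open>inj A\<close> by (simp add: injD)
  qed
  ultimately show ?thesis by blast
qed

locale semi_riemannian = smooth_atlas M for M :: "('m, 'e::euclidean_space) mfd" +
  fixes g :: "'m \<Rightarrow> 'e \<Rightarrow> 'e \<Rightarrow> real"
  assumes metric: "semi_riemannian_metric M g"
begin

lemma bilinear_metric: "p \<in> points M \<Longrightarrow> bilinear (g p)"
  and metric_sym: "p \<in> points M \<Longrightarrow> g p v w = g p w v"
  and metric_nondegenerate: "p \<in> points M \<Longrightarrow> (\<And>w. g p v w = 0) \<Longrightarrow> v = 0"
  using metric unfolding semi_riemannian_metric_def by blast+

definition gram :: "('m, 'e) chart \<Rightarrow> 'm \<Rightarrow> 'e \<Rightarrow> 'e \<Rightarrow> real" where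
  "gram c p v w = g p (of_chart M c p v) (of_chart M c p w)"

lemma smooth_in_gram: "c \<in> charts M \<Longrightarrow> smooth_in M (cdom c) (\<lambda>p. gram c p v w)"
  using metric by (intro smooth_inI_chart) (auto simp: semi_riemannian_metric_def gram_def intro: openin_cdom)

lemma bilinear_gram:
  assumes c: "c \<in> charts M" "p \<in> cdom c"
  shows "bilinear (gram c p)"
  unfolding bilinear_def
  by (intro conjI allI linearI)
    (simp_all add: gram_def linear_add[OF linear_of_chart[OF c]] linear_scale[OF linear_of_chart[OF c]]
      bilinear_ladd[OF bilinear_metric[OF cdom_points[OF c]]] bilinear_radd[OF bilinear_metric[OF cdom_points[OF c]]]
      bilinear_lmul[OF bilinear_metric[OF cdom_points[OF c]]] bilinear_rmul[OF bilinear_metric[OF cdom_points[OF c]]])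

lemma gram_sym: "c \<in> charts M \<Longrightarrow> p \<in> cdom c \<Longrightarrow> gram c p v w = gram c p w v"
  unfolding gram_def by (rule metric_sym[OF cdom_points])

lemma gram_nondegenerate:
  assumes c: "c \<in> charts M" "p \<in> cdom c" and v: "\<forall>w. gram c p v w = 0"
  shows "v = 0"
proof -
  have "g p (of_chart M c p v) w = 0" for w
    using v[rule_format, of "to_chart M c p w"] c by (simp add: gram_def)
  then have "of_chart M c p v = 0" using metric_nondegenerate[OF cdom_points[OF c]] by blast
  then show ?thesis using to_of_chart[OF c, of v] linear_0[OF linear_to_chart[OF c]] by simp
qed

lemma gram_change:
  assumes "c \<in> charts M" "d \<in> charts M" "p \<in> cdom c" "p \<in> cdom d"
  shows "gram d p (coord_change c d p v) (coord_change c d p w) = gram c p v w"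
  by (simp add: gram_def of_chart_coord_change[OF assms])

lemma gram_chart_at: "p \<in> points M \<Longrightarrow> gram (chart_at M p) p v w = g p v w"
  by (simp add: gram_def)

text \<open>Koszul's formula for coordinate fields, whose brackets vanish.\<close>

definition koszul :: "('m, 'e) chart \<Rightarrow> 'm \<Rightarrow> 'e \<Rightarrow> 'e \<Rightarrow> 'e \<Rightarrow> real" where
  "koszul c p v w z = (chart_deriv c (\<lambda>q. gram c q w z) p v + chart_deriv c (\<lambda>q. gram c q v z) p w
     - chart_deriv c (\<lambda>q. gram c q v w) p z) / 2"

definition lc_symbol :: "('m, 'e) chart \<Rightarrow> 'm \<Rightarrow> 'e \<Rightarrow> 'e \<Rightarrow> 'e" where
  "lc_symbol c p v w = (THE y. \<forall>z. gram c p y z = koszul c p v w z)"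

lemma trilinear_gram_deriv:
  assumes c: "c \<in> charts M" "p \<in> cdom c"
  shows "linear (\<lambda>v. chart_deriv c (\<lambda>q. gram c q v w) p z)"
    and "linear (\<lambda>w. chart_deriv c (\<lambda>q. gram c q v w) p z)"
    and "linear (\<lambda>z. chart_deriv c (\<lambda>q. gram c q v w) p z)"
proof -
  note W = openin_cdom[OF c(1)] c(1) c(2) c(2)
  note sm = smooth_in_gram[OF c(1)]
  have lin: "linear (gram c q u)" "linear (\<lambda>w. gram c q w u)" if "q \<in> cdom c" for q u
    using bilinear_gram[OF c(1) that] by (auto simp: bilinear_def)
  have add: "chart_deriv c (\<lambda>q. gram c q (a + b) u) p z =
      chart_deriv c (\<lambda>q. gram c q a u) p z + chart_deriv c (\<lambda>q. gram c q b u) p z" for a b u z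
  proof -
    have "chart_deriv c (\<lambda>q. gram c q (a + b) u) p = chart_deriv c (\<lambda>q. gram c q a u + gram c q b u) p"
      by (rule chart_deriv_cong[OF W(1) smooth_in_add[OF W(1) sm sm] W(2-4)]) (simp add: linear_add[OF lin(2)])
    then show ?thesis by (simp add: chart_deriv_add[OF W sm sm])
  qed
  have scale: "chart_deriv c (\<lambda>q. gram c q (r *\<^sub>R a) u) p z = r *\<^sub>R chart_deriv c (\<lambda>q. gram c q a u) p z" for a r u z
  proof -
    have "chart_deriv c (\<lambda>q. gram c q (r *\<^sub>R a) u) p = chart_deriv c (\<lambda>q. r *\<^sub>R gram c q a u) p"
      by (rule chart_deriv_cong[OF W(1) smooth_in_scaleR[OF W(1) smooth_in_const[OF W(1)] sm] W(2-4)])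
        (simp add: linear_scale[OF lin(2)])
    then show ?thesis by (simp only: chart_deriv_bounded_linear[OF W bounded_linear_scaleR_right sm])
  qed
  have sym: "chart_deriv c (\<lambda>q. gram c q v w) p = chart_deriv c (\<lambda>q. gram c q w v) p" for v w
    by (rule chart_deriv_cong[OF W(1) sm W(2-4)]) (rule gram_sym[OF c(1)])
  show 1: "linear (\<lambda>v. chart_deriv c (\<lambda>q. gram c q v w) p z)" for w z
    by (rule linearI) (simp_all only: add scale)
  show "linear (\<lambda>w. chart_deriv c (\<lambda>q. gram c q v w) p z)"
    by (subst sym) (rule 1)
  show "linear (\<lambda>z. chart_deriv c (\<lambda>q. gram c q v w) p z)"
    by (rule chart_deriv_linear[OF W(1) sm W(2-4)])
qed

lemma trilinear_koszul:
  assumes c: "c \<in> charts M" "p \<in> cdom c"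
  shows "linear (\<lambda>v. koszul c p v w z)" "linear (\<lambda>w. koszul c p v w z)" "linear (\<lambda>z. koszul c p v w z)"
  unfolding koszul_def
  by (intro linear_half linear_compose_add linear_compose_sub trilinear_gram_deriv[OF c])+

lemma lc_symbol_ex1:
  assumes c: "c \<in> charts M" "p \<in> cdom c"
  shows "\<exists>!y. \<forall>z. gram c p y z = koszul c p v w z"
  using nondegenerate_represents[OF bilinear_gram[OF c] gram_nondegenerate[OF c] trilinear_koszul(3)[OF c]] .

lemma gram_lc_symbol:
  assumes c: "c \<in> charts M" "p \<in> cdom c"
  shows "gram c p (lc_symbol c p v w) z = koszul c p v w z"
  using theI'[OF lc_symbol_ex1[OF c, of v w]] unfolding lc_symbol_def by blast

lemma lc_symbol_eqI:
  assumes c: "c \<in> charts M" "p \<in> cdom c" and y: "\<And>z. gram c p y z = koszul c p v w z"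
  shows "lc_symbol c p v w = y"
  using lc_symbol_ex1[OF c, of v w] gram_lc_symbol[OF c, of v w] y by blast

lemma bilinear_lc_symbol:
  assumes c: "c \<in> charts M" "p \<in> cdom c"
  shows "bilinear (lc_symbol c p)"
proof -
  have lin: "linear (\<lambda>w. gram c p w u)" for u
    using bilinear_gram[OF c] by (auto simp: bilinear_def)
  note K = trilinear_koszul[OF c]
  have "lc_symbol c p v (a + b) = lc_symbol c p v a + lc_symbol c p v b" for v a b
    by (rule lc_symbol_eqI[OF c]) (simp only: linear_add[OF lin] gram_lc_symbol[OF c] linear_add[OF K(2)])
  moreover have "lc_symbol c p v (r *\<^sub>R a) = r *\<^sub>R lc_symbol c p v a" for v a r
    by (rule lc_symbol_eqI[OF c]) (simp only: linear_scale[OF lin] gram_lc_symbol[OF c] linear_scale[OF K(2)])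
  moreover have "lc_symbol c p (a + b) v = lc_symbol c p a v + lc_symbol c p b v" for v a b
    by (rule lc_symbol_eqI[OF c]) (simp only: linear_add[OF lin] gram_lc_symbol[OF c] linear_add[OF K(1)])
  moreover have "lc_symbol c p (r *\<^sub>R a) v = r *\<^sub>R lc_symbol c p a v" for v a r
    by (rule lc_symbol_eqI[OF c]) (simp only: linear_scale[OF lin] gram_lc_symbol[OF c] linear_scale[OF K(1)])
  ultimately show ?thesis by (simp add: bilinear_def linear_iff)
qed

lemma lc_symbol_sym:
  assumes c: "c \<in> charts M" "p \<in> cdom c"
  shows "lc_symbol c p v w = lc_symbol c p w v"
proof (rule lc_symbol_eqI[OF c])
  have "chart_deriv c (\<lambda>q. gram c q v w) p = chart_deriv c (\<lambda>q. gram c q w v) p"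
    by (rule chart_deriv_cong[OF openin_cdom[OF c(1)] smooth_in_gram[OF c(1)] c(1) c(2) c(2)])
      (rule gram_sym[OF c(1)])
  then show "gram c p (lc_symbol c p w v) z = koszul c p v w z" for z
    unfolding gram_lc_symbol[OF c] koszul_def by simp
qed

text \<open>This identity makes the resulting connection compatible with the metric.\<close>

lemma koszul_metric:
  assumes c: "c \<in> charts M" "p \<in> cdom c"
  shows "koszul c p v w z + koszul c p v z w = chart_deriv c (\<lambda>q. gram c q w z) p v"
proof -
  have sym: "chart_deriv c (\<lambda>q. gram c q a b) p = chart_deriv c (\<lambda>q. gram c q b a) p" for a b
    by (rule chart_deriv_cong[OF openin_cdom[OF c(1)] smooth_in_gram[OF c(1)] c(1) c(2) c(2)])
      (rule gram_sym[OF c(1)])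
  show ?thesis unfolding koszul_def using sym[of z w] by (simp add: field_simps)
qed

lemma smooth_in_koszul:
  assumes c: "c \<in> charts M"
  shows "smooth_in M (cdom c) (\<lambda>p. koszul c p v w z)"
  unfolding koszul_def divide_inverse
  by (intro smooth_in_bounded_linear[OF _ bounded_linear_mult_left] smooth_in_diff smooth_in_add
      smooth_in_chart_deriv smooth_in_gram openin_cdom c order_refl)

text \<open>The symbols arise from \<open>koszul\<close> by the inverse of the Gram operator of the chart, which depends
  smoothly on the point.\<close>

lemma smooth_in_lc_symbol:
  assumes c: "c \<in> charts M"
  shows "smooth_in M (cdom c) (\<lambda>p. lc_symbol c p v w)"
proof -
  note W = openin_cdom[OF c]
  define A where "A p y = (\<Sum>i\<in>Basis. gram c p y i *\<^sub>R i)" for p and y :: 'e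
  define B where "B p = inv (A p)" for p
  have lin: "linear (gram c p u)" "linear (\<lambda>w. gram c p w u)" if "p \<in> cdom c" for p u
    using bilinear_gram[OF c that] by (auto simp: bilinear_def)
  have linA: "linear (A p)" if "p \<in> cdom c" for p
    unfolding A_def[abs_def]
    by (intro linear_compose_sum ballI linearI)
      (simp_all add: linear_add[OF lin(2)[OF that]] linear_scale[OF lin(2)[OF that]] scaleR_left_distrib)
  have A: "A p y \<bullet> z = gram c p y z" if "p \<in> cdom c" for p y z
    unfolding A_def by (rule inner_sum_Basis_linear[OF lin(1)[OF that]])
  have injA: "inj (A p)" if "p \<in> cdom c" for p
    using gram_nondegenerate[OF c that] A[OF that] unfolding linear_injective_0[OF linA[OF that]]
    by (metis inner_zero_left)
  have BA: "B p (A p y) = y" if "p \<in> cdom c" for p y using injA[OF that] by (simp add: B_def)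
  have AB: "A p (B p y) = y" if "p \<in> cdom c" for p y
    using linear_injective_imp_surjective[OF linA injA] that by (simp add: B_def surj_f_inv_f)
  have linB: "linear (B p)" if "p \<in> cdom c" for p
    by (rule linear_of_inverse[where F = "A p"]) (use that linA AB BA in auto)
  have smA: "smooth_in M (cdom c) (\<lambda>p. A p y)" for y
    unfolding A_def by (intro smooth_in_sum smooth_in_scaleR smooth_in_const smooth_in_gram W c)
  have B: "smooth_in M (cdom c) (\<lambda>p. B p y)" for y
    by (rule smooth_in_inverse_family[where A = A and B = B, OF W]) (simp_all add: linA smA AB BA)
  have k: "smooth_in M (cdom c) (\<lambda>p. \<Sum>i\<in>Basis. koszul c p v w i *\<^sub>R i)"
    by (intro smooth_in_sum smooth_in_scaleR smooth_in_const smooth_in_koszul W c)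
  show ?thesis
  proof (rule smooth_in_cong[OF W _ smooth_in_linear_family[OF W linB B k]])
    fix p assume p: "p \<in> cdom c"
    show "B p (\<Sum>i\<in>Basis. koszul c p v w i *\<^sub>R i) = lc_symbol c p v w"
    proof (rule lc_symbol_eqI[OF c p, symmetric])
      fix z
      have "gram c p (B p (\<Sum>i\<in>Basis. koszul c p v w i *\<^sub>R i)) z = (\<Sum>i\<in>Basis. koszul c p v w i *\<^sub>R i) \<bullet> z"
        by (simp add: A[OF p, symmetric] AB[OF p])
      also have "\<dots> = koszul c p v w z"
        by (rule inner_sum_Basis_linear[OF trilinear_koszul(3)[OF c p]])
      finally show "gram c p (B p (\<Sum>i\<in>Basis. koszul c p v w i *\<^sub>R i)) z = koszul c p v w z" .
    qed
  qed
qed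

text \<open>Let \<open>T\<close> be the change of components and \<open>H\<close> its derivative, a symmetric bilinear map.
  Differentiating \<open>gram c q w z = gram d q (T w) (T z)\<close> produces terms with \<open>H\<close>; in Koszul's
  expression those containing \<open>H v z\<close> and \<open>H w z\<close> cancel, and the one with \<open>H v w\<close> occurs twice,
  which compensates the factor one half.\<close>

lemma lc_symbol_change:
  assumes c: "c \<in> charts M" "p \<in> cdom c" and d: "d \<in> charts M" "p \<in> cdom d"
  shows "coord_change c d p (lc_symbol c p v w) =
    chart_deriv c (\<lambda>q. coord_change c d q w) p v + lc_symbol d p (coord_change c d p v) (coord_change c d p w)"
proof -
  let ?W = "cdom c \<inter> cdom d" and ?T = "coord_change c d"
  define H where "H v w = chart_deriv c (\<lambda>q. ?T q w) p v" for v w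
  have W: "openin (mtop M) ?W" "p \<in> ?W" using c d by (auto intro: openin_cdom)
  have Hsym: "H v w = H w v" for v w
    unfolding H_def coord_change_chart_deriv
    by (rule chart_deriv_symmetric[OF openin_cdom[OF d(1)] c(1) d(2) c(2) smooth_in_cmap[OF d(1)]])
  have linT: "linear (?T p)" by (rule linear_coord_change[OF c(1) d(1) c(2) d(2)])
  have dgram: "chart_deriv c (\<lambda>q. gram c q w z) p v = chart_deriv d (\<lambda>q. gram d q (?T p w) (?T p z)) p (?T p v)
      + gram d p (H v w) (?T p z) + gram d p (?T p w) (H v z)" for v w z
  proof -
    have smc: "smooth_in M ?W (\<lambda>q. gram c q w z)"
      by (rule smooth_in_subset[OF smooth_in_gram[OF c(1)]]) auto
    have smd: "smooth_in M ?W (\<lambda>q. gram d q a b)" for a b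
      by (rule smooth_in_subset[OF smooth_in_gram[OF d(1)]]) auto
    have "chart_deriv c (\<lambda>q. gram c q w z) p v = chart_deriv c (\<lambda>q. gram d q (?T q w) (?T q z)) p v"
      by (rule chart_deriv_cong[THEN fun_cong, OF W(1) smc c(1) W(2) c(2), symmetric])
        (use c d in \<open>simp add: gram_change\<close>)
    also have "\<dots> = chart_deriv c (\<lambda>q. gram d q (?T p w) (?T p z)) p v
      + gram d p (H v w) (?T p z) + gram d p (?T p w) (H v z)"
      unfolding H_def
      by (rule chart_deriv_bilinear_family[OF W(1) c(1) W(2) c(2) _ smd
          smooth_in_coord_change[OF c(1) d(1)] smooth_in_coord_change[OF c(1) d(1)]])
        (use d bilinear_gram in auto)
    also have "chart_deriv c (\<lambda>q. gram d q (?T p w) (?T p z)) p v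
        = chart_deriv d (\<lambda>q. gram d q (?T p w) (?T p z)) p (?T p v)"
      by (rule chart_deriv_change[OF W(1) smd W(2) c d])
    finally show ?thesis .
  qed
  have lin: "linear (\<lambda>w. gram d p w u)" for u
    using bilinear_gram[OF d] by (auto simp: bilinear_def)
  have "lc_symbol d p (?T p v) (?T p w) = ?T p (lc_symbol c p v w) - H v w"
  proof (rule lc_symbol_eqI[OF d])
    fix z'
    obtain z where z': "z' = ?T p z"
      using coord_change_inverse[OF d(1) c(1) d(2) c(2), of z'] by metis
    have "gram d p (?T p (lc_symbol c p v w)) (?T p z) = koszul c p v w z"
      by (simp add: gram_change c d gram_lc_symbol)
    also have "\<dots> = koszul d p (?T p v) (?T p w) (?T p z) + gram d p (H v w) (?T p z)"
      unfolding koszul_def dgram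
      using gram_sym[OF d] Hsym by (simp add: field_simps)
    finally show "gram d p (?T p (lc_symbol c p v w) - H v w) z' = koszul d p (?T p v) (?T p w) z'"
      by (simp add: z' linear_diff[OF lin])
  qed
  then show ?thesis by (simp add: H_def)
qed

text \<open>Each value is computed in the preferred chart at the point; by \<open>lc_connection_in_chart\<close> any other
  chart gives the same vector, and this is what makes the result a smooth field.\<close>

definition lc_connection :: "('m \<Rightarrow> 'e) \<Rightarrow> ('m \<Rightarrow> 'e) \<Rightarrow> 'm \<Rightarrow> 'e" where
  "lc_connection X Y p = chart_deriv (chart_at M p) (\<lambda>q. to_chart M (chart_at M p) q (Y q)) p (X p)
     + lc_symbol (chart_at M p) p (X p) (Y p)"

lemma lc_connection_in_chart:
  assumes W: "openin (mtop M) W" "p \<in> W" and c: "c \<in> charts M" "p \<in> cdom c" and Y: "vector_field M W Y"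
  shows "to_chart M c p (lc_connection X Y p) =
    chart_deriv c (\<lambda>q. to_chart M c q (Y q)) p (to_chart M c p (X p))
    + lc_symbol c p (to_chart M c p (X p)) (to_chart M c p (Y p))"
proof -
  define d where "d = chart_at M p"
  have p: "p \<in> points M" using cdom_points[OF c] .
  have d: "d \<in> charts M" "p \<in> cdom d" using p chart_at_charts in_chart_at by (auto simp: d_def)
  let ?T = "coord_change d c" and ?U = "cdom c \<inter> cdom d \<inter> W"
  let ?Yc = "\<lambda>q. to_chart M c q (Y q)" and ?Yd = "\<lambda>q. to_chart M d q (Y q)"
  have U: "openin (mtop M) ?U" "p \<in> ?U" using c d W by (auto intro: openin_cdom)
  have T: "?T p u = to_chart M c p u" for u by (simp add: to_chart_def d_def)
  have Yd: "smooth_in M ?U ?Yd" by (rule smooth_in_subset[OF vector_fieldD[OF W(1) Y d(1)]]) auto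
  have Yc: "smooth_in M ?U ?Yc" by (rule smooth_in_subset[OF vector_fieldD[OF W(1) Y c(1)]]) auto
  have "chart_deriv c ?Yc p (?T p (X p)) = chart_deriv d ?Yc p (X p)"
    by (rule chart_deriv_change[OF U(1) Yc U(2) d c, symmetric])
  also have "\<dots> = chart_deriv d (\<lambda>q. ?T q (?Yd q)) p (X p)"
    by (rule chart_deriv_cong[THEN fun_cong, OF U(1) Yc d(1) U(2) d(2), symmetric])
      (use c d in \<open>simp add: coord_change_to_chart\<close>)
  also have "\<dots> = chart_deriv d (\<lambda>q. ?T q (?Yd p)) p (X p) + ?T p (chart_deriv d ?Yd p (X p))"
    by (rule chart_deriv_linear_family[OF U(1) d(1) U(2) d(2) _
          smooth_in_subset[OF smooth_in_coord_change[OF d(1) c(1)]] Yd])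
      (use c d linear_coord_change in auto)
  finally have 1: "chart_deriv c ?Yc p (?T p (X p)) =
      chart_deriv d (\<lambda>q. ?T q (?Yd p)) p (X p) + ?T p (chart_deriv d ?Yd p (X p))" .
  have Ydp: "?Yd p = Y p" using p by (simp add: d_def)
  have "?T p (lc_connection X Y p) = ?T p (chart_deriv d ?Yd p (X p)) + ?T p (lc_symbol d p (X p) (Y p))"
    unfolding lc_connection_def d_def[symmetric]
    by (rule linear_add[OF linear_coord_change[OF d(1) c(1) d(2) c(2)]])
  also have "\<dots> = chart_deriv c ?Yc p (?T p (X p)) + lc_symbol c p (?T p (X p)) (?T p (Y p))"
    by (simp add: lc_symbol_change[OF d c] 1 Ydp)
  finally show ?thesis by (simp add: T)
qed

lemma affine_connection_lc_connection: "affine_connection M lc_connection"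
  unfolding affine_connection_def smooth_fun_iff
proof (intro allI impI conjI ballI; elim conjE)
  fix U and X Y :: "'m \<Rightarrow> 'e"
  assume U: "openin (mtop M) U" and X: "vector_field M U X" and Y: "vector_field M U Y"
  show "vector_field M U (lc_connection X Y)"
  proof (rule vector_fieldI[OF U])
    fix p assume p: "p \<in> U"
    define c where "c = chart_at M p"
    note c = chart_at_openin[OF U p, folded c_def]
    let ?W = "cdom c \<inter> U"
    have W: "openin (mtop M) ?W" by (rule openin_cdom_Int[OF c(1) U])
    note Xc = vector_fieldD[OF U X c(1)] and Yc = vector_fieldD[OF U Y c(1)]
    have "smooth_in M ?W (\<lambda>q. chart_deriv c (\<lambda>q. to_chart M c q (Y q)) q (to_chart M c q (X q))
       + lc_symbol c q (to_chart M c q (X q)) (to_chart M c q (Y q)))"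
    proof (rule smooth_in_add[OF W])
      show "smooth_in M ?W (\<lambda>q. chart_deriv c (\<lambda>q. to_chart M c q (Y q)) q (to_chart M c q (X q)))"
        by (rule smooth_in_linear_family[OF W chart_deriv_linear[OF W Yc c(1)] smooth_in_chart_deriv[OF W _ c(1) Yc] Xc]) auto
      show "smooth_in M ?W (\<lambda>q. lc_symbol c q (to_chart M c q (X q)) (to_chart M c q (Y q)))"
        by (rule smooth_in_bilinear_family[OF W bilinear_lc_symbol[OF c(1)] smooth_in_subset[OF smooth_in_lc_symbol[OF c(1)]] Xc Yc]) auto
    qed
    then have "smooth_in M ?W (\<lambda>q. to_chart M c q (lc_connection X Y q))"
      by (rule smooth_in_cong[OF W, rotated]) (simp add: lc_connection_in_chart[OF U _ c(1) _ Y])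
    then show "\<exists>c\<in>charts M. p \<in> cdom c \<and> smooth_in M (cdom c \<inter> U) (\<lambda>q. to_chart M c q (lc_connection X Y q))"
      using c by blast
  qed
next
  fix U p and X X' Y Y' :: "'m \<Rightarrow> 'e"
  assume U: "openin (mtop M) U" and Y: "vector_field M U Y"
    and eq: "\<forall>p\<in>U. X' p = X p \<and> Y' p = Y p" and p: "p \<in> U"
  define c where "c = chart_at M p"
  note c = chart_at_openin[OF U p, folded c_def]
  have "chart_deriv c (\<lambda>q. to_chart M c q (Y' q)) p = chart_deriv c (\<lambda>q. to_chart M c q (Y q)) p"
    by (rule chart_deriv_cong[OF openin_cdom_Int[OF c(1) U] vector_fieldD[OF U Y c(1)] c(1) _ c(2)])
      (use eq p c in auto)
  then show "lc_connection X' Y' p = lc_connection X Y p"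
    using eq p by (simp add: lc_connection_def c_def)
next
  fix U p and X X' Y :: "'m \<Rightarrow> 'e"
  assume U: "openin (mtop M) U" and Y: "vector_field M U Y" and p: "p \<in> U"
  define c where "c = chart_at M p"
  note c = chart_at_openin[OF U p, folded c_def]
  have "linear (chart_deriv c (\<lambda>q. to_chart M c q (Y q)) p)"
    by (rule chart_deriv_linear[OF openin_cdom_Int[OF c(1) U] vector_fieldD[OF U Y c(1)] c(1) _ c(2)])
      (use p c in auto)
  moreover have "linear (\<lambda>v. lc_symbol c p v w)" for w
    using bilinear_lc_symbol[OF c] by (simp add: bilinear_def)
  ultimately show "lc_connection (\<lambda>q. X q + X' q) Y p = lc_connection X Y p + lc_connection X' Y p"
    by (simp add: lc_connection_def c_def[symmetric] linear_add[of "\<lambda>v. lc_symbol c p v w" for w] linear_add)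
next
  fix U p and f :: "'m \<Rightarrow> real" and X Y :: "'m \<Rightarrow> 'e"
  assume U: "openin (mtop M) U" and Y: "vector_field M U Y" and p: "p \<in> U"
  define c where "c = chart_at M p"
  note c = chart_at_openin[OF U p, folded c_def]
  have "linear (chart_deriv c (\<lambda>q. to_chart M c q (Y q)) p)"
    by (rule chart_deriv_linear[OF openin_cdom_Int[OF c(1) U] vector_fieldD[OF U Y c(1)] c(1) _ c(2)])
      (use p c in auto)
  moreover have "linear (\<lambda>v. lc_symbol c p v w)" for w
    using bilinear_lc_symbol[OF c] by (simp add: bilinear_def)
  ultimately show "lc_connection (\<lambda>q. f q *\<^sub>R X q) Y p = f p *\<^sub>R lc_connection X Y p"
    by (simp add: lc_connection_def c_def[symmetric] linear_scale[of "\<lambda>v. lc_symbol c p v w" for w]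
        linear_scale scaleR_add_right)
next
  fix U p and X Y Y' :: "'m \<Rightarrow> 'e"
  assume U: "openin (mtop M) U" and Y: "vector_field M U Y" and Y': "vector_field M U Y'" and p: "p \<in> U"
  define c where "c = chart_at M p"
  note c = chart_at_openin[OF U p, folded c_def]
  note W = openin_cdom_Int[OF c(1) U] and Yc = vector_fieldD[OF U Y c(1)] and Yc' = vector_fieldD[OF U Y' c(1)]
  have pW: "p \<in> cdom c \<inter> U" using p c by simp
  have "chart_deriv c (\<lambda>q. to_chart M c q (Y q + Y' q)) p =
      chart_deriv c (\<lambda>q. to_chart M c q (Y q) + to_chart M c q (Y' q)) p"
    by (rule chart_deriv_cong[OF W smooth_in_add[OF W Yc Yc'] c(1) pW c(2)])
      (simp add: linear_add[OF linear_to_chart] c)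
  moreover have "linear (lc_symbol c p v)" for v
    using bilinear_lc_symbol[OF c] by (simp add: bilinear_def)
  ultimately show "lc_connection X (\<lambda>q. Y q + Y' q) p = lc_connection X Y p + lc_connection X Y' p"
    by (simp add: lc_connection_def c_def[symmetric] linear_add chart_deriv_add[OF W c(1) pW c(2) Yc Yc'])
next
  fix U p and f :: "'m \<Rightarrow> real" and X Y :: "'m \<Rightarrow> 'e"
  assume U: "openin (mtop M) U" and f: "smooth_in M U f" and Y: "vector_field M U Y" and p: "p \<in> U"
  define c where "c = chart_at M p"
  note c = chart_at_openin[OF U p, folded c_def]
  note W = openin_cdom_Int[OF c(1) U] and Yc = vector_fieldD[OF U Y c(1)]
  have pW: "p \<in> cdom c \<inter> U" using p c by simp
  have fW: "smooth_in M (cdom c \<inter> U) f" by (rule smooth_in_subset[OF f]) auto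
  have "chart_deriv c (\<lambda>q. to_chart M c q (f q *\<^sub>R Y q)) p =
      chart_deriv c (\<lambda>q. f q *\<^sub>R to_chart M c q (Y q)) p"
    by (rule chart_deriv_cong[OF W smooth_in_scaleR[OF W fW Yc] c(1) pW c(2)])
      (simp add: linear_scale[OF linear_to_chart] c)
  moreover have "linear (lc_symbol c p v)" for v
    using bilinear_lc_symbol[OF c] by (simp add: bilinear_def)
  moreover have "along M X f p = chart_deriv c f p (X p)"
    by (simp add: along_def chart_deriv_def c_def)
  moreover have "to_chart M c p u = u" for u using openin_points[OF U p] by (simp add: c_def)
  ultimately show "lc_connection X (\<lambda>q. f q *\<^sub>R Y q) p = along M X f p *\<^sub>R Y p + f p *\<^sub>R lc_connection X Y p"
    by (simp add: lc_connection_def c_def[symmetric] linear_scale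
        chart_deriv_scaleR[OF W c(1) pW c(2) fW Yc] scaleR_add_right)
qed

text \<open>The torsion vanishes by the symmetry of the symbols and of second derivatives of functions;
  metric compatibility is \<open>koszul_metric\<close>.\<close>

lemma is_levi_civita_lc_connection: "is_levi_civita M g lc_connection"
  unfolding is_levi_civita_def smooth_fun_iff
proof (intro allI impI conjI ballI affine_connection_lc_connection; elim conjE)
  fix U X Y and f :: "'m \<Rightarrow> real" and p
  assume U: "openin (mtop M) U" and X: "vector_field M U X" and Y: "vector_field M U Y"
    and f: "smooth_in M U f" and p: "p \<in> U"
  define c where "c = chart_at M p"
  note c = chart_at_openin[OF U p, folded c_def]
  let ?W = "cdom c \<inter> U"
  note W = openin_cdom_Int[OF c(1) U] and Yc = vector_fieldD[OF U Y c(1)] and Xc = vector_fieldD[OF U X c(1)]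
  have pW: "p \<in> ?W" using p c by simp
  have fW: "smooth_in M ?W f" by (rule smooth_in_subset[OF f]) auto
  have tc: "to_chart M c p u = u" for u using openin_points[OF U p] by (simp add: c_def)
  have at: "along M V h p = chart_deriv c h p (V p)" for V and h :: "'m \<Rightarrow> real"
    by (simp add: along_def chart_deriv_def c_def)
  have second: "chart_deriv c (along M V f) p w = chart_deriv c (\<lambda>q. chart_deriv c f q (V p)) p w
      + chart_deriv c f p (chart_deriv c (\<lambda>q. to_chart M c q (V q)) p w)"
    if V: "vector_field M U V" for V w
  proof -
    note Vc = vector_fieldD[OF U V c(1)]
    have sm: "smooth_in M ?W (\<lambda>q. chart_deriv c f q (to_chart M c q (V q)))"
      by (rule smooth_in_linear_family[OF W chart_deriv_linear[OF W fW c(1)] smooth_in_chart_deriv[OF W _ c(1) fW] Vc]) auto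
    have "chart_deriv c (along M V f) p w = chart_deriv c (\<lambda>q. chart_deriv c f q (to_chart M c q (V q))) p w"
      by (rule chart_deriv_cong[THEN fun_cong, OF W sm c(1) pW c(2)])
        (simp add: along_chart[OF W fW c(1)])
    also have "\<dots> = chart_deriv c (\<lambda>q. chart_deriv c f q (to_chart M c p (V p))) p w
      + chart_deriv c f p (chart_deriv c (\<lambda>q. to_chart M c q (V q)) p w)"
      by (rule chart_deriv_linear_family[OF W c(1) pW c(2) chart_deriv_linear[OF W fW c(1)]
            smooth_in_chart_deriv[OF W _ c(1) fW] Vc]) auto
    finally show ?thesis by (simp add: tc)
  qed
  have "linear (chart_deriv c f p)" by (rule chart_deriv_linear[OF W fW c(1) pW c(2)])
  moreover have "chart_deriv c (\<lambda>q. chart_deriv c f q (Y p)) p (X p) = chart_deriv c (\<lambda>q. chart_deriv c f q (X p)) p (Y p)"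
    by (rule chart_deriv_symmetric[OF W c(1) pW c(2) fW])
  ultimately show "along M (\<lambda>q. lc_connection X Y q - lc_connection Y X q) f p =
      along M X (along M Y f) p - along M Y (along M X f) p"
    unfolding at second[OF X] second[OF Y]
    using lc_symbol_sym[OF c, of "X p" "Y p"]
    by (simp add: lc_connection_def c_def[symmetric] linear_diff)
next
  fix U X Y Z p
  assume U: "openin (mtop M) U" and X: "vector_field M U X" and Y: "vector_field M U Y"
    and Z: "vector_field M U Z" and p: "p \<in> U"
  define c where "c = chart_at M p"
  have pM: "p \<in> points M" using openin_points[OF U p] .
  have c: "c \<in> charts M" "p \<in> cdom c" using pM chart_at_charts in_chart_at by (auto simp: c_def)
  let ?W = "cdom c \<inter> U"
  note W = openin_cdom_Int[OF c(1) U] and Yc = vector_fieldD[OF U Y c(1)] and Zc = vector_fieldD[OF U Z c(1)]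
  have pW: "p \<in> ?W" using p c by simp
  have tc: "to_chart M c p u = u" for u using pM by (simp add: c_def)
  have G: "gram c p v w = g p v w" for v w using pM by (simp add: gram_chart_at c_def)
  have sm: "smooth_in M ?W (\<lambda>q. gram c q v w)" for v w
    by (rule smooth_in_subset[OF smooth_in_gram[OF c(1)]]) auto
  have bil: "bilinear (gram c q)" if "q \<in> ?W" for q using that bilinear_gram[OF c(1)] by auto
  let ?Y = "\<lambda>q. to_chart M c q (Y q)" and ?Z = "\<lambda>q. to_chart M c q (Z q)"
  have "along M X (\<lambda>q. g q (Y q) (Z q)) p = chart_deriv c (\<lambda>q. g q (Y q) (Z q)) p (X p)"
    by (simp add: along_def chart_deriv_def c_def)
  also have "\<dots> = chart_deriv c (\<lambda>q. gram c q (?Y q) (?Z q)) p (X p)"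
    by (rule chart_deriv_cong[THEN fun_cong, OF W smooth_in_bilinear_family[OF W bil sm Yc Zc] c(1) pW c(2)])
      (use c in \<open>simp_all add: gram_def\<close>)
  also have "\<dots> = chart_deriv c (\<lambda>q. gram c q (Y p) (Z p)) p (X p)
      + gram c p (chart_deriv c ?Y p (X p)) (Z p) + gram c p (Y p) (chart_deriv c ?Z p (X p))"
    using chart_deriv_bilinear_family[OF W c(1) pW c(2) bil sm Yc Zc] by (simp add: tc)
  also have "chart_deriv c (\<lambda>q. gram c q (Y p) (Z p)) p (X p)
      = gram c p (lc_symbol c p (X p) (Y p)) (Z p) + gram c p (Y p) (lc_symbol c p (X p) (Z p))"
    using koszul_metric[OF c, of "X p" "Y p" "Z p"] gram_sym[OF c, of "Y p"]
    by (simp add: gram_lc_symbol[OF c])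
  finally show "along M X (\<lambda>q. g q (Y q) (Z q)) p =
      g p (lc_connection X Y p) (Z p) + g p (Y p) (lc_connection X Z p)"
    using bilinear_metric[OF pM]
    by (simp add: G lc_connection_def c_def[symmetric] bilinear_ladd bilinear_radd)
qed

lemma affine_connection_levi_civita: "affine_connection M (levi_civita M g)"
proof -
  have "is_levi_civita M g (levi_civita M g)"
    unfolding levi_civita_def by (rule someI[of "is_levi_civita M g", OF is_levi_civita_lc_connection])
  then show ?thesis by (simp add: is_levi_civita_def)
qed

end

sublocale semi_riemannian \<subseteq> levi_civita: affine_manifold M "levi_civita M g"
  by unfold_locales (rule affine_connection_levi_civita)

section \<open>The tangent bundle as a manifold\<close>

lemma smooth_on_fst:
  fixes f :: "'a::euclidean_space \<Rightarrow> 'c::real_normed_vector"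
  assumes "open S" "smooth_on S f"
  shows "smooth_on (S \<times> (UNIV :: 'b::euclidean_space set)) (\<lambda>z. f (fst z))"
  by (rule smooth_on_compose[OF _ smooth_on_bounded_linear[OF _ bounded_linear_fst smooth_on_ident] assms(2)])
    (auto intro: open_Times assms(1))

context smooth_atlas
begin

abbreviation "TM \<equiv> tangent_bundle M"

lemma cdom_lift [simp]: "cdom (lift_chart M c) = cdom c \<times> UNIV"
  and cmap_lift [simp]: "cmap (lift_chart M c) \<xi> = (cmap c (fst \<xi>), to_chart M c (fst \<xi>) (snd \<xi>))"
  by (simp_all add: lift_chart_def case_prod_unfold)

lemma charts_tangent_bundle: "charts TM = lift_chart M ` charts M"
  and chart_at_tangent_bundle: "chart_at TM \<xi> = lift_chart M (chart_at M (fst \<xi>))"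
  by (simp_all add: tangent_bundle_def case_prod_unfold)

lemma points_tangent_bundle: "points TM = points M \<times> UNIV"
  by (auto simp: points_def charts_tangent_bundle)

lemma lift_image:
  assumes c: "c \<in> charts M" and W: "W \<subseteq> cdom c"
  shows "cmap (lift_chart M c) ` (W \<times> UNIV) = (cmap c ` W) \<times> UNIV"
proof
  show "(cmap c ` W) \<times> UNIV \<subseteq> cmap (lift_chart M c) ` (W \<times> UNIV)"
  proof clarify
    fix p w assume p: "p \<in> W"
    then have "(cmap c p, w) = cmap (lift_chart M c) (p, of_chart M c p w)"
      using c W by (auto simp: subset_iff)
    then show "(cmap c p, w) \<in> cmap (lift_chart M c) ` (W \<times> UNIV)" using p by blast
  qed
qed auto

lemma inj_on_lift:
  assumes c: "c \<in> charts M"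
  shows "inj_on (cmap (lift_chart M c)) (cdom (lift_chart M c))"
proof (rule inj_onI)
  fix \<xi> \<eta> assume a: "\<xi> \<in> cdom (lift_chart M c)" "\<eta> \<in> cdom (lift_chart M c)"
    "cmap (lift_chart M c) \<xi> = cmap (lift_chart M c) \<eta>"
  then have "fst \<xi> = fst \<eta>" using inj_onD[OF inj_chart[OF c]] by auto
  moreover then have "snd \<xi> = snd \<eta>" using a of_to_chart[OF c, of "fst \<xi>"] by (metis cmap_lift cdom_lift mem_Times_iff prod.inject)
  ultimately show "\<xi> = \<eta>" by (simp add: prod_eq_iff)
qed

lemma cinv_lift:
  assumes c: "c \<in> charts M" and p: "p \<in> cdom c"
  shows "cinv (lift_chart M c) (cmap c p, w) = (p, of_chart M c p w)"
proof -
  have "(cmap c p, w) = cmap (lift_chart M c) (p, of_chart M c p w)" using c p by simp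
  then show ?thesis
    unfolding cinv_def using inv_into_f_f[OF inj_on_lift[OF c]] p by (metis UNIV_I cdom_lift mem_Sigma_iff)
qed

lemma lift_overlap_image:
  assumes c: "c \<in> charts M" and d: "d \<in> charts M"
  shows "cmap (lift_chart M c) ` (cdom (lift_chart M c) \<inter> cdom (lift_chart M d))
    = (cmap c ` (cdom c \<inter> cdom d)) \<times> UNIV"
  using lift_image[OF c, of "cdom c \<inter> cdom d"] by (simp add: Times_Int_distrib1[symmetric])

lemma smooth_lift_transition:
  assumes c: "c \<in> charts M" and d: "d \<in> charts M"
  shows "smooth_on (cmap (lift_chart M c) ` (cdom (lift_chart M c) \<inter> cdom (lift_chart M d)))
    (cmap (lift_chart M d) \<circ> cinv (lift_chart M c))"
proof -
  let ?S = "cmap c ` (cdom c \<inter> cdom d)"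
  have S: "open ?S" using open_overlap[OF c d] .
  then have SU: "open (?S \<times> (UNIV :: 'e set))" by (intro open_Times) auto
  have T: "smooth_on ?S (\<lambda>x. coord_change c d (cinv c x) v)" for v
    using smooth_inD[OF smooth_in_coord_change[OF c d] c] by (simp add: o_def Int_left_absorb)
  have "smooth_on (?S \<times> UNIV) (\<lambda>z. ((cmap d \<circ> cinv c) (fst z), coord_change c d (cinv c (fst z)) (snd z)))"
    by (rule smooth_on_Pair[OF SU smooth_on_fst[OF S smooth_transition[OF c d]]
          smooth_on_linear_family[OF SU _ smooth_on_fst[OF S T]
            smooth_on_bounded_linear[OF SU bounded_linear_snd smooth_on_ident[OF SU]]]])
      (use c d linear_coord_change[OF c d] in auto)
  then show ?thesis
    unfolding lift_overlap_image[OF c d]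
    by (rule smooth_on_cong[OF SU, rotated])
      (use c d in \<open>auto simp: cinv_lift to_chart_of_chart\<close>)
qed

lemma smooth_atlas_tangent_bundle: "smooth_atlas TM"
proof
  fix c' d' assume c': "c' \<in> charts TM" and d': "d' \<in> charts TM"
  then obtain c d where c: "c \<in> charts M" "c' = lift_chart M c" and d: "d \<in> charts M" "d' = lift_chart M d"
    by (auto simp: charts_tangent_bundle)
  show "open (cmap c' ` (cdom c' \<inter> cdom d'))"
    unfolding c d lift_overlap_image[OF c(1) d(1)] by (intro open_Times open_overlap c d open_UNIV)
  show "smooth_on (cmap c' ` (cdom c' \<inter> cdom d')) (cmap d' \<circ> cinv c')"
    unfolding c d by (rule smooth_lift_transition[OF c(1) d(1)])
next
  fix c' assume "c' \<in> charts TM"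
  then obtain c where c: "c \<in> charts M" "c' = lift_chart M c" by (auto simp: charts_tangent_bundle)
  show "inj_on (cmap c') (cdom c')" unfolding c by (rule inj_on_lift[OF c(1)])
  have "cmap c' ` cdom c' = (cmap c ` cdom c) \<times> UNIV"
    unfolding c using lift_image[OF c(1) order_refl] by simp
  then show "open (cmap c' ` cdom c')" by (auto intro: open_Times open_chart_image c)
next
  fix \<xi> assume "\<xi> \<in> points TM"
  then show "chart_at TM \<xi> \<in> charts TM"
    "\<xi> \<in> cdom (chart_at TM \<xi>)"
    by (auto simp: points_tangent_bundle charts_tangent_bundle chart_at_tangent_bundle
        chart_at_charts in_chart_at)
qed

interpretation TM: smooth_atlas TM by (rule smooth_atlas_tangent_bundle)

lemma lift_charts: "c \<in> charts M \<Longrightarrow> lift_chart M c \<in> charts TM"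
  by (simp add: charts_tangent_bundle)

lemma openin_fst_vimage:
  assumes U: "openin (mtop M) U"
  shows "openin (mtop TM) (fst -` U)"
  unfolding TM.openin_mtop_iff charts_tangent_bundle points_tangent_bundle
proof (intro conjI ballI)
  show "fst -` U \<subseteq> points M \<times> UNIV" using U openin_points by (auto simp: vimage_def)
  fix c' assume "c' \<in> lift_chart M ` charts M"
  then obtain c where c: "c \<in> charts M" "c' = lift_chart M c" by auto
  have "cdom c' \<inter> fst -` U = (cdom c \<inter> U) \<times> UNIV" using c by auto
  then have "cmap c' ` (cdom c' \<inter> fst -` U) = (cmap c ` (cdom c \<inter> U)) \<times> UNIV"
    using lift_image[OF c(1), of "cdom c \<inter> U"] c(2) by simp
  then show "open (cmap c' ` (cdom c' \<inter> fst -` U))"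
    using open_image[OF U c(1)] by (auto intro: open_Times)
qed

lemma smooth_in_fst:
  assumes W: "openin (mtop M) W" and f: "smooth_in M W f"
  shows "smooth_in TM (fst -` W) (\<lambda>\<xi>. f (fst \<xi>))"
  unfolding smooth_in_def charts_tangent_bundle
proof
  fix c' assume "c' \<in> lift_chart M ` charts M"
  then obtain c where c: "c \<in> charts M" "c' = lift_chart M c" by auto
  let ?S = "cmap c ` (cdom c \<inter> W)"
  have S: "open ?S" using open_image[OF W c(1)] .
  have "cdom c' \<inter> fst -` W = (cdom c \<inter> W) \<times> UNIV" using c by auto
  then have im: "cmap c' ` (cdom c' \<inter> fst -` W) = ?S \<times> UNIV"
    using lift_image[OF c(1), of "cdom c \<inter> W"] c(2) by simp
  show "smooth_on (cmap c' ` (cdom c' \<inter> fst -` W)) ((\<lambda>\<xi>. f (fst \<xi>)) \<circ> cinv c')"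
    unfolding im
    by (rule smooth_on_cong[OF open_Times[OF S open_UNIV] _ smooth_on_fst[OF S smooth_inD[OF f c(1)]]])
      (use c in \<open>auto simp: cinv_lift\<close>)
qed

lemma smooth_in_fibre_coordinate:
  assumes c: "c \<in> charts M"
  shows "smooth_in TM (cdom c \<times> UNIV) (\<lambda>\<xi>. to_chart M c (fst \<xi>) (snd \<xi>))"
  using TM.smooth_in_bounded_linear[OF TM.openin_cdom[OF lift_charts[OF c]] bounded_linear_snd
      TM.smooth_in_cmap[OF lift_charts[OF c]]] by simp

lemma smooth_map_fst: "smooth_map TM M fst"
  unfolding smooth_map_def
proof (intro conjI ballI)
  show "continuous_map (mtop TM) (mtop M) fst"
    unfolding continuous_map topspace_mtop TM.topspace_mtop points_tangent_bundle
  proof (intro conjI allI impI)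
    fix U assume U: "openin (mtop M) U"
     have "{\<xi> \<in> points M \<times> (UNIV :: 'e set). fst \<xi> \<in> U} = fst -` U" using openin_points[OF U] by auto
    then show "openin (mtop TM) {\<xi> \<in> points M \<times> UNIV. fst \<xi> \<in> U}"
      using openin_fst_vimage[OF U] by (simp only:)
  qed auto
  fix c' d assume "c' \<in> charts TM" and d: "d \<in> charts M"
  then have "smooth_in TM (fst -` cdom d) (\<lambda>\<xi>. cmap d (fst \<xi>))"
    and c': "c' \<in> charts TM"
    using smooth_in_fst[OF openin_cdom smooth_in_cmap] by auto
  from TM.smooth_inD[OF this]
  show "smooth_on (cmap c' ` (cdom c' \<inter> fst -` cdom d)) (cmap d \<circ> fst \<circ> cinv c')"
    by (simp add: o_def)
qed

lemma chart_deriv_fst: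
  assumes W: "openin (mtop M) W" "smooth_in M W f" and c: "c \<in> charts M" and p: "p \<in> W" "p \<in> cdom c"
  shows "chart_deriv (lift_chart M c) (\<lambda>\<xi>. f (fst \<xi>)) (p, u) (a, b) = chart_deriv c f p a"
proof -
  have fd: "(fst has_derivative fst) (at z)" for z :: "'e \<times> 'e"
    by (rule bounded_linear.has_derivative[OF bounded_linear_fst has_derivative_ident])
  have "((\<lambda>z. (f \<circ> cinv c) (fst z)) has_derivative (\<lambda>h. chart_deriv c f p (fst h)))
      (at (cmap c p, to_chart M c p u))"
    by (rule has_derivative_compose[OF fd]) (use has_chart_deriv[OF W c p] in \<open>simp add: o_def\<close>)
  then have "((\<lambda>z. (f \<circ> cinv c) (fst z)) has_derivative (\<lambda>h. chart_deriv c f p (fst h)))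
      (at (cmap (lift_chart M c) (p, u)))" by simp
  then have "((\<lambda>\<xi>. f (fst \<xi>)) \<circ> cinv (lift_chart M c) has_derivative (\<lambda>h. chart_deriv c f p (fst h)))
      (at (cmap (lift_chart M c) (p, u)))"
    by (rule has_derivative_transform_within_open[OF _ open_Times[OF open_chart_image[OF c] open_UNIV]])
      (use c p in \<open>auto simp: cinv_lift\<close>)
  then show ?thesis using TM.chart_derivI by fastforce
qed

lemma chart_deriv_fibre_coordinate:
  assumes c: "c \<in> charts M" and p: "p \<in> cdom c"
  shows "chart_deriv (lift_chart M c) (\<lambda>\<xi>. to_chart M c (fst \<xi>) (snd \<xi>)) (p, u) (a, b) = b"
proof -
  have "chart_deriv (lift_chart M c) (\<lambda>\<xi>. snd (cmap (lift_chart M c) \<xi>)) (p, u) (a, b)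
      = snd (chart_deriv (lift_chart M c) (cmap (lift_chart M c)) (p, u) (a, b))"
    by (rule TM.chart_deriv_bounded_linear[OF TM.openin_cdom lift_charts _ _ bounded_linear_snd
          TM.smooth_in_cmap]) (use c p in \<open>auto simp: lift_charts\<close>)
  then show ?thesis
    using TM.coord_change_self[OF lift_charts[OF c], of "(p, u)" "(a, b)"] p
    by (simp add: coord_change_chart_deriv[symmetric] TM.coord_change_chart_deriv[symmetric])
qed

text \<open>The transition map of the induced charts is \<open>(x, w) \<mapsto> (\<phi> x, d\<phi>\<^sub>x w)\<close>, where \<open>\<phi>\<close> is the transition
  map of the base.  Differentiating the second component in the direction of \<open>x\<close> gives the second
  derivative of \<open>\<phi>\<close>.\<close>

lemma coord_change_lift:
  assumes c: "c \<in> charts M" "p \<in> cdom c" and d: "d \<in> charts M" "p \<in> cdom d"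
  shows "coord_change (lift_chart M c) (lift_chart M d) (p, u) (a, b) =
    (coord_change c d p a,
     chart_deriv c (\<lambda>q. coord_change c d q (to_chart M c p u)) p a + coord_change c d p b)"
proof -
  let ?W = "fst -` (cdom c \<inter> cdom d) :: ('m \<times> 'e) set" and ?c = "lift_chart M c" and ?d = "lift_chart M d"
  let ?w = "\<lambda>\<xi>. to_chart M c (fst \<xi>) (snd \<xi>)"
  have V: "openin (mtop M) (cdom c \<inter> cdom d)" using c d by (auto intro: openin_cdom)
  have W: "openin (mtop TM) ?W" by (rule openin_fst_vimage[OF V])
  have c': "?c \<in> charts TM" "(p, u) \<in> ?W" "(p, u) \<in> cdom ?c"
    using c d by (auto simp: lift_charts)
  have d': "?d \<in> charts TM" "(p, u) \<in> cdom ?d" using d by (auto simp: lift_charts)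
  have smd: "smooth_in TM ?W (cmap ?d)"
    by (rule TM.smooth_in_subset[OF TM.smooth_in_cmap[OF d'(1)]]) auto
  have w: "smooth_in TM ?W ?w"
    by (rule TM.smooth_in_subset[OF smooth_in_fibre_coordinate[OF c(1)]]) auto
  have T: "smooth_in M (cdom c \<inter> cdom d) (\<lambda>q. coord_change c d q v)" for v
    by (rule smooth_in_coord_change[OF c(1) d(1)])
  note T' = smooth_in_fst[OF V T]
  have lin: "linear (coord_change c d (fst \<xi>))" if "\<xi> \<in> ?W" for \<xi>
    using that linear_coord_change[OF c(1) d(1)] by auto
  have "fst (coord_change ?c ?d (p, u) (a, b)) = chart_deriv ?c (\<lambda>\<xi>. fst (cmap ?d \<xi>)) (p, u) (a, b)"
    unfolding TM.coord_change_chart_deriv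
    by (rule TM.chart_deriv_bounded_linear[OF W c' bounded_linear_fst smd, symmetric])
  also have "\<dots> = coord_change c d p a"
    using chart_deriv_fst[OF openin_cdom[OF d(1)] smooth_in_cmap[OF d(1)] c(1) d(2) c(2)]
    by (simp add: coord_change_chart_deriv)
  finally have 1: "fst (coord_change ?c ?d (p, u) (a, b)) = coord_change c d p a" .
  have "snd (coord_change ?c ?d (p, u) (a, b)) = chart_deriv ?c (\<lambda>\<xi>. snd (cmap ?d \<xi>)) (p, u) (a, b)"
    unfolding TM.coord_change_chart_deriv
    by (rule TM.chart_deriv_bounded_linear[OF W c' bounded_linear_snd smd, symmetric])
  also have "\<dots> = chart_deriv ?c (\<lambda>\<xi>. coord_change c d (fst \<xi>) (?w \<xi>)) (p, u) (a, b)"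
    by (rule TM.chart_deriv_cong[THEN fun_cong, OF W TM.smooth_in_linear_family[OF W lin T' w] c'])
      (use c d in \<open>auto simp: coord_change_to_chart\<close>)
  also have "\<dots> = chart_deriv ?c (\<lambda>\<xi>. coord_change c d (fst \<xi>) (?w (p, u))) (p, u) (a, b)
      + coord_change c d (fst (p, u)) (chart_deriv ?c ?w (p, u) (a, b))"
    by (rule TM.chart_deriv_linear_family[OF W c' lin T' w])
  also have "\<dots> = chart_deriv c (\<lambda>q. coord_change c d q (to_chart M c p u)) p a + coord_change c d p b"
    using chart_deriv_fst[OF V T c(1) _ c(2), of "to_chart M c p u" u a b] c d
      chart_deriv_fibre_coordinate[OF c, of u a b] by simp
  finally show ?thesis using 1 by (simp add: prod_eq_iff)
qed

text \<open>Points over different base points are separated by preimages of open sets of the base, points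
  over the same base point lie in the domain of one induced chart.\<close>

lemma Hausdorff_tangent_bundle:
  assumes H: "Hausdorff_space (mtop M)"
  shows "Hausdorff_space (mtop TM)"
  unfolding Hausdorff_space_def TM.topspace_mtop points_tangent_bundle
proof (intro allI impI, elim conjE)
  fix \<xi> \<eta> :: "'m \<times> 'e"
  assume a: "\<xi> \<in> points M \<times> UNIV" "\<eta> \<in> points M \<times> UNIV" and ne: "\<xi> \<noteq> \<eta>"
  show "\<exists>U V. openin (mtop TM) U \<and> openin (mtop TM) V \<and>
      \<xi> \<in> U \<and> \<eta> \<in> V \<and> disjnt U V"
  proof (cases "fst \<xi> = fst \<eta>")
    case False
    then obtain U V where "openin (mtop M) U" "openin (mtop M) V" "fst \<xi> \<in> U" "fst \<eta> \<in> V" "disjnt U V"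
      using H a unfolding Hausdorff_space_def topspace_mtop by (metis mem_Times_iff)
    then show ?thesis
      by (intro exI[of _ "fst -` U"] exI[of _ "fst -` V"]) (auto simp: disjnt_iff openin_fst_vimage)
  next
    case True
    let ?c = "lift_chart M (chart_at M (fst \<xi>))"
    have c: "?c \<in> charts TM" "\<xi> \<in> cdom ?c" "\<eta> \<in> cdom ?c"
      using a True by (auto simp: lift_charts chart_at_charts in_chart_at mem_Times_iff)
    then have "cmap ?c \<xi> \<noteq> cmap ?c \<eta>" using TM.inj_chart[OF c(1)] ne by (meson inj_onD)
    then obtain A B where AB: "open A" "open B" "cmap ?c \<xi> \<in> A" "cmap ?c \<eta> \<in> B" "A \<inter> B = {}"
      using hausdorff by meson
    show ?thesis
      by (intro exI[of _ "{q \<in> cdom ?c. cmap ?c q \<in> A}"] exI[of _ "{q \<in> cdom ?c. cmap ?c q \<in> B}"] conjI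
          TM.openin_chart_preimage c AB) (use c AB in \<open>auto simp: disjnt_iff\<close>)
  qed
qed

text \<open>For each member of a countable base that is contained in some chart domain choose such a chart.\<close>

lemma countable_chart_cover:
  assumes "second_countable (mtop M)"
  obtains K where "countable K" "K \<subseteq> charts M" "points M = (\<Union>c\<in>K. cdom c)"
proof -
  obtain \<B> where \<B>: "countable \<B>" "\<And>V. V \<in> \<B> \<Longrightarrow> openin (mtop M) V"
    "\<And>U x. openin (mtop M) U \<Longrightarrow> x \<in> U \<Longrightarrow> \<exists>V\<in>\<B>. x \<in> V \<and> V \<subseteq> U"
    using assms unfolding second_countable_def by meson
  define f where "f B = (SOME c. c \<in> charts M \<and> B \<subseteq> cdom c)" for B
  define \<B>' where "\<B>' = {B \<in> \<B>. \<exists>c\<in>charts M. B \<subseteq> cdom c}"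
  have f: "f B \<in> charts M \<and> B \<subseteq> cdom (f B)" if "B \<in> \<B>'" for B
  proof -
    have "\<exists>c. c \<in> charts M \<and> B \<subseteq> cdom c" using that unfolding \<B>'_def by blast
    from someI_ex[OF this] show ?thesis unfolding f_def .
  qed
  show ?thesis
  proof (rule that[of "f ` \<B>'"])
    show "countable (f ` \<B>')" using countable_subset[OF _ \<B>(1), of \<B>'] by (auto simp: \<B>'_def)
    show "f ` \<B>' \<subseteq> charts M" using f by blast
    then show "points M = (\<Union>c\<in>f ` \<B>'. cdom c)"
    proof (intro equalityI subsetI)
      fix p assume "p \<in> points M"
      then have c: "chart_at M p \<in> charts M" "p \<in> cdom (chart_at M p)" using chart_at_charts in_chart_at by auto
      then obtain B where "B \<in> \<B>" "p \<in> B" "B \<subseteq> cdom (chart_at M p)" using \<B>(3) openin_cdom by blast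
      then show "p \<in> (\<Union>c\<in>f ` \<B>'. cdom c)" using f c by (auto simp: \<B>'_def)
    qed (auto simp: points_def)
  qed
qed

lemma second_countable_from_charts:
  assumes K: "countable K" "K \<subseteq> charts M" "points M = (\<Union>c\<in>K. cdom c)"
  shows "second_countable (mtop M)"
proof -
  obtain \<A> :: "'e set set" where A: "countable \<A>" "\<And>A. A \<in> \<A> \<Longrightarrow> open A"
    "\<And>S. open S \<Longrightarrow> \<exists>U. U \<subseteq> \<A> \<and> S = \<Union>U"
    using univ_second_countable by blast
  let ?P = "\<lambda>(c, A). {p \<in> cdom c. cmap c p \<in> A}"
  show ?thesis
    unfolding second_countable_def
  proof (intro exI[of _ "?P ` (K \<times> \<A>)"] conjI ballI allI impI)
    show "countable (?P ` (K \<times> \<A>))" using K A by auto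
    show "openin (mtop M) V" if "V \<in> ?P ` (K \<times> \<A>)" for V
    proof -
      obtain c A where cA: "c \<in> K" "A \<in> \<A>" "V = {p \<in> cdom c. cmap c p \<in> A}" using \<open>V \<in> _\<close> by auto
      then show ?thesis using openin_chart_preimage[of c A] A(2)[of A] K(2) by blast
    qed
    fix U p assume Up: "openin (mtop M) U \<and> p \<in> U"
    then have "p \<in> points M" using openin_points by blast
    then obtain c where c: "c \<in> K" "p \<in> cdom c" using K by blast
    then have cM: "c \<in> charts M" using K by blast
    have "open (cmap c ` (cdom c \<inter> U))" using open_image Up cM by blast
    then obtain \<U> where "\<U> \<subseteq> \<A>" "cmap c ` (cdom c \<inter> U) = \<Union>\<U>" using A(3) by blast
    moreover have "cmap c p \<in> cmap c ` (cdom c \<inter> U)" using c Up by blast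
    ultimately obtain A where A': "A \<in> \<A>" "cmap c p \<in> A" "A \<subseteq> cmap c ` (cdom c \<inter> U)" by blast
    have "?P (c, A) \<subseteq> U"
    proof
      fix q assume "q \<in> ?P (c, A)"
      then have q: "q \<in> cdom c" "cmap c q \<in> cmap c ` (cdom c \<inter> U)" using A'(3) by auto
      then obtain r where "r \<in> cdom c" "r \<in> U" "cmap c q = cmap c r" by blast
      then show "q \<in> U" using inj_onD[OF inj_chart[OF cM]] q(1) by metis
    qed
    then show "\<exists>V\<in>?P ` (K \<times> \<A>). p \<in> V \<and> V \<subseteq> U" using A' c by (intro bexI[of _ "?P (c, A)"]) auto
  qed
qed

lemma smooth_manifold_tangent_bundle:
  assumes "smooth_manifold M"
  shows "smooth_manifold TM"
proof -
  have H: "Hausdorff_space (mtop M)" and S: "second_countable (mtop M)"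
    using assms by (auto simp: smooth_manifold_def)
  obtain K where K: "countable K" "K \<subseteq> charts M" "points M = (\<Union>c\<in>K. cdom c)"
    using countable_chart_cover[OF S] .
  have "second_countable (mtop TM)"
    by (rule smooth_atlas.second_countable_from_charts[OF smooth_atlas_tangent_bundle, of "lift_chart M ` K"])
      (use K in \<open>auto simp: charts_tangent_bundle points_tangent_bundle\<close>)
  then show ?thesis
    unfolding smooth_manifold_def
    by (intro conjI ballI TM.inj_chart TM.open_chart_image TM.open_overlap TM.smooth_transition
        TM.chart_at_charts TM.in_chart_at Hausdorff_tangent_bundle[OF H])
qed

end

section \<open>Lifts and the Sasaki metric\<close>

context semi_riemannian
begin

interpretation TM: smooth_atlas TM by (rule smooth_atlas_tangent_bundle)

abbreviation "\<Gamma> \<equiv> christoffel M (levi_civita M g)"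

text \<open>The preferred chart at \<open>p\<close> identifies tangent vectors at \<open>p\<close> with their components, so that \<open>\<gamma> p\<close>
  acts on tangent vectors themselves.\<close>

definition \<gamma> :: "'m \<Rightarrow> 'e \<Rightarrow> 'e \<Rightarrow> 'e" where "\<gamma> p = \<Gamma> (chart_at M p) p"

lemma bilinear_\<gamma>: "p \<in> points M \<Longrightarrow> bilinear (\<gamma> p)"
  unfolding \<gamma>_def by (intro levi_civita.bilinear_christoffel chart_at_charts in_chart_at)

lemma vlift_eq:
  assumes p: "p \<in> points M"
  shows "vlift M (p, u) v = (0, v)"
proof -
  have "((\<lambda>t. (cmap (chart_at M p) p, u + t *\<^sub>R v)) has_vector_derivative (0, v)) (at 0)"
    by (auto intro!: derivative_eq_intros)
  then show ?thesis
    using p by (simp add: vlift_def chart_at_tangent_bundle vector_derivative_at)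
qed

lemma mderiv_section:
  assumes U: "openin (mtop M) U" "p \<in> U" and Z: "vector_field M U Z"
  shows "mderiv M TM (\<lambda>q. (q, Z q)) p w =
    (w, chart_deriv (chart_at M p) (\<lambda>q. to_chart M (chart_at M p) q (Z q)) p w)"
proof -
  define c where "c = chart_at M p"
  have c: "c \<in> charts M" "p \<in> cdom c" using openin_points[OF U] chart_at_charts in_chart_at by (auto simp: c_def)
  let ?W = "cdom c \<inter> U"
  have W: "openin (mtop M) ?W" "p \<in> ?W" using openin_cdom_Int[OF c(1) U(1)] c U by auto
  have sm: "smooth_in M ?W (cmap c)" by (rule smooth_in_subset[OF smooth_in_cmap[OF c(1)]]) auto
  note Zc = vector_fieldD[OF U(1) Z c(1)]
  let ?F = "\<lambda>q. (cmap c q, to_chart M c q (Z q))"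
  have F: "smooth_in M ?W ?F" by (rule smooth_in_Pair[OF W(1) sm Zc])
  have "mderiv M TM (\<lambda>q. (q, Z q)) p = chart_deriv c ?F p"
    by (simp add: mderiv_def chart_deriv_def chart_at_tangent_bundle c_def o_def)
  moreover have "fst (chart_deriv c ?F p w) = w"
    using chart_deriv_bounded_linear[OF W(1) c(1) W(2) c(2) bounded_linear_fst F, of w]
      coord_change_self[OF c, of w] by (simp add: coord_change_chart_deriv)
  moreover have "snd (chart_deriv c ?F p w) = chart_deriv c (\<lambda>q. to_chart M c q (Z q)) p w"
    using chart_deriv_bounded_linear[OF W(1) c(1) W(2) c(2) bounded_linear_snd F, of w] by simp
  ultimately show ?thesis by (simp add: c_def[symmetric] prod_eq_iff)
qed

text \<open>The derivative of the components of \<open>Z\<close> occurs both in the differential of the section \<open>Z\<close> and in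
  the covariant derivative of \<open>Z\<close>; in the difference only \<open>\<gamma>\<close> remains, and this depends on the
  values of the fields at \<open>p\<close> alone.\<close>

lemma hlift_eq:
  assumes p: "p \<in> points M"
  shows "hlift M g (p, u) w = (w, - \<gamma> p w u)"
proof -
  define c where "c = chart_at M p"
  have c: "c \<in> charts M" "p \<in> cdom c" using p chart_at_charts in_chart_at by (auto simp: c_def)
  have val: "mderiv M TM (\<lambda>q. (q, Z q)) p (X p) - vlift M (p, Z p) (levi_civita M g X Z p)
      = (X p, - \<gamma> p (X p) (Z p))"
    if U: "openin (mtop M) U" "p \<in> U" and X: "vector_field M U X" and Z: "vector_field M U Z" for U X Z
    using levi_civita.connection_in_chart[OF U c X Z] p
    by (simp add: mderiv_section[OF U Z] vlift_eq[OF p] \<gamma>_def c_def)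
  show ?thesis
    unfolding hlift_def prod.case
  proof (rule the_equality)
    let ?E = "\<lambda>v q. of_chart M c q v"
    have E: "?E v p = v" for v using p by (simp add: c_def)
    show "\<exists>U X Z. openin (mtop M) U \<and> p \<in> U \<and> vector_field M U X \<and> vector_field M U Z \<and> X p = w \<and> Z p = u \<and>
        (w, - \<gamma> p w u) = mderiv M TM (\<lambda>q. (q, Z q)) p w - vlift M (p, u) (levi_civita M g X Z p)"
      using val[OF openin_cdom[OF c(1)] c(2) vector_field_const[OF c(1)] vector_field_const[OF c(1)], of u w]
      by (intro exI[of _ "cdom c"] exI[of _ "?E w"] exI[of _ "?E u"])
        (simp add: E openin_cdom[OF c(1)] c(2) vector_field_const[OF c(1)])
  next
    fix \<eta>
    assume "\<exists>U X Z. openin (mtop M) U \<and> p \<in> U \<and> vector_field M U X \<and> vector_field M U Z \<and> X p = w \<and> Z p = u \<and>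
        \<eta> = mderiv M TM (\<lambda>q. (q, Z q)) p w - vlift M (p, u) (levi_civita M g X Z p)"
    then show "\<eta> = (w, - \<gamma> p w u)" using val by fastforce
  qed
qed

text \<open>The connector: the vector of the base whose vertical lift is the vertical component of \<open>x\<close>.\<close>

definition vpart :: "'m \<times> 'e \<Rightarrow> 'e \<times> 'e \<Rightarrow> 'e" where
  "vpart \<xi> x = snd x + \<gamma> (fst \<xi>) (fst x) (snd \<xi>)"

lemma linear_vpart: "fst \<xi> \<in> points M \<Longrightarrow> linear (vpart \<xi>)"
  by (rule linearI)
    (simp_all add: vpart_def bilinear_ladd[OF bilinear_\<gamma>] bilinear_lmul[OF bilinear_\<gamma>] scaleR_add_right)

lemma tangent_decomp:
  assumes "fst \<xi> \<in> points M"
  shows "x = hlift M g \<xi> (fst x) + vlift M \<xi> (vpart \<xi> x)"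
  using hlift_eq[OF assms, of "snd \<xi>"] vlift_eq[OF assms, of "snd \<xi>"] by (simp add: vpart_def prod_eq_iff)

lemma vpart_lifts:
  assumes "fst \<xi> \<in> points M"
  shows "vpart \<xi> (vlift M \<xi> v) = v" "vpart \<xi> (hlift M g \<xi> v) = 0"
    "fst (vlift M \<xi> v) = 0" "fst (hlift M g \<xi> v) = v"
  using hlift_eq[OF assms, of "snd \<xi>"] vlift_eq[OF assms, of "snd \<xi>"] bilinear_lzero[OF bilinear_\<gamma>[OF assms]]
  by (simp_all add: vpart_def)

lemma linear_lifts:
  assumes "fst \<xi> \<in> points M"
  shows "linear (vlift M \<xi>)" "linear (hlift M g \<xi>)"
  using hlift_eq[OF assms, of "snd \<xi>"] vlift_eq[OF assms, of "snd \<xi>"]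
  by (auto intro!: linearI simp: bilinear_ladd[OF bilinear_\<gamma>[OF assms]] bilinear_lmul[OF bilinear_\<gamma>[OF assms]])

lemma bilinear_sasaki_form:
  assumes p: "fst \<xi> \<in> points M"
  shows "bilinear (\<lambda>x y. g (fst \<xi>) (fst x) (fst y) + g (fst \<xi>) (vpart \<xi> x) (vpart \<xi> y))"
proof -
  note B = bilinear_metric[OF p]
  show ?thesis
    unfolding bilinear_def
    by (intro conjI allI linearI)
      (simp_all add: bilinear_ladd[OF B] bilinear_radd[OF B] bilinear_lmul[OF B] bilinear_rmul[OF B]
        linear_add[OF linear_vpart[OF p]] linear_scale[OF linear_vpart[OF p]] distrib_left)
qed

text \<open>A symmetric bilinear form is determined by its values on horizontal and vertical lifts, since
  these span.\<close>

lemma sasaki_metric_eq: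
  assumes p: "fst \<xi> \<in> points M"
  shows "sasaki_metric M g \<xi> x y = g (fst \<xi>) (fst x) (fst y) + g (fst \<xi>) (vpart \<xi> x) (vpart \<xi> y)"
proof -
  note B = bilinear_metric[OF p] and S = bilinear_sasaki_form[OF p]
  let ?S = "\<lambda>x y. g (fst \<xi>) (fst x) (fst y) + g (fst \<xi>) (vpart \<xi> x) (vpart \<xi> y)"
  have "sasaki_metric M g \<xi> = ?S"
    unfolding sasaki_metric_def
  proof (rule the_equality)
    show "bilinear ?S \<and> (\<forall>\<eta> \<zeta>. ?S \<eta> \<zeta> = ?S \<zeta> \<eta>) \<and>
      (\<forall>v w. ?S (vlift M \<xi> v) (vlift M \<xi> w) = g (fst \<xi>) v w \<and>
        ?S (hlift M g \<xi> v) (hlift M g \<xi> w) = g (fst \<xi>) v w \<and> ?S (vlift M \<xi> v) (hlift M g \<xi> w) = 0)"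
      using S metric_sym[OF p] by (simp add: vpart_lifts[OF p] bilinear_lzero[OF B] bilinear_rzero[OF B])
  next
    fix b :: "'e \<times> 'e \<Rightarrow> 'e \<times> 'e \<Rightarrow> real"
    assume b: "bilinear b \<and> (\<forall>\<eta> \<zeta>. b \<eta> \<zeta> = b \<zeta> \<eta>) \<and>
      (\<forall>v w. b (vlift M \<xi> v) (vlift M \<xi> w) = g (fst \<xi>) v w \<and>
        b (hlift M g \<xi> v) (hlift M g \<xi> w) = g (fst \<xi>) v w \<and> b (vlift M \<xi> v) (hlift M g \<xi> w) = 0)"
    then have b0: "b (hlift M g \<xi> w) (vlift M \<xi> v) = 0" for v w by metis
    have "b x y = ?S x y" for x y
    proof -
      have "b x y = b (hlift M g \<xi> (fst x) + vlift M \<xi> (vpart \<xi> x)) (hlift M g \<xi> (fst y) + vlift M \<xi> (vpart \<xi> y))"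
        using tangent_decomp[OF p, of x] tangent_decomp[OF p, of y] by (simp only: )
      also have "\<dots> = ?S x y" using b b0 by (simp add: bilinear_ladd bilinear_radd)
      finally show ?thesis .
    qed
    then show "b = ?S" by blast
  qed
  then show ?thesis by simp
qed

text \<open>The lift of a single endomorphism of the tangent space at the base point of \<open>\<xi>\<close>.  As a function
  of the endomorphism, and not of a tensor field, it is an algebra homomorphism.\<close>

definition lift_op :: "'m \<times> 'e \<Rightarrow> ('e \<Rightarrow>\<^sub>L 'e) \<Rightarrow> ('e \<times> 'e) \<Rightarrow>\<^sub>L ('e \<times> 'e)" where
  "lift_op \<xi> B = Blinfun (\<lambda>x. hlift M g \<xi> (B (fst x)) + vlift M \<xi> (B (vpart \<xi> x)))"

lemma lift_op_apply:
  assumes p: "fst \<xi> \<in> points M"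
  shows "lift_op \<xi> B x = hlift M g \<xi> (B (fst x)) + vlift M \<xi> (B (vpart \<xi> x))"
proof -
  have "linear (\<lambda>x. hlift M g \<xi> (B (fst x)) + vlift M \<xi> (B (vpart \<xi> x)))"
    by (rule linearI)
      (simp_all add: linear_add[OF linear_lifts(1)[OF p]] linear_add[OF linear_lifts(2)[OF p]]
        linear_scale[OF linear_lifts(1)[OF p]] linear_scale[OF linear_lifts(2)[OF p]]
        linear_add[OF linear_vpart[OF p]] linear_scale[OF linear_vpart[OF p]] blinfun.bilinear_simps scaleR_add_right)
  then show ?thesis
    unfolding lift_op_def by (simp add: bounded_linear_Blinfun_apply linear_linear)
qed

lemma lift_op_parts:
  assumes p: "fst \<xi> \<in> points M"
  shows "fst (lift_op \<xi> B x) = B (fst x)" "vpart \<xi> (lift_op \<xi> B x) = B (vpart \<xi> x)"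
  by (simp_all add: lift_op_apply[OF p] vpart_lifts[OF p] linear_add[OF linear_vpart[OF p]])

lemma tangent_eqI:
  assumes "fst \<xi> \<in> points M" "fst x = fst y" "vpart \<xi> x = vpart \<xi> y"
  shows "x = y"
  using tangent_decomp[OF assms(1)] assms(2,3) by metis

lemma lift_endo_eq:
  assumes p: "fst \<xi> \<in> points M"
  shows "lift_endo M g J \<xi> = lift_op \<xi> (J (fst \<xi>))"
  unfolding lift_endo_def
proof (rule the_equality)
  show "\<forall>v. lift_op \<xi> (J (fst \<xi>)) (vlift M \<xi> v) = vlift M \<xi> (J (fst \<xi>) v) \<and>
     lift_op \<xi> (J (fst \<xi>)) (hlift M g \<xi> v) = hlift M g \<xi> (J (fst \<xi>) v)"
    by (simp add: lift_op_apply[OF p] vpart_lifts[OF p] linear_0[OF linear_lifts(1)[OF p]]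
        linear_0[OF linear_lifts(2)[OF p]])
next
  fix B :: "('e \<times> 'e) \<Rightarrow>\<^sub>L ('e \<times> 'e)"
  assume B: "\<forall>v. B (vlift M \<xi> v) = vlift M \<xi> (J (fst \<xi>) v) \<and> B (hlift M g \<xi> v) = hlift M g \<xi> (J (fst \<xi>) v)"
  show "B = lift_op \<xi> (J (fst \<xi>))"
  proof (rule blinfun_eqI)
    fix x
    have "B x = B (hlift M g \<xi> (fst x) + vlift M \<xi> (vpart \<xi> x))"
      using tangent_decomp[OF p, of x] by (simp only: )
    also have "\<dots> = lift_op \<xi> (J (fst \<xi>)) x" using B by (simp add: blinfun.add_right lift_op_apply[OF p])
    finally show "B x = lift_op \<xi> (J (fst \<xi>)) x" .
  qed
qed

lemma linear_lift_op:
  assumes p: "fst \<xi> \<in> points M"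
  shows "linear (lift_op \<xi>)"
  by (rule linearI; rule blinfun_eqI; rule tangent_eqI[OF p])
    (simp_all add: lift_op_parts[OF p] blinfun.bilinear_simps linear_add[OF linear_vpart[OF p]]
        linear_scale[OF linear_vpart[OF p]])

lemma inj_lift_op:
  assumes p: "fst \<xi> \<in> points M"
  shows "inj (lift_op \<xi>)"
proof (rule injI, rule blinfun_eqI)
  fix A B v assume "lift_op \<xi> A = lift_op \<xi> B"
  then have "fst (lift_op \<xi> A (v, 0)) = fst (lift_op \<xi> B (v, 0))" by simp
  then show "A v = B v" by (simp add: lift_op_parts[OF p])
qed

lemma lift_op_compose:
  assumes p: "fst \<xi> \<in> points M"
  shows "lift_op \<xi> A o\<^sub>L lift_op \<xi> B = lift_op \<xi> (A o\<^sub>L B)" "lift_op \<xi> id_blinfun = id_blinfun"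
  by (rule blinfun_eqI; rule tangent_eqI[OF p]; simp add: lift_op_parts[OF p])+

text \<open>In terms of the induced chart of an arbitrary chart \<open>c\<close>, the splitting into horizontal and
  vertical part has the same form as in the preferred chart, with \<open>\<Gamma> c\<close> in place of \<open>\<gamma>\<close>: the second
  derivatives in \<open>coord_change_lift\<close> and \<open>christoffel_change\<close> cancel.\<close>

lemma of_chart_tangent:
  assumes c: "c \<in> charts M" "p \<in> cdom c"
  shows "of_chart TM (lift_chart M c) (p, u) (a, b) =
    (of_chart M c p a, of_chart M c p (b + \<Gamma> c p a (to_chart M c p u)) - \<gamma> p (of_chart M c p a) u)"
proof -
  have p: "p \<in> points M" using cdom_points[OF c] .
  define d where "d = chart_at M p"
  have d: "d \<in> charts M" "p \<in> cdom d" using p chart_at_charts in_chart_at by (auto simp: d_def)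
  have of: "of_chart M c p = coord_change c d p" by (simp add: of_chart_def d_def)
  have u: "coord_change c d p (to_chart M c p u) = u"
    using of_to_chart[OF c, of u] by (simp add: of)
  have "of_chart TM (lift_chart M c) (p, u) (a, b)
      = coord_change (lift_chart M c) (lift_chart M d) (p, u) (a, b)"
    by (simp add: of_chart_def chart_at_tangent_bundle d_def)
  then show ?thesis
    using levi_civita.christoffel_change[OF c d, of a "to_chart M c p u"]
      linear_add[OF linear_of_chart[OF c], of b]
    by (simp add: coord_change_lift[OF c d] of u \<gamma>_def d_def[symmetric])
qed

lemma vpart_of_chart:
  assumes c: "c \<in> charts M" "p \<in> cdom c"
  shows "vpart (p, u) (of_chart TM (lift_chart M c) (p, u) x)
      = of_chart M c p (snd x + \<Gamma> c p (fst x) (to_chart M c p u))"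
    "fst (of_chart TM (lift_chart M c) (p, u) x) = of_chart M c p (fst x)"
  using of_chart_tangent[OF c, of u "fst x" "snd x"] by (simp_all add: vpart_def)

lemma to_chart_tangent:
  assumes c: "c \<in> charts M" "p \<in> cdom c"
  shows "to_chart TM (lift_chart M c) (p, u) x =
    (to_chart M c p (fst x), to_chart M c p (vpart (p, u) x) - \<Gamma> c p (to_chart M c p (fst x)) (to_chart M c p u))"
proof -
  have p: "p \<in> points M" using cdom_points[OF c] .
  let ?y = "(to_chart M c p (fst x), to_chart M c p (vpart (p, u) x) - \<Gamma> c p (to_chart M c p (fst x)) (to_chart M c p u))"
  have "of_chart TM (lift_chart M c) (p, u) ?y = x"
    by (rule tangent_eqI[of "(p, u)"]) (simp_all add: p vpart_of_chart[OF c] c)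
  then show ?thesis
    using TM.to_of_chart[OF lift_charts[OF c(1)], of "(p, u)" ?y] c by simp
qed

lemma bilinear_sasaki:
  assumes p: "fst \<xi> \<in> points M"
  shows "bilinear (sasaki_metric M g \<xi>)"
proof -
  have "sasaki_metric M g \<xi> = (\<lambda>x y. g (fst \<xi>) (fst x) (fst y) + g (fst \<xi>) (vpart \<xi> x) (vpart \<xi> y))"
    by (intro ext sasaki_metric_eq[OF p])
  then show ?thesis using bilinear_sasaki_form[OF p] by (simp only:)
qed

lemma sasaki_nondegenerate:
  assumes p: "fst \<xi> \<in> points M" and x: "\<And>y. sasaki_metric M g \<xi> x y = 0"
  shows "x = 0"
proof (rule tangent_eqI[OF p])
  note B = bilinear_metric[OF p]
  have "g (fst \<xi>) (fst x) w = 0" for w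
    using x[of "hlift M g \<xi> w"] by (simp add: sasaki_metric_eq[OF p] vpart_lifts[OF p] bilinear_rzero[OF B])
  then show "fst x = fst 0" using metric_nondegenerate[OF p] by simp
  have "g (fst \<xi>) (vpart \<xi> x) w = 0" for w
    using x[of "vlift M \<xi> w"] by (simp add: sasaki_metric_eq[OF p] vpart_lifts[OF p] bilinear_rzero[OF B])
  then show "vpart \<xi> x = vpart \<xi> 0" using metric_nondegenerate[OF p] linear_0[OF linear_vpart[OF p]] by simp
qed

lemma smooth_in_vertical_coordinate:
  assumes c: "c \<in> charts M"
  shows "smooth_in TM (fst -` cdom c)
    (\<lambda>\<xi>. b + \<Gamma> c (fst \<xi>) a (to_chart M c (fst \<xi>) (snd \<xi>)))"
proof -
  note U = openin_cdom[OF c]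
  note W = openin_fst_vimage[OF U]
  have w: "smooth_in TM (fst -` cdom c) (\<lambda>\<xi>. to_chart M c (fst \<xi>) (snd \<xi>))"
    by (rule TM.smooth_in_subset[OF smooth_in_fibre_coordinate[OF c]]) auto
  show ?thesis
    by (rule TM.smooth_in_add[OF W TM.smooth_in_const[OF W] TM.smooth_in_linear_family[OF W _
          smooth_in_fst[OF U levi_civita.smooth_in_christoffel[OF c]] w]])
      (use levi_civita.bilinear_christoffel[OF c] in \<open>auto simp: bilinear_def\<close>)
qed

lemma smooth_sasaki:
  assumes c: "c \<in> charts M"
  shows "smooth_in TM (fst -` cdom c) (\<lambda>\<xi>. sasaki_metric M g \<xi>
      (of_chart TM (lift_chart M c) \<xi> x) (of_chart TM (lift_chart M c) \<xi> y))"
proof -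
  note U = openin_cdom[OF c]
  note W = openin_fst_vimage[OF U]
  let ?v = "\<lambda>x \<xi>. snd x + \<Gamma> c (fst \<xi>) (fst x) (to_chart M c (fst \<xi>) (snd \<xi>))"
  have "smooth_in TM (fst -` cdom c)
      (\<lambda>\<xi>. gram c (fst \<xi>) (fst x) (fst y) + gram c (fst \<xi>) (?v x \<xi>) (?v y \<xi>))"
    by (rule TM.smooth_in_add[OF W smooth_in_fst[OF U smooth_in_gram[OF c]] TM.smooth_in_bilinear_family[OF W _
          smooth_in_fst[OF U smooth_in_gram[OF c]] smooth_in_vertical_coordinate[OF c] smooth_in_vertical_coordinate[OF c]]])
      (use bilinear_gram[OF c] in auto)
  then show ?thesis
  proof (rule TM.smooth_in_cong[OF W, rotated])
    fix \<xi> :: "'m \<times> 'e" assume "\<xi> \<in> fst -` cdom c"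
    then obtain p u where \<xi>: "\<xi> = (p, u)" and p: "p \<in> cdom c" by (cases \<xi>) auto
    show "gram c (fst \<xi>) (fst x) (fst y) + gram c (fst \<xi>) (?v x \<xi>) (?v y \<xi>) = sasaki_metric M g \<xi>
      (of_chart TM (lift_chart M c) \<xi> x) (of_chart TM (lift_chart M c) \<xi> y)"
      by (simp add: \<xi> sasaki_metric_eq cdom_points[OF c p] vpart_of_chart[OF c p] gram_def)
  qed
qed

lemma tensor_field_lift_endo:
  assumes U: "openin (mtop M) U" and J: "tensor_field11 M U J"
  shows "tensor_field11 TM (fst -` U) (lift_endo M g J)"
proof (rule TM.tensor_field11I)
  fix c' x assume "c' \<in> charts TM"
  then obtain c where c: "c \<in> charts M" and c': "c' = lift_chart M c" by (auto simp: charts_tangent_bundle)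
  let ?V = "cdom c \<inter> U" and ?Jc = "\<lambda>p v. to_chart M c p (J p (of_chart M c p v))"
  have V: "openin (mtop M) ?V" by (rule openin_cdom_Int[OF c U])
  note W = openin_fst_vimage[OF V]
  let ?w = "\<lambda>\<xi>. to_chart M c (fst \<xi>) (snd \<xi>)"
  let ?v = "\<lambda>\<xi>. snd x + \<Gamma> c (fst \<xi>) (fst x) (?w \<xi>)"
  have w: "smooth_in TM (fst -` ?V) ?w"
    by (rule TM.smooth_in_subset[OF smooth_in_fibre_coordinate[OF c]]) auto
  have v: "smooth_in TM (fst -` ?V) ?v"
    by (rule TM.smooth_in_subset[OF smooth_in_vertical_coordinate[OF c]]) auto
  have Jc: "smooth_in TM (fst -` ?V) (\<lambda>\<xi>. ?Jc (fst \<xi>) v)" for v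
    by (rule smooth_in_fst[OF V tensor_field11D[OF U J c]])
  have \<Gamma>: "smooth_in TM (fst -` ?V) (\<lambda>\<xi>. \<Gamma> c (fst \<xi>) v z)" for v z
    by (rule smooth_in_fst[OF V smooth_in_subset[OF levi_civita.smooth_in_christoffel[OF c]]]) auto
  have linJ: "linear (?Jc p)" if "p \<in> ?V" for p
    using that c by (intro linearI)
      (simp_all add: linear_add[OF linear_to_chart] linear_scale[OF linear_to_chart]
        linear_add[OF linear_of_chart] linear_scale[OF linear_of_chart] blinfun.bilinear_simps)
  have bil: "bilinear (\<Gamma> c p)" if "p \<in> ?V" for p
    using that levi_civita.bilinear_christoffel[OF c] by blast
  have "smooth_in TM (fst -` ?V)
      (\<lambda>\<xi>. (?Jc (fst \<xi>) (fst x), ?Jc (fst \<xi>) (?v \<xi>) - \<Gamma> c (fst \<xi>) (?Jc (fst \<xi>) (fst x)) (?w \<xi>)))"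
    by (rule TM.smooth_in_Pair[OF W Jc TM.smooth_in_diff[OF W TM.smooth_in_linear_family[OF W _ Jc v]
            TM.smooth_in_bilinear_family[OF W _ \<Gamma> Jc w]]])
      (use linJ bil in auto)
  then have "smooth_in TM (fst -` ?V) (\<lambda>\<xi>. to_chart TM c' \<xi>
      (lift_endo M g J \<xi> (of_chart TM c' \<xi> x)))"
  proof (rule TM.smooth_in_cong[OF W, rotated])
    fix \<xi> :: "'m \<times> 'e" assume "\<xi> \<in> fst -` ?V"
    then obtain p u where \<xi>: "\<xi> = (p, u)" and p: "p \<in> cdom c" by (cases \<xi>) auto
    have p': "fst (p, u) \<in> points M" using cdom_points[OF c p] by simp
    show "(?Jc (fst \<xi>) (fst x), ?Jc (fst \<xi>) (?v \<xi>) - \<Gamma> c (fst \<xi>) (?Jc (fst \<xi>) (fst x)) (?w \<xi>))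
      = to_chart TM c' \<xi> (lift_endo M g J \<xi> (of_chart TM c' \<xi> x))"
      unfolding \<xi> c' to_chart_tangent[OF c p] lift_endo_eq[OF p'] lift_op_parts[OF p'] vpart_of_chart[OF c p]
      by simp
  qed
  moreover have "cdom c' \<inter> fst -` U = fst -` ?V" by (auto simp: c')
  ultimately show "smooth_in TM (cdom c' \<inter> fst -` U) (\<lambda>\<xi>. to_chart TM c' \<xi>
      (lift_endo M g J \<xi> (of_chart TM c' \<xi> x)))" by simp
qed

lemma mderiv_fst:
  assumes p: "fst \<xi> \<in> points M"
  shows "mderiv TM M fst \<xi> = fst"
proof -
  define c where "c = chart_at M (fst \<xi>)"
  have c: "c \<in> charts M" "fst \<xi> \<in> cdom c" using p chart_at_charts in_chart_at by (auto simp: c_def)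
  have "mderiv TM M fst \<xi> = chart_deriv (lift_chart M c) (\<lambda>\<eta>. cmap c (fst \<eta>)) \<xi>"
    by (simp add: mderiv_def chart_deriv_def chart_at_tangent_bundle c_def o_def)
  moreover have "chart_deriv (lift_chart M c) (\<lambda>\<eta>. cmap c (fst \<eta>)) \<xi> x = fst x" for x
    using chart_deriv_fst[OF openin_cdom[OF c(1)] smooth_in_cmap[OF c(1)] c(1) c(2) c(2), of "snd \<xi>" "fst x" "snd x"]
      coord_change_self[OF c, of "fst x"] by (simp add: coord_change_chart_deriv)
  ultimately show ?thesis by auto
qed

text \<open>Horizontal vectors are those with \<open>vpart \<xi> x = 0\<close>, by nondegeneracy of \<open>g\<close>; on them the second
  summand of the Sasaki metric vanishes.\<close>

lemma semi_riemannian_submersion_fst: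
  "semi_riemannian_submersion TM (sasaki_metric M g) M g fst"
  unfolding semi_riemannian_submersion_def Let_def
proof (intro conjI ballI smooth_map_fst)
  show "fst ` points TM = points M" by (auto simp: points_tangent_bundle image_iff)
  fix \<xi> assume "\<xi> \<in> points TM"
  then have p: "fst \<xi> \<in> points M" by (auto simp: points_tangent_bundle)
  note B = bilinear_metric[OF p] and md = mderiv_fst[OF p] and S = sasaki_metric_eq[OF p]
  let ?V = "{v. mderiv TM M fst \<xi> v = 0}"
  let ?H = "{w. \<forall>v\<in>?V. sasaki_metric M g \<xi> w v = 0}"
  have vV: "vlift M \<xi> v \<in> ?V" for v by (simp add: md vpart_lifts[OF p])
  show "surj (mderiv TM M fst \<xi>)" by (simp add: md surj_def)
  show "(\<forall>w\<in>?V. sasaki_metric M g \<xi> v w = 0) \<longrightarrow> v = 0" if "v \<in> ?V" for v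
  proof
    assume a: "\<forall>w\<in>?V. sasaki_metric M g \<xi> v w = 0"
    have v: "fst v = 0" using that by (simp add: md)
    show "v = 0"
    proof (rule tangent_eqI[OF p])
      have "g (fst \<xi>) (vpart \<xi> v) w = 0" for w
        using a[rule_format, OF vV, of w] by (simp add: S vpart_lifts[OF p] v bilinear_lzero[OF B])
      then show "vpart \<xi> v = vpart \<xi> 0"
        using metric_nondegenerate[OF p] linear_0[OF linear_vpart[OF p]] by simp
    qed (simp add: v)
  qed
  have H: "vpart \<xi> x = 0" if "x \<in> ?H" for x
  proof (rule metric_nondegenerate[OF p])
    fix w
    have "sasaki_metric M g \<xi> x (vlift M \<xi> w) = 0" using that vV by blast
    then show "g (fst \<xi>) (vpart \<xi> x) w = 0" by (simp add: S vpart_lifts[OF p] bilinear_rzero[OF B])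
  qed
  show "g (fst \<xi>) (mderiv TM M fst \<xi> v) (mderiv TM M fst \<xi> w) = sasaki_metric M g \<xi> v w"
    if "v \<in> ?H" "w \<in> ?H" for v w
    by (simp add: md S H[OF that(1)] H[OF that(2)] bilinear_rzero[OF B])
qed

end

section \<open>The index of the Sasaki metric\<close>

text \<open>A negative definite subspace meets \<open>P\<close> only in zero, so its dimension is at most \<open>DIM('e) - dim P\<close>.\<close>

lemma form_index_eqI:
  fixes b :: "'e::euclidean_space \<Rightarrow> 'e \<Rightarrow> real"
  assumes W: "subspace W" "\<forall>w\<in>W - {0}. b w w < 0" and P: "subspace P" "\<forall>x\<in>P. 0 \<le> b x x"
    and d: "DIM('e) \<le> dim W + dim P"
  shows "form_index b = dim W"
  unfolding form_index_def
proof (rule Max_eqI)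
  have "{dim W |W. subspace W \<and> (\<forall>w\<in>W - {0}. b w w < 0)} \<subseteq> {..DIM('e)}"
    using dim_subset_UNIV by auto
  then show "finite {dim W |W. subspace W \<and> (\<forall>w\<in>W - {0}. b w w < 0)}"
    using finite_subset by blast
  show "dim W \<in> {dim W |W. subspace W \<and> (\<forall>w\<in>W - {0}. b w w < 0)}" using W by blast
  fix k assume "k \<in> {dim W |W. subspace W \<and> (\<forall>w\<in>W - {0}. b w w < 0)}"
  then obtain N where N: "subspace N" "\<forall>w\<in>N - {0}. b w w < 0" "k = dim N" by blast
  have "N \<inter> P \<subseteq> {0}" using N(2) P(2) by (fastforce simp: not_le[symmetric])
  then have "dim (N \<inter> P) = 0" by (simp add: dim_eq_0)
  then have "dim {x + y |x y. x \<in> N \<and> y \<in> P} = dim N + dim P"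
    using dim_sums_Int[OF N(1) P(1)] by linarith
  then have "dim N + dim P \<le> DIM('e)"
    using dim_subset_UNIV[of "{x + y |x y. x \<in> N \<and> y \<in> P}"] by linarith
  then show "k \<le> dim W" using d N(3) by simp
qed

text \<open>Take for \<open>W\<close> a negative definite subspace of maximal dimension and for \<open>P\<close> its orthogonal space
  with respect to \<open>b\<close>.  A vector of \<open>P\<close> with negative square could be added to \<open>W\<close>.  The dimension
  of \<open>P\<close> is estimated as that of the kernel of a map into \<open>W\<close>.\<close>

lemma negative_definite_splitting:
  fixes b :: "'e::euclidean_space \<Rightarrow> 'e \<Rightarrow> real"
  assumes b: "bilinear b" and sym: "\<And>x y. b x y = b y x"
  obtains W P where "subspace W" "\<forall>w\<in>W - {0}. b w w < 0" "subspace P" "\<forall>x\<in>P. 0 \<le> b x x"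
    "DIM('e) \<le> dim W + dim P"
proof -
  have lin: "linear (b x)" "linear (\<lambda>x. b x y)" for x y using b by (auto simp: bilinear_def)
  let ?A = "{dim W |W. subspace W \<and> (\<forall>w\<in>W - {0}. b w w < 0)}"
  have "?A \<subseteq> {..DIM('e)}" using dim_subset_UNIV by auto
  then have fin: "finite ?A" using finite_subset by blast
  have "dim {0::'e} \<in> ?A" using subspace_single_0 by blast
  then have "Max ?A \<in> ?A" using fin by (intro Max_in) auto
  then obtain W where W: "subspace W" "\<forall>w\<in>W - {0}. b w w < 0" "dim W = Max ?A" by auto
  define P where "P = {x. \<forall>w\<in>W. b x w = 0}"
  have P: "subspace P"
    unfolding P_def subspace_def by (auto simp: linear_0[OF lin(2)] linear_add[OF lin(2)] linear_scale[OF lin(2)])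
  have psd: "0 \<le> b x x" if x: "x \<in> P" for x
  proof (rule ccontr)
    assume neg: "\<not> 0 \<le> b x x"
    have xW: "x \<notin> W"
    proof
      assume "x \<in> W"
      then have "b x x = 0" using x by (simp add: P_def)
      then show False using neg by simp
    qed
    have "\<forall>v\<in>span (insert x W) - {0}. b v v < 0"
    proof
      fix v assume v: "v \<in> span (insert x W) - {0}"
      then obtain t where t: "v - t *\<^sub>R x \<in> W" using W(1) by (auto simp: span_insert span_eq_iff[THEN iffD2])
      define w where "w = v - t *\<^sub>R x"
      have w: "w \<in> W" "v = w + t *\<^sub>R x" using t by (simp_all add: w_def)
      have "b x w = 0" "b w x = 0" using x w sym[of w x] by (auto simp: P_def)
      then have eq: "b v v = b w w + t * t * b x x"
        by (simp add: w(2) linear_add[OF lin(1)] linear_add[OF lin(2)] linear_scale[OF lin(1)] linear_scale[OF lin(2)])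
      have t0: "t * t * b x x \<le> 0" using neg by (intro mult_nonneg_nonpos) auto
      show "b v v < 0"
      proof (cases "w = 0")
        case True
        then have "t \<noteq> 0" using v w by auto
        then have "t * t * b x x < 0" using neg by (intro mult_pos_neg) (auto simp: zero_less_mult_iff neq_iff)
        then show ?thesis using eq True by (simp add: linear_0[OF lin(1)])
      next
        case False
        then have "b w w < 0" using W(2) w by blast
        then show ?thesis using eq t0 by simp
      qed
    qed
    then have "dim (span (insert x W)) \<in> ?A" by blast
    then have "dim (span (insert x W)) \<le> dim W" using W(3) fin by simp
    moreover have "dim (insert x W) = dim W + 1"
      using xW W(1) by (simp add: dim_insert span_eq_iff[THEN iffD2])
    ultimately show False by simp
  qed
  have "DIM('e) \<le> dim W + dim P"
  proof -
    obtain B where B: "B \<subseteq> W" "independent B" "W \<subseteq> span B" "card B = dim W" using basis_exists[of W] by blast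
    have finB: "finite B" using B(2) independent_imp_finite by blast
    \<comment> \<open>The kernel of \<open>T\<close> is \<open>P\<close>, since \<open>B\<close> is independent and spans \<open>W\<close>; \<open>T\<close> is injective on the
      Euclidean complement \<open>Q\<close> of \<open>P\<close>, whence \<open>dim Q \<le> dim W\<close>.\<close>
    define T where "T x = (\<Sum>i\<in>B. b x i *\<^sub>R i)" for x
    have linT: "linear T"
      unfolding T_def[abs_def]
      by (intro linear_compose_sum ballI linearI)
        (simp_all add: linear_add[OF lin(2)] linear_scale[OF lin(2)] scaleR_left_distrib)
    have kernel: "x \<in> P" if "T x = 0" for x
    proof -
      have Bz: "\<forall>i\<in>B. b x i = 0"
        using B(2) finB that unfolding T_def independent_explicit by blast
      have "b x w = 0" if w: "w \<in> span B" for w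
        using w by (induction rule: span_induct_alt)
          (auto simp: Bz linear_0[OF lin(1)] linear_add[OF lin(1)] linear_scale[OF lin(1)])
      then show ?thesis using B(3) by (auto simp: P_def)
    qed
    define Q where "Q = {y. \<forall>x\<in>P. orthogonal x y}"
    have Q: "subspace Q" unfolding Q_def subspace_def by (auto simp: orthogonal_clauses)
    have dPQ: "dim Q + dim P = DIM('e)"
      using dim_subspace_orthogonal_to_vectors[OF P subspace_UNIV] by (simp add: Q_def)
    have "inj_on T Q"
    proof (rule inj_onI)
      fix x y assume xy: "x \<in> Q" "y \<in> Q" "T x = T y"
      then have "T (x - y) = 0" by (simp add: linear_diff[OF linT])
      then have "x - y \<in> P" "x - y \<in> Q" using kernel xy Q by (auto simp: subspace_diff)
      then have "orthogonal (x - y) (x - y)" by (auto simp: Q_def)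
      then show "x = y" by (simp add: orthogonal_self)
    qed
    then have "dim Q = dim (T ` Q)"
      using dim_image_eq[OF linT, of Q] Q by (simp add: span_eq_iff[THEN iffD2])
    also have "\<dots> \<le> dim (span B)"
      by (rule dim_subset) (auto simp: T_def intro!: span_sum intro: span_scale span_base)
    also have "\<dots> = dim W" using B by (simp add: dim_eq_card_independent)
    finally show ?thesis using dPQ by simp
  qed
  then show ?thesis using that W P psd by blast
qed

text \<open>The shear \<open>T\<close> takes the form to \<open>b \<oplus> b\<close>, which is negative definite on \<open>W \<times> W\<close> and positive
  semidefinite on \<open>P \<times> P\<close> when \<open>b\<close> is so on \<open>W\<close> and \<open>P\<close>.\<close>

lemma form_index_double:
  fixes b :: "'e::euclidean_space \<Rightarrow> 'e \<Rightarrow> real" and \<kappa> :: "'e \<times> 'e \<Rightarrow> 'e"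
  assumes b: "bilinear b" "\<And>x y. b x y = b y x"
    and k: "linear k" and \<kappa>: "\<And>x. \<kappa> x = snd x + k (fst x)"
  shows "form_index (\<lambda>x y. b (fst x) (fst y) + b (\<kappa> x) (\<kappa> y)) = 2 * form_index b"
proof -
  obtain W P where W: "subspace W" "\<forall>w\<in>W - {0}. b w w < 0" and P: "subspace P" "\<forall>x\<in>P. 0 \<le> b x x"
    and d: "DIM('e) \<le> dim W + dim P"
    using negative_definite_splitting[OF b] by blast
  define T where "T x = (fst x, snd x - k (fst x))" for x :: "'e \<times> 'e"
  have linT: "linear T"
    unfolding T_def[abs_def]
    by (rule linearI) (simp_all add: linear_add[OF k] linear_scale[OF k] algebra_simps)
  have injT: "inj T" by (rule injI) (auto simp: T_def prod_eq_iff)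
  have T: "fst (T x) = fst x" "\<kappa> (T x) = snd x" for x by (simp_all add: T_def \<kappa>)
  have dimT: "dim (T ` (V \<times> V)) = 2 * dim V" and subT: "subspace (T ` (V \<times> V))" if "subspace V" for V
    using dim_image_eq[OF linT inj_on_subset[OF injT]] dim_Times[OF that that]
      linear_subspace_image[OF linT subspace_Times[OF that that]] by auto
  have "form_index (\<lambda>x y. b (fst x) (fst y) + b (\<kappa> x) (\<kappa> y)) = dim (T ` (W \<times> W))"
  proof (rule form_index_eqI[OF subT[OF W(1)] _ subT[OF P(1)]])
    have le: "b w w \<le> 0" if "w \<in> W" for w
      using W(2) that b(1) by (cases "w = 0") (auto simp: bilinear_lzero less_imp_le)
    have lt: "b w w < 0" if "w \<in> W" "w \<noteq> 0" for w using W(2) that by blast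
    show "\<forall>x\<in>T ` (W \<times> W) - {0}. b (fst x) (fst x) + b (\<kappa> x) (\<kappa> x) < 0"
    proof
      fix x assume x: "x \<in> T ` (W \<times> W) - {0}"
      then obtain a c where ac: "x = T (a, c)" "a \<in> W" "c \<in> W" by auto
      then have "a \<noteq> 0 \<or> c \<noteq> 0" using x linear_0[OF linT] by (auto simp: zero_prod_def)
      then show "b (fst x) (fst x) + b (\<kappa> x) (\<kappa> x) < 0"
        using lt[OF ac(2)] lt[OF ac(3)] le[OF ac(2)] le[OF ac(3)] unfolding ac(1) T by force
    qed
    show "\<forall>x\<in>T ` (P \<times> P). 0 \<le> b (fst x) (fst x) + b (\<kappa> x) (\<kappa> x)"
      using P(2) by (auto simp: T)
    show "DIM('e \<times> 'e) \<le> dim (T ` (W \<times> W)) + dim (T ` (P \<times> P))"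
      using d by (simp add: dimT[OF W(1)] dimT[OF P(1)])
  qed
  then show ?thesis using form_index_eqI[where b = b and W = W and P = P, OF W P d] dimT[OF W(1)] by simp
qed

context semi_riemannian
begin

lemma semi_riemannian_sasaki: "semi_riemannian_metric TM (sasaki_metric M g)"
  unfolding semi_riemannian_metric_def
proof (intro conjI ballI allI impI)
  fix \<xi> assume "\<xi> \<in> points TM"
  then have p: "fst \<xi> \<in> points M" by (auto simp: points_tangent_bundle)
  show "bilinear (sasaki_metric M g \<xi>)" by (rule bilinear_sasaki[OF p])
  show "sasaki_metric M g \<xi> v w = sasaki_metric M g \<xi> w v" for v w
    by (simp add: sasaki_metric_eq[OF p] metric_sym[OF p])
  show "v = 0" if "\<forall>w. sasaki_metric M g \<xi> v w = 0" for v using sasaki_nondegenerate[OF p] that by blast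
next
  interpret TM: smooth_atlas TM by (rule smooth_atlas_tangent_bundle)
  fix c' v w assume c': "c' \<in> charts TM"
  then obtain c where c: "c \<in> charts M" "c' = lift_chart M c" by (auto simp: charts_tangent_bundle)
  have eq: "cdom c' \<inter> fst -` cdom c = cdom c'" using c by auto
  show "smooth_on (cmap c' ` cdom c')
      ((\<lambda>\<xi>. sasaki_metric M g \<xi> (of_chart TM c' \<xi> v) (of_chart TM c' \<xi> w)) \<circ> cinv c')"
    using TM.smooth_inD[OF smooth_sasaki[OF c(1), of v w] c'] unfolding eq c(2)[symmetric] .
next
  obtain k where k: "\<forall>p\<in>points M. form_index (g p) = k" using metric by (auto simp: semi_riemannian_metric_def)
  have "form_index (sasaki_metric M g \<xi>) = 2 * k" if "\<xi> \<in> points TM" for \<xi>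
  proof -
    have p: "fst \<xi> \<in> points M" using that by (auto simp: points_tangent_bundle)
    have "sasaki_metric M g \<xi> = (\<lambda>x y. g (fst \<xi>) (fst x) (fst y) + g (fst \<xi>) (vpart \<xi> x) (vpart \<xi> y))"
      by (intro ext sasaki_metric_eq[OF p])
    then show ?thesis
      using form_index_double[OF bilinear_metric[OF p] metric_sym[OF p], of "\<lambda>a. \<gamma> (fst \<xi>) a (snd \<xi>)" "vpart \<xi>"]
        bilinear_\<gamma>[OF p] k p by (simp add: vpart_def bilinear_def)
  qed
  then show "\<exists>k. \<forall>\<xi>\<in>points TM. form_index (sasaki_metric M g \<xi>) = k" by blast
qed

end

section \<open>Paraquaternionic structures\<close>

text \<open>The full multiplication table of a local basis at a point, with the signs \<open>\<tau>\<close> evaluated.\<close>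

definition para_triple :: "('e::real_normed_vector \<Rightarrow>\<^sub>L 'e) \<Rightarrow> ('e \<Rightarrow>\<^sub>L 'e) \<Rightarrow> ('e \<Rightarrow>\<^sub>L 'e) \<Rightarrow> bool" where
  "para_triple A B C \<longleftrightarrow>
     A o\<^sub>L A = id_blinfun \<and> B o\<^sub>L B = id_blinfun \<and> C o\<^sub>L C = - id_blinfun \<and>
     A o\<^sub>L B = C \<and> B o\<^sub>L A = - C \<and> B o\<^sub>L C = - A \<and> C o\<^sub>L B = A \<and> C o\<^sub>L A = - B \<and> A o\<^sub>L C = B"

definition comb :: "('e::real_normed_vector \<Rightarrow>\<^sub>L 'e) \<Rightarrow> ('e \<Rightarrow>\<^sub>L 'e) \<Rightarrow> ('e \<Rightarrow>\<^sub>L 'e) \<Rightarrow> real \<Rightarrow> real \<Rightarrow> real \<Rightarrow> 'e \<Rightarrow>\<^sub>L 'e"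
  where "comb A B C x y z = x *\<^sub>R A + y *\<^sub>R B + z *\<^sub>R C"

lemma para_triple_apply:
  assumes "para_triple A B C"
  shows "A (A v) = v" "B (B v) = v" "C (C v) = - v" "A (B v) = C v" "B (A v) = - C v"
    "B (C v) = - A v" "C (B v) = A v" "C (A v) = - B v" "A (C v) = B v"
  using assms[unfolded para_triple_def]
  by (auto dest!: arg_cong[of _ _ "\<lambda>F. blinfun_apply F v"] simp: blinfun.bilinear_simps)

lemma local_basis_iff:
  fixes M :: "('a, 'b::euclidean_space) mfd"
  shows "local_basis M \<sigma> U J \<longleftrightarrow> openin (mtop M) U \<and>
     tensor_field11 M U (J 1) \<and> tensor_field11 M U (J 2) \<and> tensor_field11 M U (J 3) \<and>
     (\<forall>y\<in>U. span {J 1 y, J 2 y, J 3 y} = \<sigma> y) \<and> (\<forall>y\<in>U. para_triple (J 1 y) (J 2 y) (J 3 y))"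
proof -
  have \<tau>: "\<tau> 1 = - 1" "\<tau> 2 = - 1" "\<tau> 3 = 1" by (simp_all add: \<tau>_def)
  have 2: "(F = - D \<and> - D = - E) \<longleftrightarrow> (F = - D \<and> E = D)" for D E F :: "'b \<Rightarrow>\<^sub>L 'b"
    by (metis minus_minus)
  have "para_triple (J 1 y) (J 2 y) (J 3 y) \<longleftrightarrow>
     (\<forall>a\<in>{1, 2, 3}. J a y o\<^sub>L J a y = - \<tau> a *\<^sub>R id_blinfun) \<and>
     (\<forall>(a, b, c)\<in>{(1, 2, 3), (2, 3, 1), (3, 1, 2)}.
        J a y o\<^sub>L J b y = \<tau> c *\<^sub>R J c y \<and> \<tau> c *\<^sub>R J c y = - (J b y o\<^sub>L J a y))" for y
    by (simp only: para_triple_def ball_simps prod.case \<tau> scaleR_one scaleR_minus1_left minus_minus 2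
        equation_minus_iff[of "J 3 y" "J 2 y o\<^sub>L J 1 y"] simp_thms conj_assoc)
  then show ?thesis
    unfolding local_basis_def by (simp only: ball_simps simp_thms ball_conj_distrib conj_assoc)
qed

lemma sign_changes_zero:
  fixes a b c d :: "'e::euclidean_space"
  assumes "a + b + c + d = 0" "a + b - c - d = 0" "a - b + c - d = 0" "- a + b + c - d = 0"
  shows "a = 0" "b = 0" "c = 0"
proof -
  have "a \<bullet> i = 0 \<and> b \<bullet> i = 0 \<and> c \<bullet> i = 0" for i
    using assms[THEN arg_cong, of "\<lambda>x. x \<bullet> i"] unfolding inner_simps by simp
  then show "a = 0" "b = 0" "c = 0" by (auto intro: euclidean_eqI)
qed

text \<open>Conjugation by \<open>A\<close>, \<open>B\<close> or \<open>C\<close> changes, up to a common sign, the signs of two of the four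
  coefficients; the four equations obtained in this way separate the terms.\<close>

lemma para_triple_independent:
  fixes A B C :: "'e::euclidean_space \<Rightarrow>\<^sub>L 'e"
  assumes P: "para_triple A B C" and zero: "s *\<^sub>R id_blinfun + comb A B C x y z = 0"
  shows "s = 0 \<and> x = 0 \<and> y = 0 \<and> z = 0"
proof -
  note T = para_triple_apply[OF P]
  have E: "s *\<^sub>R v + x *\<^sub>R A v + y *\<^sub>R B v + z *\<^sub>R C v = 0" for v
    using arg_cong[OF zero, of "\<lambda>F. blinfun_apply F v"]
    by (simp add: comb_def blinfun.bilinear_simps add.assoc)
  obtain v :: 'e where v: "v \<noteq> 0" using nonempty_Basis nonzero_Basis by blast
  \<comment> \<open>Evaluate at \<open>A v\<close> and apply \<open>A\<close>; likewise with \<open>B\<close> and \<open>C\<close>.\<close>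
  have E1: "s *\<^sub>R v + x *\<^sub>R A v - y *\<^sub>R B v - z *\<^sub>R C v = 0"
    using arg_cong[OF E[of "A v"], of A] by (simp add: T blinfun.bilinear_simps)
  have E2: "s *\<^sub>R v - x *\<^sub>R A v + y *\<^sub>R B v - z *\<^sub>R C v = 0"
    using arg_cong[OF E[of "B v"], of B] by (simp add: T blinfun.bilinear_simps)
  have E3: "- (s *\<^sub>R v) + x *\<^sub>R A v + y *\<^sub>R B v - z *\<^sub>R C v = 0"
    using arg_cong[OF E[of "C v"], of C] by (simp add: T blinfun.bilinear_simps)
  have s: "s *\<^sub>R v = 0" and x: "x *\<^sub>R A v = 0" and y: "y *\<^sub>R B v = 0"
    using sign_changes_zero[OF E E1 E2 E3] by auto
  have z: "z *\<^sub>R C v = 0" using E[of v] s x y by simp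
  have "A v \<noteq> 0" "B v \<noteq> 0" "C v \<noteq> 0"
    using T(1)[of v] T(2)[of v] T(3)[of v] v by (auto simp: blinfun.zero_right)
  then show ?thesis using s x y z v by auto
qed

lemma comb_eq_iff:
  fixes A B C :: "'e::euclidean_space \<Rightarrow>\<^sub>L 'e"
  assumes P: "para_triple A B C"
  shows "s *\<^sub>R id_blinfun + comb A B C x y z = s' *\<^sub>R id_blinfun + comb A B C x' y' z' \<longleftrightarrow>
    s = s' \<and> x = x' \<and> y = y' \<and> z = z'"
proof
  assume "s *\<^sub>R id_blinfun + comb A B C x y z = s' *\<^sub>R id_blinfun + comb A B C x' y' z'"
  then have "(s - s') *\<^sub>R id_blinfun + comb A B C (x - x') (y - y') (z - z') = 0"
    by (simp add: comb_def algebra_simps)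
  from para_triple_independent[OF P this] show "s = s' \<and> x = x' \<and> y = y' \<and> z = z'" by simp
qed auto

lemma comb_compose:
  assumes P: "para_triple A B C"
  shows "comb A B C x1 x2 x3 o\<^sub>L comb A B C y1 y2 y3 = (x1 * y1 + x2 * y2 - x3 * y3) *\<^sub>R id_blinfun
    + comb A B C (x3 * y2 - x2 * y3) (x1 * y3 - x3 * y1) (x1 * y2 - x2 * y1)"
  by (rule blinfun_eqI) (simp add: comb_def blinfun.bilinear_simps para_triple_apply[OF P] algebra_simps)

text \<open>Whether a product of two combinations equals a third is a condition on the coefficients that does
  not mention the triple.\<close>

lemma comb_compose_eq_iff:
  fixes A B C :: "'e::euclidean_space \<Rightarrow>\<^sub>L 'e"
  assumes P: "para_triple A B C"
  shows "comb A B C x1 x2 x3 o\<^sub>L comb A B C y1 y2 y3 = s *\<^sub>R id_blinfun + comb A B C z1 z2 z3 \<longleftrightarrow>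
    x1 * y1 + x2 * y2 - x3 * y3 = s \<and> x3 * y2 - x2 * y3 = z1 \<and> x1 * y3 - x3 * y1 = z2 \<and> x1 * y2 - x2 * y1 = z3"
  unfolding comb_compose[OF P] comb_eq_iff[OF P] ..

lemma comb_0: "comb A B C 0 0 0 = 0" and comb_uminus: "- comb A B C x y z = comb A B C (- x) (- y) (- z)"
  and comb_unit: "comb A B C 1 0 0 = A" "comb A B C 0 1 0 = B" "comb A B C 0 0 1 = C"
  by (simp_all add: comb_def)

lemma para_triple_comb_iff:
  fixes A B C :: "'e::euclidean_space \<Rightarrow>\<^sub>L 'e"
  shows "para_triple (comb A B C x1 x2 x3) (comb A B C y1 y2 y3) (comb A B C z1 z2 z3) \<longleftrightarrow>
    (let X = comb A B C x1 x2 x3; Y = comb A B C y1 y2 y3; Z = comb A B C z1 z2 z3 in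
     X o\<^sub>L X = 1 *\<^sub>R id_blinfun + comb A B C 0 0 0 \<and> Y o\<^sub>L Y = 1 *\<^sub>R id_blinfun + comb A B C 0 0 0 \<and>
     Z o\<^sub>L Z = (- 1) *\<^sub>R id_blinfun + comb A B C 0 0 0 \<and>
     X o\<^sub>L Y = 0 *\<^sub>R id_blinfun + comb A B C z1 z2 z3 \<and> Y o\<^sub>L X = 0 *\<^sub>R id_blinfun + comb A B C (- z1) (- z2) (- z3) \<and>
     Y o\<^sub>L Z = 0 *\<^sub>R id_blinfun + comb A B C (- x1) (- x2) (- x3) \<and> Z o\<^sub>L Y = 0 *\<^sub>R id_blinfun + comb A B C x1 x2 x3 \<and>
     Z o\<^sub>L X = 0 *\<^sub>R id_blinfun + comb A B C (- y1) (- y2) (- y3) \<and> X o\<^sub>L Z = 0 *\<^sub>R id_blinfun + comb A B C y1 y2 y3)"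
  unfolding para_triple_def Let_def comb_0 comb_uminus[symmetric] by simp

text \<open>Hence relations that hold for combinations of one triple hold for the combinations of any other
  triple with the same coefficients.\<close>

lemma para_triple_comb_transfer:
  fixes A B C A' B' C' :: "'e::euclidean_space \<Rightarrow>\<^sub>L 'e"
  assumes "para_triple A B C" "para_triple A' B' C'"
    and "para_triple (comb A B C x1 x2 x3) (comb A B C y1 y2 y3) (comb A B C z1 z2 z3)"
  shows "para_triple (comb A' B' C' x1 x2 x3) (comb A' B' C' y1 y2 y3) (comb A' B' C' z1 z2 z3)"
  using assms(3) unfolding para_triple_comb_iff Let_def comb_compose_eq_iff[OF assms(1)] comb_compose_eq_iff[OF assms(2)] .

lemma span_comb: "w \<in> span {A, B, C} \<longleftrightarrow> (\<exists>x y z. w = comb A B C x y z)"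
proof
  assume "w \<in> span {A, B, C}"
  then obtain x y z where "w - x *\<^sub>R A - y *\<^sub>R B - z *\<^sub>R C = 0"
    by (auto simp: span_insert)
  then have "w = comb A B C x y z" by (simp add: comb_def algebra_simps)
  then show "\<exists>x y z. w = comb A B C x y z" by blast
next
  assume "\<exists>x y z. w = comb A B C x y z"
  then show "w \<in> span {A, B, C}"
    by (auto simp: comb_def intro!: span_add span_scale intro: span_base)
qed

lemma comb_comb: "comb (comb A B C x1 x2 x3) (comb A B C y1 y2 y3) (comb A B C z1 z2 z3) a b c =
    comb A B C (a * x1 + b * y1 + c * z1) (a * x2 + b * y2 + c * z2) (a * x3 + b * y3 + c * z3)"
  by (simp add: comb_def algebra_simps)

text \<open>The inverse of the coefficient matrix does not depend on the triple either.\<close>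

lemma span_comb_transfer:
  fixes A B C A' B' C' :: "'e::euclidean_space \<Rightarrow>\<^sub>L 'e"
  assumes P: "para_triple A B C"
    and span: "span {comb A B C x1 x2 x3, comb A B C y1 y2 y3, comb A B C z1 z2 z3} = span {A, B, C}"
  shows "span {comb A' B' C' x1 x2 x3, comb A' B' C' y1 y2 y3, comb A' B' C' z1 z2 z3} = span {A', B', C'}"
    (is "?L = ?R")
proof
  show "?L \<subseteq> ?R"
  proof (rule span_minimal[OF _ subspace_span])
    show "{comb A' B' C' x1 x2 x3, comb A' B' C' y1 y2 y3, comb A' B' C' z1 z2 z3} \<subseteq> span {A', B', C'}"
      using span_comb by blast
  qed
  have transfer: "comb A' B' C' k l m \<in> ?L" if inS: "comb A B C k l m \<in> span {A, B, C}" for k l m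
  proof -
    obtain a b c where "comb A B C k l m
        = comb (comb A B C x1 x2 x3) (comb A B C y1 y2 y3) (comb A B C z1 z2 z3) a b c"
      using span_comb[THEN iffD1, OF inS[folded span]] by blast
    then have "k = a * x1 + b * y1 + c * z1 \<and> l = a * x2 + b * y2 + c * z2 \<and> m = a * x3 + b * y3 + c * z3"
      unfolding comb_comb using comb_eq_iff[OF P, of 0 k l m 0, simplified, THEN iffD1] by blast
    then have "comb A' B' C' k l m
        = comb (comb A' B' C' x1 x2 x3) (comb A' B' C' y1 y2 y3) (comb A' B' C' z1 z2 z3) a b c"
      unfolding comb_comb by simp
    then show ?thesis unfolding span_comb by blast
  qed
  show "?R \<subseteq> ?L"
  proof (rule span_minimal[OF _ subspace_span])
    show "{A', B', C'} \<subseteq> ?L"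
      using transfer[of 1 0 0] transfer[of 0 1 0] transfer[of 0 0 1]
      by (simp add: comb_unit span_base)
  qed
qed

lemma dim_span_para_triple:
  fixes A B C :: "'e::euclidean_space \<Rightarrow>\<^sub>L 'e"
  assumes P: "para_triple A B C"
  shows "dim (span {A, B, C}) = 3"
proof -
  have ind: "x = 0 \<and> y = 0 \<and> z = 0" if "comb A B C x y z = 0" for x y z
    using para_triple_independent[OF P, of 0 x y z] that by simp
  have 1: "A \<notin> span {B, C}"
  proof
    assume "A \<in> span {B, C}"
    then obtain y z where "A - y *\<^sub>R B - z *\<^sub>R C = 0" by (auto simp: span_insert)
    then have "comb A B C 1 (- y) (- z) = 0" by (simp add: comb_def)
    from ind[OF this] show False by simp
  qed
  have 2: "B \<notin> span {C}"
  proof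
    assume "B \<in> span {C}"
    then obtain z where "B - z *\<^sub>R C = 0" by (auto simp: span_insert)
    then have "comb A B C 0 1 (- z) = 0" by (simp add: comb_def)
    from ind[OF this] show False by simp
  qed
  have 3: "C \<noteq> 0" using ind[of 0 0 1] by (auto simp: comb_def)
  have ne: "A \<noteq> B" "A \<noteq> C" "B \<noteq> C" using 1 2 span_base[of B "{B, C}"] span_base[of C "{B, C}"] span_base[of C "{C}"] by auto
  have "independent {A, B, C}"
    using 1 2 3 ne by (simp add: independent_insert)
  then have "dim (span {A, B, C}) = card {A, B, C}" by (rule dim_span_eq_card_independent)
  then show ?thesis using ne by simp
qed

context smooth_atlas
begin

lemma local_basis_subset:
  "local_basis M \<sigma> U J \<Longrightarrow> openin (mtop M) V \<Longrightarrow> V \<subseteq> U \<Longrightarrow> local_basis M \<sigma> V J"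
  unfolding local_basis_iff using tensor_field11_subset by blast

lemma tensor_field11_comb:
  assumes U: "openin (mtop M) U" and A: "tensor_field11 M U A" and B: "tensor_field11 M U B" and C: "tensor_field11 M U C"
  shows "tensor_field11 M U (\<lambda>q. comb (A q) (B q) (C q) x y z)"
proof (rule tensor_field11I)
  fix c v assume c: "c \<in> charts M"
  note W = openin_cdom_Int[OF c U]
  let ?T = "\<lambda>J p. to_chart M c p (J p (of_chart M c p v))"
  have "smooth_in M (cdom c \<inter> U) (\<lambda>p. x *\<^sub>R ?T A p + y *\<^sub>R ?T B p + z *\<^sub>R ?T C p)"
    by (intro smooth_in_add smooth_in_scaleR smooth_in_const W tensor_field11D[OF U _ c] A B C)
  then show "smooth_in M (cdom c \<inter> U) (\<lambda>p. to_chart M c p (comb (A p) (B p) (C p) x y z (of_chart M c p v)))"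
    by (rule smooth_in_cong[OF W, rotated])
      (simp add: comb_def blinfun.bilinear_simps c linear_add[OF linear_to_chart] linear_scale[OF linear_to_chart])
qed

text \<open>Endomorphisms at \<open>p\<close> that form a triple are extended to \<open>V\<close> with constant coefficients with respect
  to the given local basis.\<close>

lemma local_basis_extend:
  assumes J: "local_basis M \<sigma> V J" and p: "p \<in> V"
    and j: "para_triple j1 j2 j3" "span {j1, j2, j3} = \<sigma> p"
  obtains J' where "local_basis M \<sigma> V J'" "J' 1 p = j1" "J' 2 p = j2" "J' 3 p = j3"
proof -
  define A where "A = J 1"
  define B where "B = J 2"
  define C where "C = J 3"
  have V: "openin (mtop M) V" and tensor: "tensor_field11 M V A" "tensor_field11 M V B" "tensor_field11 M V C"
    and sp: "\<And>q. q \<in> V \<Longrightarrow> span {A q, B q, C q} = \<sigma> q" and P: "\<And>q. q \<in> V \<Longrightarrow> para_triple (A q) (B q) (C q)"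
    using J unfolding local_basis_iff A_def B_def C_def by blast+
  have "j1 \<in> span {A p, B p, C p}" "j2 \<in> span {A p, B p, C p}" "j3 \<in> span {A p, B p, C p}"
    unfolding sp[OF p] j(2)[symmetric] by (auto intro: span_base)
  then obtain x1 x2 x3 y1 y2 y3 z1 z2 z3 where
    j1: "j1 = comb (A p) (B p) (C p) x1 x2 x3" and j2: "j2 = comb (A p) (B p) (C p) y1 y2 y3"
    and j3: "j3 = comb (A p) (B p) (C p) z1 z2 z3"
    unfolding span_comb by blast
  define X where "X q = comb (A q) (B q) (C q) x1 x2 x3" for q
  define Y where "Y q = comb (A q) (B q) (C q) y1 y2 y3" for q
  define Z where "Z q = comb (A q) (B q) (C q) z1 z2 z3" for q
  define J' where "J' a = (if a = 1 then X else if a = 2 then Y else Z)" for a :: nat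
  have J': "J' 1 = X" "J' 2 = Y" "J' 3 = Z" by (simp_all add: J'_def)
  have "para_triple (X q) (Y q) (Z q)" if "q \<in> V" for q
    using para_triple_comb_transfer[OF P[OF p] P[OF that]] j(1) unfolding j1 j2 j3 X_def Y_def Z_def by blast
  moreover have "span {X q, Y q, Z q} = \<sigma> q" if "q \<in> V" for q
    using span_comb_transfer[OF P[OF p]] j(2) sp[OF p] sp[OF that]
    unfolding j1 j2 j3 X_def Y_def Z_def by metis
  moreover have "tensor_field11 M V X" "tensor_field11 M V Y" "tensor_field11 M V Z"
    unfolding X_def[abs_def] Y_def[abs_def] Z_def[abs_def] by (intro tensor_field11_comb V tensor)+
  ultimately have "local_basis M \<sigma> V J'" unfolding local_basis_iff J' using V by blast
  then show ?thesis using that unfolding J' X_def Y_def Z_def j1 j2 j3 using J' X_def Y_def Z_def by metis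
qed

end

locale paraquaternionic_hermitian = semi_riemannian M g
  for M :: "('m, 'e::euclidean_space) mfd" and g +
  fixes \<sigma> :: "'m \<Rightarrow> ('e \<Rightarrow>\<^sub>L 'e) set"
    and C :: "('m set \<times> (nat \<Rightarrow> 'm \<Rightarrow> 'e \<Rightarrow>\<^sub>L 'e)) set"
  assumes hermitian: "almost_paraquaternionic_hermitian M \<sigma> g"
    and cover: "local_basis_cover M \<sigma> C"
begin

interpretation TM: smooth_atlas TM by (rule smooth_atlas_tangent_bundle)

lemma local_basis_exists: "p \<in> points M \<Longrightarrow> \<exists>U J. p \<in> U \<and> local_basis M \<sigma> U J"
  using hermitian unfolding almost_paraquaternionic_hermitian_def almost_paraquaternionic_def by blast

text \<open>The hypothesis on local bases is evaluated on coordinate fields, for a local basis restricted to a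
  chart domain, and extended to the fibre of \<open>\<sigma>\<close> by linearity.\<close>

lemma skew_adjoint:
  assumes p: "p \<in> points M" and F: "F \<in> \<sigma> p"
  shows "g p v (F w) + g p (F v) w = 0"
proof -
  note B = bilinear_metric[OF p]
  let ?S = "{F :: 'e \<Rightarrow>\<^sub>L 'e. \<forall>v w. g p v (F w) + g p (F v) w = 0}"
  have skew: "g q (X q) (J a q (Y q)) + g q (J a q (X q)) (Y q) = 0"
    if "local_basis M \<sigma> U J" "vector_field M U X" "vector_field M U Y" "a \<in> {1, 2, 3}" "q \<in> U" for U J X Y a q
    using hermitian that unfolding almost_paraquaternionic_hermitian_def by blast
  obtain U J where U: "p \<in> U" and J: "local_basis M \<sigma> U J" using local_basis_exists[OF p] by blast
  define c where "c = chart_at M p"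
  have c: "c \<in> charts M" "p \<in> cdom c" using p chart_at_charts in_chart_at by (auto simp: c_def)
  have Uo: "openin (mtop M) U" using J by (simp add: local_basis_iff)
  have W: "openin (mtop M) (cdom c \<inter> U)" by (rule openin_cdom_Int[OF c(1) Uo])
  have JW: "local_basis M \<sigma> (cdom c \<inter> U) J" by (rule local_basis_subset[OF J W]) auto
  have vf: "vector_field M (cdom c \<inter> U) (\<lambda>q. of_chart M c q u)" for u
    by (rule vector_field_subset[OF vector_field_const[OF c(1)]]) auto
  have "g p v (J a p w) + g p (J a p v) w = 0" if "a \<in> {1, 2, 3}" for a v w
    using skew[OF JW vf[of v] vf[of w] that, of p] U c(2) p by (simp add: c_def)
  then have "{J 1 p, J 2 p, J 3 p} \<subseteq> ?S" by auto
  moreover have "subspace ?S"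
  proof (rule subspaceI; clarsimp simp: blinfun.bilinear_simps bilinear_lzero[OF B] bilinear_rzero[OF B])
    fix F G :: "'e \<Rightarrow>\<^sub>L 'e" and v w
    assume FG: "\<forall>v w. g p v (F w) + g p (F v) w = 0" "\<forall>v w. g p v (G w) + g p (G v) w = 0"
    show "g p v (F w + G w) + g p (F v + G v) w = 0"
      using FG(1)[rule_format, of v w] FG(2)[rule_format, of v w]
      by (simp add: bilinear_ladd[OF B] bilinear_radd[OF B])
  next
    fix r and F :: "'e \<Rightarrow>\<^sub>L 'e" and v w
    assume F: "\<forall>v w. g p v (F w) + g p (F v) w = 0"
    have "g p v (r *\<^sub>R F w) + g p (r *\<^sub>R F v) w = r * (g p v (F w) + g p (F v) w)"
      by (simp add: bilinear_lmul[OF B] bilinear_rmul[OF B] distrib_left)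
    then show "g p v (r *\<^sub>R F w) + g p (r *\<^sub>R F v) w = 0" using F by simp
  qed
  ultimately have "span {J 1 p, J 2 p, J 3 p} \<subseteq> ?S"
    by (rule span_minimal)
  then show ?thesis using F J U by (auto simp: local_basis_iff)
qed

text \<open>The fibre of \<open>\<sigma>\<close> is spanned by each member of the covering that contains the base point, so all
  members together span the same space.\<close>

lemma lift_structure_eq:
  assumes p: "fst \<xi> \<in> points M"
  shows "lift_structure M g C \<xi> = lift_op \<xi> ` \<sigma> (fst \<xi>)"
proof -
  let ?p = "fst \<xi>"
  let ?S = "{J a ?p |U J a. (U, J) \<in> C \<and> ?p \<in> U \<and> a \<in> {1, 2, 3}}"
  have lb: "local_basis M \<sigma> U J" if "(U, J) \<in> C" for U J using cover that by (auto simp: local_basis_cover_def)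
  have "subspace (\<sigma> ?p)"
    using hermitian p unfolding almost_paraquaternionic_hermitian_def almost_paraquaternionic_def by blast
  moreover have "?S \<subseteq> \<sigma> ?p"
  proof
    fix F assume "F \<in> ?S"
    then obtain U J a where a: "(U, J) \<in> C" "?p \<in> U" "a \<in> {1, 2, 3}" "F = J a ?p" by blast
    then have "F \<in> span {J 1 ?p, J 2 ?p, J 3 ?p}" by (auto intro: span_base)
    then show "F \<in> \<sigma> ?p" using lb[OF a(1)] a(2) by (simp add: local_basis_iff)
  qed
  ultimately have "span ?S \<subseteq> \<sigma> ?p" by (rule span_minimal[rotated])
  moreover have "\<sigma> ?p \<subseteq> span ?S"
  proof -
    obtain U J where UJ: "(U, J) \<in> C" "?p \<in> U" using cover p by (auto simp: local_basis_cover_def)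
    then have "\<sigma> ?p = span {J 1 ?p, J 2 ?p, J 3 ?p}" using lb[OF UJ(1)] by (simp add: local_basis_iff)
    also have "\<dots> \<subseteq> span ?S" by (rule span_mono) (use UJ in auto)
    finally show ?thesis .
  qed
  ultimately have "span ?S = \<sigma> ?p" by blast
  moreover have "{lift_endo M g (J a) \<xi> |U J a. (U, J) \<in> C \<and> ?p \<in> U \<and> a \<in> {1, 2, 3}} = lift_op \<xi> ` ?S"
    unfolding lift_endo_eq[OF p] by blast
  ultimately show ?thesis
    unfolding lift_structure_def by (simp only: linear_span_image[OF linear_lift_op[OF p]])
qed

lemma para_triple_lift_op:
  assumes p: "fst \<xi> \<in> points M"
  shows "para_triple (lift_op \<xi> A) (lift_op \<xi> B) (lift_op \<xi> D) \<longleftrightarrow> para_triple A B D"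
proof -
  note L = linear_lift_op[OF p]
  have neg: "- lift_op \<xi> F = lift_op \<xi> (- F)" for F by (rule linear_neg[OF L, symmetric])
  show ?thesis
    unfolding para_triple_def lift_op_compose(1)[OF p] lift_op_compose(2)[OF p, symmetric] neg
      inj_eq[OF inj_lift_op[OF p]] ..
qed

lemma local_basis_lift:
  assumes J: "local_basis M \<sigma> U J"
  shows "local_basis TM (lift_structure M g C) (fst -` U) (\<lambda>a. lift_endo M g (J a))"
proof -
  have U: "openin (mtop M) U" using J by (simp add: local_basis_iff)
  have p: "fst \<xi> \<in> points M" if "\<xi> \<in> fst -` U" for \<xi> :: "'m \<times> 'e" using openin_points[OF U] that by auto
  show ?thesis
    unfolding local_basis_iff
  proof (intro conjI ballI openin_fst_vimage U tensor_field_lift_endo)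
    fix \<xi> :: "'m \<times> 'e" assume \<xi>: "\<xi> \<in> fst -` U"
    show "span {lift_endo M g (J 1) \<xi>, lift_endo M g (J 2) \<xi>, lift_endo M g (J 3) \<xi>} = lift_structure M g C \<xi>"
      using linear_span_image[OF linear_lift_op[OF p[OF \<xi>]], of "{J 1 (fst \<xi>), J 2 (fst \<xi>), J 3 (fst \<xi>)}"] J \<xi>
      unfolding lift_endo_eq[OF p[OF \<xi>]] lift_structure_eq[OF p[OF \<xi>]] by (simp add: local_basis_iff)
    show "para_triple (lift_endo M g (J 1) \<xi>) (lift_endo M g (J 2) \<xi>) (lift_endo M g (J 3) \<xi>)"
      unfolding lift_endo_eq[OF p[OF \<xi>]] para_triple_lift_op[OF p[OF \<xi>]] using J \<xi> by (simp add: local_basis_iff)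
  qed (use J in \<open>auto simp: local_basis_iff\<close>)
qed

lemma almost_paraquaternionic_tangent_bundle:
  "almost_paraquaternionic TM (lift_structure M g C)"
  unfolding almost_paraquaternionic_def
proof (intro conjI ballI)
  show "smooth_manifold TM"
    using hermitian smooth_manifold_tangent_bundle
    unfolding almost_paraquaternionic_hermitian_def almost_paraquaternionic_def by blast
  fix \<xi> assume "\<xi> \<in> points TM"
  then have p: "fst \<xi> \<in> points M" by (auto simp: points_tangent_bundle)
  show "subspace (lift_structure M g C \<xi>)" unfolding lift_structure_def by (rule subspace_span)
  obtain U J where U: "fst \<xi> \<in> U" and J: "local_basis M \<sigma> U J" using local_basis_exists[OF p] by blast
  note LJ = local_basis_lift[OF J]
  show "\<exists>U J. \<xi> \<in> U \<and> local_basis TM (lift_structure M g C) U J" using LJ U by blast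
  show "dim (lift_structure M g C \<xi>) = 3"
    using LJ U dim_span_para_triple unfolding local_basis_iff by (metis vimageI2)
qed

lemma hermitian_tangent_bundle:
  "almost_paraquaternionic_hermitian TM (lift_structure M g C) (sasaki_metric M g)"
  unfolding almost_paraquaternionic_hermitian_def
proof (intro conjI allI impI ballI almost_paraquaternionic_tangent_bundle semi_riemannian_sasaki)
  fix U K X Y and a :: nat and \<xi>
  assume K: "local_basis TM (lift_structure M g C) U K" and a: "a \<in> {1, 2, 3}" and \<xi>: "\<xi> \<in> U"
  have p: "fst \<xi> \<in> points M"
    using K \<xi> TM.openin_points unfolding local_basis_iff points_tangent_bundle by (metis mem_Times_iff)
  have "K a \<xi> \<in> span {K 1 \<xi>, K 2 \<xi>, K 3 \<xi>}" using a by (auto intro: span_base)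
  then have "K a \<xi> \<in> lift_op \<xi> ` \<sigma> (fst \<xi>)"
    using K \<xi> lift_structure_eq[OF p] by (simp add: local_basis_iff)
  then obtain F where F: "F \<in> \<sigma> (fst \<xi>)" "K a \<xi> = lift_op \<xi> F" by blast
  show "sasaki_metric M g \<xi> (X \<xi>) (K a \<xi> (Y \<xi>)) + sasaki_metric M g \<xi> (K a \<xi> (X \<xi>)) (Y \<xi>) = 0"
    using skew_adjoint[OF p F(1), of "fst (X \<xi>)" "fst (Y \<xi>)"]
      skew_adjoint[OF p F(1), of "vpart \<xi> (X \<xi>)" "vpart \<xi> (Y \<xi>)"]
    by (simp add: sasaki_metric_eq[OF p] F(2) lift_op_parts[OF p])
qed

text \<open>At \<open>\<xi>\<close> the local basis is the lift of a triple in the fibre of \<open>\<sigma>\<close>.  The extension \<open>J'\<close> of this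
  triple to a neighbourhood in the base has a lift that agrees with the local basis at \<open>\<xi>\<close> and is
  related to \<open>J'\<close> by the projection.\<close>

lemma paraholomorphic_fst:
  "paraholomorphic TM (lift_structure M g C) M \<sigma> fst"
  unfolding paraholomorphic_def
proof (intro conjI ballI allI impI smooth_map_fst, elim conjE)
  fix \<xi> U J
  assume "\<xi> \<in> points TM" and \<xi>: "\<xi> \<in> U"
    and J: "local_basis TM (lift_structure M g C) U J"
  then have p: "fst \<xi> \<in> points M" by (auto simp: points_tangent_bundle)
  let ?L = "lift_op \<xi>"
  obtain V J0 where V: "fst \<xi> \<in> V" and J0: "local_basis M \<sigma> V J0" using local_basis_exists[OF p] by blast
  have Vo: "openin (mtop M) V" using J0 by (simp add: local_basis_iff)
  have Uo: "openin (mtop TM) U" using J by (simp add: local_basis_iff)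
  have sp: "span {J 1 \<xi>, J 2 \<xi>, J 3 \<xi>} = ?L ` \<sigma> (fst \<xi>)" and P: "para_triple (J 1 \<xi>) (J 2 \<xi>) (J 3 \<xi>)"
    using J \<xi> lift_structure_eq[OF p] by (simp_all add: local_basis_iff)
  have "J 1 \<xi> \<in> ?L ` \<sigma> (fst \<xi>)" "J 2 \<xi> \<in> ?L ` \<sigma> (fst \<xi>)" "J 3 \<xi> \<in> ?L ` \<sigma> (fst \<xi>)"
    unfolding sp[symmetric] by (auto intro: span_base)
  then obtain j1 j2 j3 where j: "J 1 \<xi> = ?L j1" "J 2 \<xi> = ?L j2" "J 3 \<xi> = ?L j3" by blast
  have j_para: "para_triple j1 j2 j3" using P unfolding j para_triple_lift_op[OF p] .
  have "?L ` span {j1, j2, j3} = ?L ` \<sigma> (fst \<xi>)"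
    using sp linear_span_image[OF linear_lift_op[OF p], of "{j1, j2, j3}"] by (simp add: j del: One_nat_def)
  then have j_span: "span {j1, j2, j3} = \<sigma> (fst \<xi>)" by (simp add: inj_image_eq_iff[OF inj_lift_op[OF p]])
  obtain J' where J': "local_basis M \<sigma> V J'" "J' 1 (fst \<xi>) = j1" "J' 2 (fst \<xi>) = j2" "J' 3 (fst \<xi>) = j3"
    using local_basis_extend[OF J0 V j_para j_span] .
  let ?K = "\<lambda>a. lift_endo M g (J' a)"
  have "local_basis TM (lift_structure M g C) (U \<inter> fst -` V) ?K"
    by (rule TM.local_basis_subset[OF local_basis_lift[OF J'(1)]]) (use Uo openin_fst_vimage[OF Vo] in auto)
  moreover have "\<forall>a\<in>{1, 2, 3}. ?K a \<xi> = J a \<xi>"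
    using J'(2-4) by (simp add: lift_endo_eq[OF p] j del: One_nat_def)
  moreover have "\<forall>\<eta>\<in>U \<inter> fst -` V. \<forall>a\<in>{1, 2, 3}.
      blinfun_apply (J' a (fst \<eta>)) \<circ> mderiv TM M fst \<eta> =
      mderiv TM M fst \<eta> \<circ> blinfun_apply (?K a \<eta>)"
  proof (intro ballI)
    fix \<eta> :: "'m \<times> 'e" and a assume "\<eta> \<in> U \<inter> fst -` V"
    then have "fst \<eta> \<in> points M" using openin_points[OF Vo] by auto
    then show "blinfun_apply (J' a (fst \<eta>)) \<circ> mderiv TM M fst \<eta> =
      mderiv TM M fst \<eta> \<circ> blinfun_apply (?K a \<eta>)"
      by (auto simp: mderiv_fst lift_endo_eq lift_op_parts)
  qed
  ultimately show "\<exists>U' J' K. fst \<xi> \<in> U' \<and> local_basis M \<sigma> U' J' \<and>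
      local_basis TM (lift_structure M g C) (U \<inter> fst -` U') K \<and>
      (\<forall>a\<in>{1, 2, 3}. K a \<xi> = J a \<xi>) \<and>
      (\<forall>\<eta>\<in>U \<inter> fst -` U'. \<forall>a\<in>{1, 2, 3}. blinfun_apply (J' a (fst \<eta>)) \<circ> mderiv TM M fst \<eta> =
        mderiv TM M fst \<eta> \<circ> blinfun_apply (K a \<eta>))"
    using V J'(1) by blast
qed

end

theorem proposition5p2:
  fixes M :: "('m, 'e::euclidean_space) mfd"
    and \<sigma> :: "'m \<Rightarrow> ('e \<Rightarrow>\<^sub>L 'e) set"
    and g :: "'m \<Rightarrow> 'e \<Rightarrow> 'e \<Rightarrow> real"
    and C :: "('m set \<times> (nat \<Rightarrow> 'm \<Rightarrow> 'e \<Rightarrow>\<^sub>L 'e)) set"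
  assumes "almost_paraquaternionic_hermitian M \<sigma> g"
    and "local_basis_cover M \<sigma> C"
  shows "(\<forall>U J. local_basis M \<sigma> U J \<longrightarrow>
            local_basis (tangent_bundle M) (lift_structure M g C) (fst -` U)
              (\<lambda>a. lift_endo M g (J a))) \<and>
         almost_paraquaternionic_hermitian (tangent_bundle M) (lift_structure M g C)
           (sasaki_metric M g) \<and>
         paraquaternionic_submersion (tangent_bundle M) (lift_structure M g C) (sasaki_metric M g)
           M \<sigma> g fst"
proof -
  have "smooth_manifold M" "semi_riemannian_metric M g"
    using assms(1) by (auto simp: almost_paraquaternionic_hermitian_def almost_paraquaternionic_def)
  then interpret paraquaternionic_hermitian M g \<sigma> C
    by (intro paraquaternionic_hermitian.intro semi_riemannian.intro smooth_manifold_atlas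
        semi_riemannian_axioms.intro paraquaternionic_hermitian_axioms.intro assms)
  show ?thesis
    unfolding paraquaternionic_submersion_def
    using local_basis_lift hermitian_tangent_bundle semi_riemannian_submersion_fst paraholomorphic_fst by blast
qed

end
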